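(* With all quantities as defined in the context, there is a constant $C$ (independent of $n$) such that $$\sum_{\bar{w}, \bar{l}} \frac{N(\bar{w}, \bar{l})}{N_0} \, \le \, C\cdot 3^{(1- \gamma )n},$$ where the sum ranges over all triples $\bar{w}=(w_0,w_1,w_2)$ of nonnegative integers with $w_0+w_1+w_2=n$ and all triples $\bar{l}=(l_0,l_1,l_2)$ of nonnegative integers with $l_0+l_1+l_2=km$.
   Context: Setting: random systems of equations modulo 3 of the form $x_1+\dots+x_k=a$, $a\in\{0,1,2\}$, where $x_1,\dots,x_k$ is an ordered $k$-tuple of variables from a set of $n$ variables; a formula consists of $m=\gamma n$ such equations (with $\gamma$ bounded above by a constant $<1$, $k$ constant) in which every variable occupies at least two of the $km$ slots (a $2$-core). For integers $m,n$ let $M(m,n)=\sum_{v_1,\dots,v_n\ge 2}\binom{m}{v_1,\dots,v_n}$, and $N_0=M(km,n)$ (so $N_0\cdot 3^m$ is the number of such formulas). For $\bar{l}=(l_0,l_1,l_2)$ with $\sum_i l_i=km$, let $\mathcal{K}(\bar{l})$ be the set of $3\times m$ integer matrices $(k_{i,j})_{0\le i\le 2,1\le j\le m}$ with nonnegative entries, each column summing to $k$, row $i$ summing to $l_i$, and $k_{1,j}\equiv k_{2,j}\pmod 3$ for each $j$; let $K(\bar{l})=\sum_{(k_{i,j})\in\mathcal{K}(\bar{l})}\prod_{j=1}^m\binom{k}{k_{0,j},k_{1,j},k_{2,j}}$. For $\bar{w}=(w_0,w_1,w_2)$ with $\sum_i w_i=n$ define $N(\bar{w},\bar{l})=\binom{n}{w_0,w_1,w_2}\cdot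 K(\bar{l})\cdot\prod_{i=0}^2 M(l_i,w_i)$. (Combinatorially, for a fixed assignment $a$, $N(\bar w,\bar l)$ counts pairs $(b,F)$ of an assignment $b$ and a formula $F$ true under both $a$ and $b$, such that the set $W_i=\{x: b(x)=a(x)+i \bmod 3\}$ has $w_i$ elements and its variables occupy exactly $l_i$ slots of $F$.) Let $Q(x)=x(e^x-1)/(e^x-x-1)$ and define $s$ by $Q(s)=k\gamma$; the proof uses that $s$ is sufficiently large ($s\ge 15$, which holds e.g. for $k\ge 15$ and $k\gamma$ large enough as in the paper's main theorem for $k>15$). *)

theory Defs
  imports Complex_Main "HOL-Library.FuncSet"
begin

text \<open>
  Families indexed by a finite set \<open>I\<close> (tuples, and matrices with \<open>I\<close> a product of index sets)
  are functions in \<open>I \<rightarrow>\<^sub>E UNIV\<close>, that is, with a fixed value outside \<open>I\<close>, so that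
  distinct families are distinct functions.  Counts are real numbers, because they occur only in
  quotients.
\<close>

definition tuples_sum :: "'i set \<Rightarrow> nat \<Rightarrow> ('i \<Rightarrow> nat) set" where
  "tuples_sum I N = {v \<in> I \<rightarrow>\<^sub>E UNIV. (\<Sum>i\<in>I. v i) = N}"

lemma finite_tuples_sum:
  assumes "finite I"
  shows "finite (tuples_sum I N)"
proof (rule finite_subset)
  show "tuples_sum I N \<subseteq> I \<rightarrow>\<^sub>E {..N}"
  proof
    fix v assume v: "v \<in> tuples_sum I N"
    then have "v i \<le> N" if "i \<in> I" for i
      using assms that member_le_sum[of i I v] by (auto simp: tuples_sum_def)
    with v show "v \<in> I \<rightarrow>\<^sub>E {..N}"
      by (simp add: tuples_sum_def PiE_iff)
  qed
  show "finite (I \<rightarrow>\<^sub>E {..N})"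
    using assms by (intro finite_PiE) auto
qed

text \<open>Only meaningful if the values of \<open>v\<close> on \<open>I\<close> add up to \<open>N\<close>, as in all uses below.\<close>

definition multinomial :: "nat \<Rightarrow> 'i set \<Rightarrow> ('i \<Rightarrow> nat) \<Rightarrow> real" where
  "multinomial N I v = fact N / (\<Prod>i\<in>I. fact (v i))"

text \<open>The sum may be restricted to tuples with sum \<open>m\<close>, since the other multinomial
  coefficients vanish by convention.\<close>

definition M :: "nat \<Rightarrow> nat \<Rightarrow> real" where
  "M m n = (\<Sum>v \<in> {v \<in> tuples_sum {1..n} m. \<forall>i\<in>{1..n}. 2 \<le> v i}. multinomial m {1..n} v)"

definition N0 :: "nat \<Rightarrow> nat \<Rightarrow> nat \<Rightarrow> real" where
  "N0 k m n = M (k * m) n"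

definition K_set :: "nat \<Rightarrow> nat \<Rightarrow> (nat \<Rightarrow> nat) \<Rightarrow> (nat \<times> nat \<Rightarrow> nat) set" where
  "K_set k m l = {\<kappa> \<in> {0..2} \<times> {1..m} \<rightarrow>\<^sub>E UNIV.
     (\<forall>j\<in>{1..m}. (\<Sum>i\<in>{0..2}. \<kappa> (i, j)) = k) \<and>
     (\<forall>i\<in>{0..2}. (\<Sum>j\<in>{1..m}. \<kappa> (i, j)) = l i) \<and>
     (\<forall>j\<in>{1..m}. \<kappa> (1, j) mod 3 = \<kappa> (2, j) mod 3)}"

lemma finite_K_set: "finite (K_set k m l)"
proof (rule finite_subset)
  have *: "\<kappa> (i, j) \<le> k" if "\<kappa> \<in> K_set k m l" "i \<in> {0..2}" "j \<in> {1..m}" for \<kappa> i j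
  proof -
    have "\<kappa> (i, j) \<le> (\<Sum>i\<in>{0..2}. \<kappa> (i, j))"
      using that(2) by (intro member_le_sum) auto
    also have "\<dots> = k"
      using that by (simp add: K_set_def)
    finally show ?thesis .
  qed
  show "K_set k m l \<subseteq> {0..2} \<times> {1..m} \<rightarrow>\<^sub>E {..k}"
  proof
    fix \<kappa> assume \<kappa>: "\<kappa> \<in> K_set k m l"
    then have "\<kappa> \<in> extensional ({0..2} \<times> {1..m})"
      by (simp add: K_set_def PiE_iff)
    moreover have "\<kappa> p \<in> {..k}" if "p \<in> {0..2} \<times> {1..m}" for p
      using that *[OF \<kappa>] by (cases p) auto
    ultimately show "\<kappa> \<in> {0..2} \<times> {1..m} \<rightarrow>\<^sub>E {..k}"
      unfolding PiE_iff by blast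
  qed
  show "finite ({0..2::nat} \<times> {1..m} \<rightarrow>\<^sub>E {..k})"
    by (intro finite_PiE) auto
qed

definition K :: "nat \<Rightarrow> nat \<Rightarrow> (nat \<Rightarrow> nat) \<Rightarrow> real" where
  "K k m l = (\<Sum>\<kappa> \<in> K_set k m l. \<Prod>j\<in>{1..m}. multinomial k {0..2} (\<lambda>i. \<kappa> (i, j)))"

definition N :: "nat \<Rightarrow> nat \<Rightarrow> nat \<Rightarrow> (nat \<Rightarrow> nat) \<Rightarrow> (nat \<Rightarrow> nat) \<Rightarrow> real" where
  "N k m n w l = multinomial n {0..2} w * K k m l * (\<Prod>i\<in>{0..2}. M (l i) (w i))"

definition Q :: "real \<Rightarrow> real" where
  "Q x = x * (exp x - 1) / (exp x - x - 1)"

end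

theory Submission
  imports Defs "HOL-Analysis.Analysis" "HOL-Computational_Algebra.Formal_Power_Series"
begin

text \<open>
  The sum is the expected number of vectors in the kernel, modulo 3, of the random \<open>m \<times> n\<close> incidence matrix of a formula.  This kernel has \<open>3\<^sup>n\<^sup>-\<^sup>m\<close> times as many elements as the
  kernel of the transposed matrix, so it suffices to bound the expected number of \<open>c \<in> {0,1,2}\<^sup>m\<close>
  with \<open>c\<^sup>T A = 0\<close>.  The vector \<open>c = 0\<close> contributes exactly 1.  All other contributions
  together are bounded, and polynomial losses do not matter for them: for \<open>c\<close> with few non-zero
  entries, every variable touched by them occurs in at least two of their slots, which costs a
  large power of \<open>n\<close> since \<open>k \<ge> 15\<close>, and for \<open>c\<close> with many non-zero entries the total is exponentially
  small because \<open>\<gamma> \<le> \<gamma>\<^sub>0 < 1\<close>.  Both estimates come from bounding the coefficient of an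
  exponential generating function in three variables at a positive point by its value.  The denominator
  \<open>N\<^sub>0\<close> is bounded below, up to a factor linear in \<open>n\<close>, by its saddle point value, using that the
  coefficients of \<open>(e\<^sup>x - x - 1)\<^sup>n\<close> are log-concave.
\<close>

section \<open>Functions with prescribed fibre sizes\<close>

text \<open>A direct estimate would have to be exact up to a constant factor wherever
  \<open>N k m n w l\<close> is largest, summed over many comparable terms. In the transposed sum
  the leading term is a single vector, and all others leave room for crude bounds. Moreover, for
  fixed \<open>c\<close> the conditions on a formula are separate for each variable, so the
  generating function is an n-th power.

  The budget is this. Grouping \<open>c\<close> by the size q of its support, the crude bounds lose
  a factor of order q m n, and there are m groups, so each group has to come out as O(1/m) relative
  to \<open>N0\<close>. Few and many are divided at s q / m = 1/2. Below, non-zero slots get the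
  weight sqrt (s q / m), because the bound for a single variable begins with the square of that
  weight. Above, zero and non-zero slots get the weights s (1 - q / m) and s q / m, in proportion to
  their numbers, and the entropy factors of the slots cancel exactly.\<close>

lemma sum_PiE_insert:
  fixes F :: "('a \<Rightarrow> 'b) \<Rightarrow> 'c::comm_monoid_add"
  assumes "a \<notin> A"
  shows "(\<Sum>f\<in>insert a A \<rightarrow>\<^sub>E B. F f) = (\<Sum>b\<in>B. \<Sum>g\<in>A \<rightarrow>\<^sub>E B. F (g(a := b)))"
proof -
  have "(\<Sum>f\<in>insert a A \<rightarrow>\<^sub>E B. F f) = (\<Sum>x\<in>B \<times> (A \<rightarrow>\<^sub>E B). F ((\<lambda>(y, g). g(a := y)) x))"
    unfolding PiE_insert_eq
    by (subst sum.reindex[OF inj_combinator[OF assms, of "\<lambda>_. B"]]) (simp_all add: o_def)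
  also have "\<dots> = (\<Sum>b\<in>B. \<Sum>g\<in>A \<rightarrow>\<^sub>E B. F (g(a := b)))"
    by (simp add: sum.cartesian_product case_prod_beta)
  finally show ?thesis .
qed

lemma card_filter_sum: "finite S \<Longrightarrow> card {x \<in> S. P x} = (\<Sum>x\<in>S. if P x then 1 else 0)"
  by (simp flip: sum.inter_filter)

text \<open>The colours \<open>col\<close> allow the same count to be used for functions whose fibres are
  prescribed within each colour class of the domain.\<close>

lemma card_functions_coloured_fibres:
  fixes col :: "'a \<Rightarrow> 'i" and v :: "'i \<Rightarrow> 'b \<Rightarrow> nat"
  assumes "finite A" "finite B" "finite I" "col ` A \<subseteq> I"
    and "\<And>i. i \<in> I \<Longrightarrow> (\<Sum>b\<in>B. v i b) = card {a\<in>A. col a = i}"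
  shows "card {f \<in> A \<rightarrow>\<^sub>E B. \<forall>i\<in>I. \<forall>b\<in>B. card {a\<in>A. col a = i \<and> f a = b} = v i b}
           * (\<Prod>i\<in>I. \<Prod>b\<in>B. fact (v i b)) = (\<Prod>i\<in>I. fact (card {a\<in>A. col a = i}))"
  using assms
proof (induction A arbitrary: v rule: finite_induct)
  case empty
  then have z: "\<forall>i\<in>I. \<forall>b\<in>B. v i b = 0" by simp
  then have e: "{f \<in> {} \<rightarrow>\<^sub>E B. \<forall>i\<in>I. \<forall>b\<in>B. card {a\<in>{}. col a = i \<and> f a = b} = v i b} = {\<lambda>_. undefined}"
    by auto
  show ?case unfolding e using z by simp
next
  case (insert a A)
  let ?i = "col a"
  have i: "?i \<in> I" using insert.prems by auto
  \<comment> \<open>Sending \<open>a\<close> to \<open>b\<close> leaves the demand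
    \<open>w b\<close> for the rest of the domain. Passing from \<open>v\<close> to
    \<open>w b\<close> divides the product of factorials by \<open>v (col a) b\<close>, and over all
    \<open>b\<close> these numbers add up to the size of the colour class of \<open>a\<close>. The
    truncated subtraction is harmless, since \<open>v (col a) b = 0\<close> is a case of its
    own.\<close>
  define w where "w b = v(?i := (v ?i)(b := v ?i b - 1))" for b
  define P where "P = (\<Prod>i\<in>I. \<Prod>b\<in>B. fact (v i b) :: nat)"
  have cnt: "card {a'\<in>insert a A. col a' = i' \<and> (g(a := b)) a' = b'}
     = card {a'\<in>A. col a' = i' \<and> g a' = b'} + (if i' = ?i \<and> b' = b then 1 else 0)" for g i' b b'
  proof -
    have "{a'\<in>insert a A. col a' = i' \<and> (g(a := b)) a' = b'}
      = (if i' = ?i \<and> b' = b then insert a {a'\<in>A. col a' = i' \<and> g a' = b'} else {a'\<in>A. col a' = i' \<and> g a' = b'})"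
      using insert.hyps by auto
    then show ?thesis using insert.hyps by auto
  qed
  have colc: "card {a'\<in>insert a A. col a' = i'} = card {a'\<in>A. col a' = i'} + (if i' = ?i then 1 else 0)" for i'
  proof -
    have "{a'\<in>insert a A. col a' = i'} = (if i' = ?i then insert a {a'\<in>A. col a' = i'} else {a'\<in>A. col a' = i'})"
      by auto
    then show ?thesis using insert.hyps by auto
  qed
  have step: "card {g \<in> A \<rightarrow>\<^sub>E B. \<forall>i'\<in>I. \<forall>b'\<in>B. card {a'\<in>insert a A. col a' = i' \<and> (g(a := b)) a' = b'} = v i' b'} * P
     = v ?i b * (\<Prod>i\<in>I. fact (card {a\<in>A. col a = i}))" if b: "b \<in> B" for b
  proof (cases "v ?i b = 0")
    case True
    have "\<not> (\<forall>i'\<in>I. \<forall>b'\<in>B. card {a'\<in>insert a A. col a' = i' \<and> (g(a := b)) a' = b'} = v i' b')" for g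
    proof
      assume "\<forall>i'\<in>I. \<forall>b'\<in>B. card {a'\<in>insert a A. col a' = i' \<and> (g(a := b)) a' = b'} = v i' b'"
      then have "card {a'\<in>insert a A. col a' = ?i \<and> (g(a := b)) a' = b} = v ?i b" using i b by blast
      then show False using True unfolding cnt by simp
    qed
    then have "{g \<in> A \<rightarrow>\<^sub>E B. \<forall>i'\<in>I. \<forall>b'\<in>B. card {a'\<in>insert a A. col a' = i' \<and> (g(a := b)) a' = b'} = v i' b'} = {}"
      by blast
    then show ?thesis by (simp only: True card.empty mult_0)
  next
    case False
    have eq1: "{g \<in> A \<rightarrow>\<^sub>E B. \<forall>i'\<in>I. \<forall>b'\<in>B. card {a'\<in>insert a A. col a' = i' \<and> (g(a := b)) a' = b'} = v i' b'}
       = {g \<in> A \<rightarrow>\<^sub>E B. \<forall>i'\<in>I. \<forall>b'\<in>B. card {a'\<in>A. col a' = i' \<and> g a' = b'} = w b i' b'}"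
    proof -
      have "(c + (if i' = ?i \<and> b' = b then 1 else 0) = v i' b') = (c = w b i' b')" for c i' b'
        using False by (auto simp: w_def)
      then show ?thesis unfolding cnt by simp
    qed
    have eq2: "P = v ?i b * (\<Prod>i\<in>I. \<Prod>b'\<in>B. fact (w b i b'))"
    proof -
      have "P = (\<Prod>b'\<in>B. fact (v ?i b')) * (\<Prod>i\<in>I - {?i}. \<Prod>b\<in>B. fact (v i b))"
        unfolding P_def using i insert.prems by (subst prod.remove[of _ ?i]) auto
      also have "(\<Prod>b'\<in>B. fact (v ?i b') :: nat) = fact (v ?i b) * (\<Prod>b'\<in>B-{b}. fact (v ?i b'))"
        using b insert.prems by (subst prod.remove[of _ b]) auto
      also have "fact (v ?i b) = v ?i b * (fact (v ?i b - 1) :: nat)"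
        using False by (simp add: fact_reduce)
      also have "(\<Prod>b'\<in>B-{b}. fact (v ?i b') :: nat) = (\<Prod>b'\<in>B-{b}. fact (w b ?i b'))"
        by (intro prod.cong) (auto simp: w_def)
      also have "(\<Prod>i\<in>I - {?i}. \<Prod>b\<in>B. fact (v i b) :: nat) = (\<Prod>i\<in>I - {?i}. \<Prod>b'\<in>B. fact (w b i b'))"
        by (intro prod.cong) (auto simp: w_def)
      also have "v ?i b * fact (v ?i b - 1) * (\<Prod>b'\<in>B-{b}. fact (w b ?i b')) = v ?i b * (\<Prod>b'\<in>B. fact (w b ?i b'))"
        using b insert.prems by (subst prod.remove[of _ b]) (auto simp: w_def)
      also have "\<dots> * (\<Prod>i\<in>I - {?i}. \<Prod>b'\<in>B. fact (w b i b')) = v ?i b * (\<Prod>i\<in>I. \<Prod>b'\<in>B. fact (w b i b'))"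
        using i insert.prems by (subst (2) prod.remove[of _ ?i]) (auto simp: mult.assoc)
      finally show ?thesis .
    qed
    have eq3: "(\<Sum>b'\<in>B. w b i' b') = card {a\<in>A. col a = i'}" if i': "i' \<in> I" for i'
    proof (cases "i' = ?i")
      case True
      have "(\<Sum>b'\<in>B. w b i' b') + 1 = (\<Sum>b'\<in>B. v ?i b')"
      proof -
        have "(\<Sum>b'\<in>B. w b i' b') = w b ?i b + (\<Sum>b'\<in>B-{b}. w b ?i b')"
          using b insert.prems True by (subst sum.remove[of _ b]) auto
        also have "(\<Sum>b'\<in>B-{b}. w b ?i b') = (\<Sum>b'\<in>B-{b}. v ?i b')"
          by (intro sum.cong) (auto simp: w_def)
        finally show ?thesis
          using b insert.prems(1) False by (subst (2) sum.remove[of _ b]) (auto simp: w_def)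
      qed
      then show ?thesis using insert.prems(4)[OF i] colc[of ?i] True by simp
    next
      case False
      then show ?thesis using insert.prems(4)[OF i'] colc[of i'] by (simp add: w_def)
    qed
    have "col ` A \<subseteq> I" using insert.prems by auto
    then have "card {g \<in> A \<rightarrow>\<^sub>E B. \<forall>i'\<in>I. \<forall>b'\<in>B. card {a'\<in>A. col a' = i' \<and> g a' = b'} = w b i' b'}
        * (\<Prod>i\<in>I. \<Prod>b'\<in>B. fact (w b i b')) = (\<Prod>i\<in>I. fact (card {a\<in>A. col a = i}))"
      using insert.prems(1,2) eq3 by (intro insert.IH)
    then show ?thesis
      unfolding eq1 eq2 mult.left_commute[of _ "v ?i b"] by (rule arg_cong)
  qed
  have "card {f \<in> insert a A \<rightarrow>\<^sub>E B. \<forall>i\<in>I. \<forall>b\<in>B. card {a'\<in>insert a A. col a' = i \<and> f a' = b} = v i b}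
     = (\<Sum>f\<in>insert a A \<rightarrow>\<^sub>E B. if \<forall>i\<in>I. \<forall>b\<in>B. card {a'\<in>insert a A. col a' = i \<and> f a' = b} = v i b then 1 else 0)"
    using insert.hyps insert.prems by (intro card_filter_sum finite_PiE) auto
  also have "\<dots> = (\<Sum>b\<in>B. card {g \<in> A \<rightarrow>\<^sub>E B. \<forall>i'\<in>I. \<forall>b'\<in>B. card {a'\<in>insert a A. col a' = i' \<and> (g(a := b)) a' = b'} = v i' b'})"
    unfolding sum_PiE_insert[OF insert.hyps(2)] using insert.hyps insert.prems
    by (intro sum.cong refl card_filter_sum[symmetric] finite_PiE) auto
  finally have "card {f \<in> insert a A \<rightarrow>\<^sub>E B. \<forall>i\<in>I. \<forall>b\<in>B. card {a'\<in>insert a A. col a' = i \<and> f a' = b} = v i b} * P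
     = (\<Sum>b\<in>B. v ?i b * (\<Prod>i\<in>I. fact (card {a\<in>A. col a = i})))"
    by (simp only: sum_distrib_right step cong: sum.cong)
  also have "\<dots> = card {a'\<in>insert a A. col a' = ?i} * (\<Prod>i\<in>I. fact (card {a\<in>A. col a = i}))"
    by (simp only: sum_distrib_right[symmetric] insert.prems(4)[OF i])
  also have "\<dots> = (\<Prod>i\<in>I. fact (card {a'\<in>insert a A. col a' = i}))"
  proof -
    have "(\<Prod>i\<in>I. fact (card {a'\<in>insert a A. col a' = i}) :: nat)
       = fact (card {a'\<in>insert a A. col a' = ?i}) * (\<Prod>i\<in>I-{?i}. fact (card {a'\<in>insert a A. col a' = i}))"
      using i insert.prems by (subst prod.remove[of _ ?i]) auto
    also have "(\<Prod>i\<in>I-{?i}. fact (card {a'\<in>insert a A. col a' = i}) :: nat) = (\<Prod>i\<in>I-{?i}. fact (card {a'\<in>A. col a' = i}))"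
      by (intro prod.cong refl, subst colc) auto
    also have "fact (card {a'\<in>insert a A. col a' = ?i}) = card {a'\<in>insert a A. col a' = ?i} * (fact (card {a'\<in>A. col a' = ?i}) :: nat)"
      by (subst (1 2) colc) simp
    also have "\<dots> * (\<Prod>i\<in>I-{?i}. fact (card {a'\<in>A. col a' = i}))
       = card {a'\<in>insert a A. col a' = ?i} * (\<Prod>i\<in>I. fact (card {a\<in>A. col a = i}))"
      by (simp only: prod.remove[OF insert.prems(2) i] mult.assoc)
    finally show ?thesis by (simp only:)
  qed
  finally show ?case unfolding P_def .
qed

lemma card_functions_fibres:
  assumes "finite A" "finite B" "v \<in> tuples_sum B (card A)"
  shows "real (card {f \<in> A \<rightarrow>\<^sub>E B. \<forall>b\<in>B. card {a\<in>A. f a = b} = v b}) = multinomial (card A) B v"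
proof -
  have "card {f \<in> A \<rightarrow>\<^sub>E B. \<forall>b\<in>B. card {a\<in>A. f a = b} = v b} * (\<Prod>b\<in>B. fact (v b)) = fact (card A)"
    using card_functions_coloured_fibres[where col = "\<lambda>_. ()" and I = "{()}" and v = "\<lambda>_. v", OF assms(1,2)] assms(3)
    by (simp add: tuples_sum_def image_subset_iff)
  then have "real (card {f \<in> A \<rightarrow>\<^sub>E B. \<forall>b\<in>B. card {a\<in>A. f a = b} = v b} * (\<Prod>b\<in>B. fact (v b))) = real (fact (card A))"
    by simp
  then show ?thesis using assms(2) by (simp add: multinomial_def eq_divide_eq prod_zero_iff mult.commute)
qed

text \<open>Grouping functions by their fibre sizes gives each size vector its multinomial
  coefficient as weight. In this way the sum over \<open>w\<close> in the theorem becomes a sum over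
  assignments.\<close>

lemma sum_multinomial:
  fixes g :: "('b \<Rightarrow> nat) \<Rightarrow> real"
  assumes "finite A" "finite B"
  shows "(\<Sum>v\<in>tuples_sum B (card A). multinomial (card A) B v * g v)
       = (\<Sum>f\<in>A \<rightarrow>\<^sub>E B. g (\<lambda>b\<in>B. card {a\<in>A. f a = b}))"
proof -
  let ?c = "\<lambda>f. \<lambda>b\<in>B. card {a\<in>A. f a = b}"
  have im: "?c ` (A \<rightarrow>\<^sub>E B) \<subseteq> tuples_sum B (card A)"
  proof
    fix v assume "v \<in> ?c ` (A \<rightarrow>\<^sub>E B)"
    then obtain f where f: "f \<in> A \<rightarrow>\<^sub>E B" and v: "v = ?c f" by blast
    have "card A = card (\<Union>b\<in>B. {a\<in>A. f a = b})" using f by (intro arg_cong[where f=card]) auto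
    also have "\<dots> = (\<Sum>b\<in>B. card {a\<in>A. f a = b})" using assms by (intro card_UN_disjoint) auto
    finally show "v \<in> tuples_sum B (card A)" using v by (simp add: tuples_sum_def)
  qed
  have "(\<Sum>f\<in>A \<rightarrow>\<^sub>E B. g (?c f)) = (\<Sum>v\<in>tuples_sum B (card A). \<Sum>f\<in>{f\<in>A \<rightarrow>\<^sub>E B. ?c f = v}. g (?c f))"
    using assms im by (intro sum.group[symmetric] finite_PiE finite_tuples_sum) auto
  also have "\<dots> = (\<Sum>v\<in>tuples_sum B (card A). multinomial (card A) B v * g v)"
  proof (intro sum.cong refl)
    fix v assume v: "v \<in> tuples_sum B (card A)"
    have "{f\<in>A \<rightarrow>\<^sub>E B. ?c f = v} = {f \<in> A \<rightarrow>\<^sub>E B. \<forall>b\<in>B. card {a\<in>A. f a = b} = v b}"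
      using v by (force simp: tuples_sum_def fun_eq_iff PiE_iff extensional_def)
    then have "real (card {f\<in>A \<rightarrow>\<^sub>E B. ?c f = v}) = multinomial (card A) B v"
      using card_functions_fibres[OF assms v] by simp
    then show "(\<Sum>f\<in>{f\<in>A \<rightarrow>\<^sub>E B. ?c f = v}. g (?c f)) = multinomial (card A) B v * g v"
      by simp
  qed
  finally show ?thesis by simp
qed

section \<open>Fibres with at least two elements and their exponential generating function e^x - 1 -
  x\<close>

definition trunc_exp :: "real fps" where
  "trunc_exp = Abs_fps (\<lambda>j. if 2 \<le> j then 1 / fact j else 0)"

lemma sum_tuples_insert:
  fixes F :: "('a \<Rightarrow> nat) \<Rightarrow> 'c::comm_monoid_add"
  assumes "finite B" "b \<notin> B"
  shows "(\<Sum>v\<in>tuples_sum (insert b B) r. F v) = (\<Sum>j\<le>r. \<Sum>v\<in>tuples_sum B (r - j). F (v(b := j)))"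
proof -
  have "(\<Sum>v\<in>tuples_sum (insert b B) r. F v)
     = (\<Sum>(j, v)\<in>(SIGMA j:{..r}. tuples_sum B (r - j)). F (v(b := j)))"
  proof (rule sum.reindex_bij_witness[where i = "\<lambda>(j, v). v(b := j)" and j = "\<lambda>v. (v b, v(b := undefined))"])
    fix v assume v: "v \<in> tuples_sum (insert b B) r"
    have "sum (v(b := undefined)) B = sum v B" using assms by (intro sum.cong) auto
    then show "(v b, v(b := undefined)) \<in> (SIGMA j:{..r}. tuples_sum B (r - j))"
      using v assms by (auto simp: tuples_sum_def PiE_iff extensional_def)
  next
    fix x assume x: "x \<in> (SIGMA j:{..r}. tuples_sum B (r - j))"
    obtain j v where xjv: "x = (j, v)" by (cases x)
    have "sum (v(b := j)) B = sum v B" using assms by (intro sum.cong) auto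
    then have "v(b := j) \<in> tuples_sum (insert b B) r"
      using x assms xjv by (simp add: tuples_sum_def PiE_iff extensional_def del: fun_upd_apply) auto
    then show "(case x of (j, v) \<Rightarrow> v(b := j)) \<in> tuples_sum (insert b B) r"
      by (simp add: xjv)
    have "v b = undefined" using x assms xjv by (auto simp: tuples_sum_def PiE_iff extensional_def)
    then show "((case x of (j, v) \<Rightarrow> v(b := j)) b, (case x of (j, v) \<Rightarrow> v(b := j))(b := undefined)) = x"
      by (auto simp: xjv)
  qed auto
  also have "\<dots> = (\<Sum>j\<le>r. \<Sum>v\<in>tuples_sum B (r - j). F (v(b := j)))"
    using assms by (subst sum.Sigma) (auto simp: finite_tuples_sum)
  finally show ?thesis .
qed

lemma sum_tuples_prod:
  fixes B :: "'a set" and h :: "real fps"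
  assumes "finite B"
  shows "(\<Sum>v\<in>tuples_sum B r. \<Prod>b\<in>B. fps_nth h (v b)) = fps_nth (h ^ card B) r"
  using assms
proof (induction B arbitrary: r rule: finite_induct)
  case empty
  have "tuples_sum ({} :: 'a set) r = (if r = 0 then {\<lambda>_. undefined} else {})"
    by (auto simp: tuples_sum_def)
  then show ?case by simp
next
  case (insert b B)
  have "(\<Sum>v\<in>tuples_sum (insert b B) r. \<Prod>c\<in>insert b B. fps_nth h (v c))
     = (\<Sum>j\<le>r. \<Sum>v\<in>tuples_sum B (r - j). fps_nth h j * (\<Prod>c\<in>B. fps_nth h (v c)))"
    unfolding sum_tuples_insert[OF insert.hyps]
  proof (intro sum.cong refl)
    fix j v
    have "(\<Prod>c\<in>B. fps_nth h ((v(b := j)) c)) = (\<Prod>c\<in>B. fps_nth h (v c))"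
      using insert.hyps by (intro prod.cong) auto
    then show "(\<Prod>c\<in>insert b B. fps_nth h ((v(b := j)) c)) = fps_nth h j * (\<Prod>c\<in>B. fps_nth h (v c))"
      using insert.hyps by simp
  qed
  then show ?case
    using insert by (simp add: fps_mult_nth atLeast0AtMost flip: sum_distrib_left)
qed

text \<open>The coefficients of \<open>trunc_exp\<close> at 0 and 1 vanish, so a product of
  coefficients carries the constraint \<open>2 \<le> v b\<close> by itself.\<close>

lemma sum_multinomial_ge_2_eq_coeff:
  assumes "finite B"
  shows "(\<Sum>v\<in>{v \<in> tuples_sum B r. \<forall>b\<in>B. 2 \<le> v b}. multinomial r B v) = fact r * fps_nth (trunc_exp ^ card B) r"
proof -
  have "(\<Sum>v\<in>{v \<in> tuples_sum B r. \<forall>b\<in>B. 2 \<le> v b}. multinomial r B v)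
     = (\<Sum>v\<in>tuples_sum B r. if \<forall>b\<in>B. 2 \<le> v b then multinomial r B v else 0)"
    by (rule sum.inter_filter[OF finite_tuples_sum[OF assms]])
  also have "\<dots> = (\<Sum>v\<in>tuples_sum B r. fact r * (\<Prod>b\<in>B. fps_nth trunc_exp (v b)))"
  proof (intro sum.cong refl)
    fix v
    show "(if \<forall>b\<in>B. 2 \<le> v b then multinomial r B v else 0) = fact r * (\<Prod>b\<in>B. fps_nth trunc_exp (v b))"
      using assms by (auto simp: multinomial_def trunc_exp_def prod_dividef prod_zero_iff)
  qed
  finally show ?thesis using sum_tuples_prod[OF assms, of trunc_exp r] by (simp flip: sum_distrib_left)
qed

lemma M_eq_coeff: "M m n = fact m * fps_nth (trunc_exp ^ n) m"
  using sum_multinomial_ge_2_eq_coeff[of "{1..n}" m] by (simp add: M_def)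

text \<open>The analytic bounds treat \<open>M\<close> as a coefficient; the duality argument treats
  it as a number of functions.\<close>

lemma M_eq_card:
  assumes "finite A" "finite B"
  shows "M (card A) (card B) = real (card {f \<in> A \<rightarrow>\<^sub>E B. \<forall>b\<in>B. 2 \<le> card {a\<in>A. f a = b}})"
proof -
  have fin: "finite (A \<rightarrow>\<^sub>E B)" using assms by (intro finite_PiE) auto
  have "M (card A) (card B) = (\<Sum>v\<in>{v \<in> tuples_sum B (card A). \<forall>b\<in>B. 2 \<le> v b}. multinomial (card A) B v)"
    by (simp add: sum_multinomial_ge_2_eq_coeff[OF assms(2)] M_eq_coeff)
  also have "\<dots> = (\<Sum>v\<in>tuples_sum B (card A). multinomial (card A) B v * (if \<forall>b\<in>B. 2 \<le> v b then 1 else 0))"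
    unfolding sum.inter_filter[OF finite_tuples_sum[OF assms(2)]] by (intro sum.cong) auto
  also have "\<dots> = (\<Sum>f\<in>A \<rightarrow>\<^sub>E B. if \<forall>b\<in>B. 2 \<le> card {a\<in>A. f a = b} then 1 else 0)"
    unfolding sum_multinomial[OF assms] by (intro sum.cong) auto
  also have "\<dots> = real (card {f \<in> A \<rightarrow>\<^sub>E B. \<forall>b\<in>B. 2 \<le> card {a\<in>A. f a = b}})"
    using fin by (simp add: card_filter_sum of_nat_sum if_distrib cong: if_cong)
  finally show ?thesis .
qed

section \<open>Duality\<close>

lemma card_slot_row: "j \<in> {1..m} \<Longrightarrow> card {a \<in> {1..m} \<times> {..<k}. fst a = j} = k"
proof -
  assume "j \<in> {1..m}"
  then have "{a \<in> {1..m} \<times> {..<k}. fst a = j} = {j} \<times> {..<k}" by auto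
  then show ?thesis by simp
qed

text \<open>A slot is a pair of an equation and a position in it, and \<open>f\<close> colours each
  slot by the class of the variable placed there. The matrices in \<open>K_set\<close> are the
  tables of colour counts per equation, and each product of multinomial coefficients counts the
  colourings with one table.\<close>

lemma K_eq_card:
  fixes k m :: nat
  defines "A \<equiv> {1..m} \<times> {..<k}"
  shows "K k m l = real (card {f \<in> A \<rightarrow>\<^sub>E {0..2::nat}.
           (\<forall>j\<in>{1..m}. card {a\<in>A. fst a = j \<and> f a = 1} mod 3 = card {a\<in>A. fst a = j \<and> f a = 2} mod 3)
           \<and> (\<forall>i\<in>{0..2}. card {a\<in>A. f a = i} = l i)})"
    (is "_ = real (card ?S)")
proof -
  define X where "X \<kappa> = {f \<in> A \<rightarrow>\<^sub>E {0..2::nat}. \<forall>j\<in>{1..m}. \<forall>i\<in>{0..2}. card {a\<in>A. fst a = j \<and> f a = i} = \<kappa> (i, j)}"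
    for \<kappa> :: "nat \<times> nat \<Rightarrow> nat"
  have finA: "finite A" by (simp add: A_def)
  have finX: "finite (X \<kappa>)" for \<kappa>
    unfolding X_def using finA by (intro finite_subset[OF _ finite_PiE[of A "\<lambda>_. {0..2}"]]) auto
  have K: "(\<Prod>j\<in>{1..m}. multinomial k {0..2} (\<lambda>i. \<kappa> (i, j))) = real (card (X \<kappa>))"
    if "\<kappa> \<in> K_set k m l" for \<kappa>
  proof -
    have "card (X \<kappa>) * (\<Prod>j\<in>{1..m}. \<Prod>i\<in>{0..2}. fact (\<kappa> (i, j))) = (\<Prod>j\<in>{1..m}. fact (card {a\<in>A. fst a = j}))"
      unfolding X_def
    proof (rule card_functions_coloured_fibres)
      show "(\<Sum>i\<in>{0..2}. \<kappa> (i, j)) = card {a\<in>A. fst a = j}" if "j \<in> {1..m}" for j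
        using \<open>\<kappa> \<in> K_set k m l\<close> that card_slot_row[of j m k] by (simp add: K_set_def A_def)
    qed (auto simp: A_def)
    also have "\<dots> = (\<Prod>j\<in>{1..m}. fact k)"
      using card_slot_row[of _ m k] by (intro prod.cong refl) (simp add: A_def)
    finally have "real (card (X \<kappa>) * (\<Prod>j\<in>{1..m}. \<Prod>i\<in>{0..2}. fact (\<kappa> (i, j)))) = real (\<Prod>j\<in>{1..m}. fact k)"
      by simp
    then show ?thesis
      by (simp add: multinomial_def prod_dividef field_simps prod_zero_iff)
  qed
  have S: "?S = (\<Union>\<kappa>\<in>K_set k m l. X \<kappa>)"
  proof (intro equalityI subsetI)
    fix f assume f: "f \<in> ?S"
    define \<kappa> where "\<kappa> = (\<lambda>(i, j)\<in>{0..2}\<times>{1..m}. card {a\<in>A. fst a = j \<and> f a = i})"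
    have fA: "f a \<in> {0..2}" if "a \<in> A" for a using f that by auto
    have "(\<Sum>i\<in>{0..2}. card {a\<in>A. fst a = j \<and> f a = i}) = k" if j: "j \<in> {1..m}" for j
    proof -
      have "{a\<in>A. fst a = j} = (\<Union>i\<in>{0..2}. {a\<in>A. fst a = j \<and> f a = i})"
        using fA by blast
      then have "k = card (\<Union>i\<in>{0..2}. {a\<in>A. fst a = j \<and> f a = i})"
        using card_slot_row[OF j, of k] by (simp only: A_def)
      also have "\<dots> = (\<Sum>i\<in>{0..2}. card {a\<in>A. fst a = j \<and> f a = i})"
        using finA by (intro card_UN_disjoint) auto
      finally show ?thesis by simp
    qed
    moreover have "(\<Sum>j\<in>{1..m}. card {a\<in>A. fst a = j \<and> f a = i}) = l i" if i: "i \<in> {0..2}" for i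
    proof -
      have "{a\<in>A. f a = i} = (\<Union>j\<in>{1..m}. {a\<in>A. fst a = j \<and> f a = i})" by (auto simp: A_def)
      moreover have "card {a\<in>A. f a = i} = l i" using f i by blast
      ultimately have "l i = card (\<Union>j\<in>{1..m}. {a\<in>A. fst a = j \<and> f a = i})" by simp
      also have "\<dots> = (\<Sum>j\<in>{1..m}. card {a\<in>A. fst a = j \<and> f a = i})"
        using finA by (intro card_UN_disjoint) auto
      finally show ?thesis by simp
    qed
    ultimately have "\<kappa> \<in> K_set k m l"
      using f by (auto simp: K_set_def \<kappa>_def)
    moreover have "f \<in> X \<kappa>" using f by (auto simp: X_def \<kappa>_def)
    ultimately show "f \<in> (\<Union>\<kappa>\<in>K_set k m l. X \<kappa>)" by blast
  next
    fix f assume "f \<in> (\<Union>\<kappa>\<in>K_set k m l. X \<kappa>)"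
    then obtain \<kappa> where \<kappa>: "\<kappa> \<in> K_set k m l" and f: "f \<in> X \<kappa>" by blast
    have "card {a\<in>A. f a = i} = l i" if i: "i \<in> {0..2}" for i
    proof -
      have "{a\<in>A. f a = i} = (\<Union>j\<in>{1..m}. {a\<in>A. fst a = j \<and> f a = i})" by (auto simp: A_def)
      then have "card {a\<in>A. f a = i} = (\<Sum>j\<in>{1..m}. card {a\<in>A. fst a = j \<and> f a = i})"
        using finA by (simp only:) (intro card_UN_disjoint, auto)
      also have "\<dots> = (\<Sum>j\<in>{1..m}. \<kappa> (i, j))" using f i by (simp add: X_def)
      also have "\<dots> = l i" using \<kappa> i by (simp add: K_set_def)
      finally show ?thesis .
    qed
    moreover have "card {a\<in>A. fst a = j \<and> f a = 1} mod 3 = card {a\<in>A. fst a = j \<and> f a = 2} mod 3" if "j \<in> {1..m}" for j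
      using that f \<kappa> by (simp add: X_def K_set_def)
    ultimately show "f \<in> ?S" using f by (simp add: X_def)
  qed
  have disj: "X \<kappa> \<inter> X \<kappa>' = {}" if "\<kappa> \<in> K_set k m l" "\<kappa>' \<in> K_set k m l" "\<kappa> \<noteq> \<kappa>'" for \<kappa> \<kappa>'
  proof (rule ccontr)
    assume "X \<kappa> \<inter> X \<kappa>' \<noteq> {}"
    then obtain f where f: "f \<in> X \<kappa>" "f \<in> X \<kappa>'" by blast
    have "\<kappa> p = \<kappa>' p" if "p \<in> {0..2} \<times> {1..m}" for p
    proof -
      obtain i j where p: "p = (i, j)" by (cases p)
      have "i \<in> {0..2}" "j \<in> {1..m}" using that p by auto
      then show ?thesis using f unfolding X_def p by fastforce
    qed
    then have "\<kappa> = \<kappa>'" using that by (intro extensionalityI[of _ "{0..2} \<times> {1..m}"]) (auto simp: K_set_def PiE_def)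
    with that show False by simp
  qed
  have "card ?S = (\<Sum>\<kappa>\<in>K_set k m l. card (X \<kappa>))"
    unfolding S using finX disj by (intro card_UN_disjoint finite_K_set) auto
  then show ?thesis using K by (simp add: K_def)
qed

text \<open>Functions from the slots of each colour to the variables of the same colour glue to one
  \<open>\<sigma>\<close> on all slots, and the glueing is injective.\<close>

lemma prod_M_le_card:
  fixes f :: "'a \<Rightarrow> 'i" and b :: "'b \<Rightarrow> 'i"
  assumes "finite A" "finite V" "finite I" "f ` A \<subseteq> I" "b ` V \<subseteq> I"
  shows "(\<Prod>i\<in>I. M (card {a\<in>A. f a = i}) (card {x\<in>V. b x = i}))
       \<le> real (card {\<sigma> \<in> A \<rightarrow>\<^sub>E V. (\<forall>x\<in>V. 2 \<le> card {a\<in>A. \<sigma> a = x}) \<and> (\<forall>a\<in>A. b (\<sigma> a) = f a)})"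
    (is "_ \<le> real (card ?T)")
proof -
  define H where "H i = {h \<in> {a\<in>A. f a = i} \<rightarrow>\<^sub>E {x\<in>V. b x = i}. \<forall>x\<in>{x\<in>V. b x = i}. 2 \<le> card {a\<in>{a\<in>A. f a = i}. h a = x}}" for i
  have "(\<Prod>i\<in>I. M (card {a\<in>A. f a = i}) (card {x\<in>V. b x = i})) = (\<Prod>i\<in>I. real (card (H i)))"
    unfolding H_def using assms by (intro prod.cong refl M_eq_card) auto
  also have "\<dots> = real (card (PiE I H))" using assms by (simp add: card_PiE)
  also have "card (PiE I H) \<le> card ?T"
  proof (rule card_inj_on_le)
    let ?G = "\<lambda>h. \<lambda>a\<in>A. h (f a) a"
    have mem: "h (f a) a \<in> V \<and> b (h (f a) a) = f a" if "h \<in> PiE I H" "a \<in> A" for h a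
    proof -
      have "h (f a) \<in> H (f a)" using that assms by auto
      then show ?thesis using that by (auto simp: H_def PiE_iff)
    qed
    show "inj_on ?G (PiE I H)"
    proof (rule inj_onI)
      fix h h' assume h: "h \<in> PiE I H" "h' \<in> PiE I H" and eq: "?G h = ?G h'"
      have "h i = h' i" if i: "i \<in> I" for i
      proof (rule extensionalityI[of _ "{a\<in>A. f a = i}"])
        show "h i \<in> extensional {a\<in>A. f a = i}" "h' i \<in> extensional {a\<in>A. f a = i}"
          using h i by (auto simp: H_def PiE_iff)
        fix a assume "a \<in> {a\<in>A. f a = i}"
        then show "h i a = h' i a" using fun_cong[OF eq, of a] by auto
      qed
      then show "h = h'" using h by (intro extensionalityI[of _ I]) (auto simp: PiE_def)
    qed
    show "?G ` PiE I H \<subseteq> ?T"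
    proof
      fix \<sigma> assume "\<sigma> \<in> ?G ` PiE I H"
      then obtain h where h: "h \<in> PiE I H" and \<sigma>: "\<sigma> = ?G h" by blast
      have "2 \<le> card {a\<in>A. \<sigma> a = x}" if x: "x \<in> V" for x
      proof -
        have "h (b x) \<in> H (b x)" using h x assms by auto
        then have "2 \<le> card {a\<in>{a\<in>A. f a = b x}. h (b x) a = x}" using x by (auto simp: H_def)
        also have "\<dots> \<le> card {a\<in>A. \<sigma> a = x}"
          using assms by (intro card_mono) (auto simp: \<sigma>)
        finally show ?thesis .
      qed
      then show "\<sigma> \<in> ?T" using mem[OF h] by (auto simp: \<sigma>)
    qed
    show "finite ?T" using assms by (intro finite_subset[OF _ finite_PiE[of A "\<lambda>_. V"]]) auto
  qed
  finally show ?thesis by simp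
qed

text \<open>The tuples \<open>w\<close> and \<open>l\<close> only record class sizes, so summing
  over them leaves triples of a shift \<open>b\<close>, a slot colouring \<open>f\<close> and a
  formula \<open>\<sigma>\<close> with \<open>f a = b (\<sigma> a)\<close>. Thus \<open>f\<close> is
  determined by the other two, and the congruence in \<open>K_set\<close> says that \<open>b\<close>
  adds up to 0 modulo 3 along each equation.\<close>

lemma sum_N_le_card:
  fixes k m n :: nat
  defines "A \<equiv> {1..m} \<times> {..<k}"
  shows "(\<Sum>w\<in>tuples_sum {0..2} n. \<Sum>l\<in>tuples_sum {0..2} (k * m). N k m n w l)
     \<le> (\<Sum>\<sigma>\<in>{\<sigma> \<in> A \<rightarrow>\<^sub>E {1..n}. \<forall>x\<in>{1..n}. 2 \<le> card {a\<in>A. \<sigma> a = x}}.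
          real (card {b \<in> {1..n} \<rightarrow>\<^sub>E {0..2::nat}. \<forall>j\<in>{1..m}. 3 dvd (\<Sum>a\<in>{a\<in>A. fst a = j}. b (\<sigma> a))}))"
proof -
  let ?V = "{1..n}" and ?I = "{0..2::nat}"
  have finA: "finite A" and cardA: "card A = k * m" by (auto simp: A_def)
  define good where "good f \<longleftrightarrow> (\<forall>j\<in>{1..m}. card {a\<in>A. fst a = j \<and> f a = 1} mod 3 = card {a\<in>A. fst a = j \<and> f a = (2::nat)} mod 3)" for f
  define F where "F = {\<sigma> \<in> A \<rightarrow>\<^sub>E ?V. \<forall>x\<in>?V. 2 \<le> card {a\<in>A. \<sigma> a = x}}"
  have finF: "finite F" unfolding F_def using finA by (intro finite_subset[OF _ finite_PiE[of A "\<lambda>_. ?V"]]) auto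
  have finf: "finite (A \<rightarrow>\<^sub>E ?I)" and finb: "finite (?V \<rightarrow>\<^sub>E ?I)" using finA by (auto intro!: finite_PiE)
  define tot where "tot f = (\<lambda>i\<in>?I. card {a\<in>A. f a = i})" for f
  have tot: "tot f \<in> tuples_sum ?I (k * m)" if "f \<in> A \<rightarrow>\<^sub>E ?I" for f
  proof -
    have "card A = card (\<Union>i\<in>?I. {a\<in>A. f a = i})" using that by (intro arg_cong[where f=card]) auto
    also have "\<dots> = (\<Sum>i\<in>?I. card {a\<in>A. f a = i})" using finA by (intro card_UN_disjoint) auto
    finally show ?thesis using cardA by (simp add: tot_def tuples_sum_def)
  qed
  have K: "(\<Sum>l\<in>tuples_sum ?I (k * m). K k m l * g l) = (\<Sum>f\<in>{f \<in> A \<rightarrow>\<^sub>E ?I. good f}. g (tot f))" for g :: "(nat \<Rightarrow> nat) \<Rightarrow> real"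
  proof -
    have "(\<Sum>f\<in>{f \<in> A \<rightarrow>\<^sub>E ?I. good f}. g (tot f))
       = (\<Sum>l\<in>tuples_sum ?I (k * m). \<Sum>f\<in>{f \<in> {f \<in> A \<rightarrow>\<^sub>E ?I. good f}. tot f = l}. g (tot f))"
      using finf tot by (intro sum.group[symmetric] finite_tuples_sum) auto
    also have "\<dots> = (\<Sum>l\<in>tuples_sum ?I (k * m). K k m l * g l)"
    proof (intro sum.cong refl)
      fix l assume l: "l \<in> tuples_sum ?I (k * m)"
      have "tot f = l \<longleftrightarrow> (\<forall>i\<in>?I. card {a\<in>A. f a = i} = l i)" for f
        using l by (auto simp: tot_def fun_eq_iff tuples_sum_def PiE_iff extensional_def)
      then have "{f \<in> {f \<in> A \<rightarrow>\<^sub>E ?I. good f}. tot f = l} = {f \<in> A \<rightarrow>\<^sub>E ?I. good f \<and> (\<forall>i\<in>?I. card {a\<in>A. f a = i} = l i)}"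
        by auto
      then have "real (card {f \<in> {f \<in> A \<rightarrow>\<^sub>E ?I. good f}. tot f = l}) = K k m l"
        using K_eq_card[where k = k and m = m and l = l] by (simp add: A_def good_def)
      then show "(\<Sum>f\<in>{f \<in> {f \<in> A \<rightarrow>\<^sub>E ?I. good f}. tot f = l}. g (tot f)) = K k m l * g l" by simp
    qed
    finally show ?thesis by simp
  qed
  have "(\<Sum>w\<in>tuples_sum ?I n. \<Sum>l\<in>tuples_sum ?I (k * m). N k m n w l)
     = (\<Sum>w\<in>tuples_sum ?I n. multinomial n ?I w * (\<Sum>l\<in>tuples_sum ?I (k * m). K k m l * (\<Prod>i\<in>?I. M (l i) (w i))))"
    by (simp add: N_def sum_distrib_left mult.assoc)
  also have "\<dots> = (\<Sum>b\<in>?V \<rightarrow>\<^sub>E ?I. \<Sum>f\<in>{f \<in> A \<rightarrow>\<^sub>E ?I. good f}. \<Prod>i\<in>?I. M (card {a\<in>A. f a = i}) (card {x\<in>?V. b x = i}))"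
    using sum_multinomial[of ?V ?I "\<lambda>w. \<Sum>f\<in>{f \<in> A \<rightarrow>\<^sub>E ?I. good f}. \<Prod>i\<in>?I. M (tot f i) (w i)"]
    by (simp add: K tot_def)
  also have "\<dots> \<le> (\<Sum>b\<in>?V \<rightarrow>\<^sub>E ?I. \<Sum>f\<in>{f \<in> A \<rightarrow>\<^sub>E ?I. good f}. real (card {\<sigma>\<in>F. \<forall>a\<in>A. b (\<sigma> a) = f a}))"
  proof (intro sum_mono)
    fix b f assume b: "b \<in> ?V \<rightarrow>\<^sub>E ?I" and f: "f \<in> {f \<in> A \<rightarrow>\<^sub>E ?I. good f}"
    have "{\<sigma>\<in>F. \<forall>a\<in>A. b (\<sigma> a) = f a} = {\<sigma> \<in> A \<rightarrow>\<^sub>E ?V. (\<forall>x\<in>?V. 2 \<le> card {a\<in>A. \<sigma> a = x}) \<and> (\<forall>a\<in>A. b (\<sigma> a) = f a)}"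
      by (auto simp: F_def)
    moreover have "f ` A \<subseteq> ?I" "b ` ?V \<subseteq> ?I" using b f by auto
    ultimately show "(\<Prod>i\<in>?I. M (card {a\<in>A. f a = i}) (card {x\<in>?V. b x = i})) \<le> real (card {\<sigma>\<in>F. \<forall>a\<in>A. b (\<sigma> a) = f a})"
      using prod_M_le_card[of A ?V ?I f b] finA by (simp only: finite_atLeastAtMost simp_thms)
  qed
  also have "\<dots> = (\<Sum>b\<in>?V \<rightarrow>\<^sub>E ?I. \<Sum>\<sigma>\<in>F. \<Sum>f\<in>{f \<in> A \<rightarrow>\<^sub>E ?I. good f}. if \<forall>a\<in>A. b (\<sigma> a) = f a then 1 else 0)"
    using finF by (subst sum.swap) (simp add: card_filter_sum of_nat_sum if_distrib[of real] cong: if_cong)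
  also have "\<dots> \<le> (\<Sum>b\<in>?V \<rightarrow>\<^sub>E ?I. \<Sum>\<sigma>\<in>F. if \<forall>j\<in>{1..m}. 3 dvd (\<Sum>a\<in>{a\<in>A. fst a = j}. b (\<sigma> a)) then 1 else 0)"
  proof (intro sum_mono)
    fix b \<sigma> assume b: "b \<in> ?V \<rightarrow>\<^sub>E ?I" and \<sigma>: "\<sigma> \<in> F"
    let ?f = "\<lambda>a\<in>A. b (\<sigma> a)"
    have "(\<Sum>f\<in>{f \<in> A \<rightarrow>\<^sub>E ?I. good f}. if \<forall>a\<in>A. b (\<sigma> a) = f a then 1 else 0) = (\<Sum>f\<in>{f \<in> A \<rightarrow>\<^sub>E ?I. good f}. if f = ?f then 1 else 0 :: real)"
    proof (intro sum.cong refl if_cong)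
      fix f assume f: "f \<in> {f \<in> A \<rightarrow>\<^sub>E ?I. good f}"
      show "(\<forall>a\<in>A. b (\<sigma> a) = f a) \<longleftrightarrow> f = ?f"
      proof
        assume "\<forall>a\<in>A. b (\<sigma> a) = f a"
        then show "f = ?f" using f by (intro extensionalityI[of _ A]) (auto simp: PiE_def)
      qed auto
    qed
    also have "\<dots> \<le> (if good ?f then 1 else 0)"
      using finf by (auto simp: sum.delta)
    also have "\<dots> \<le> (if \<forall>j\<in>{1..m}. 3 dvd (\<Sum>a\<in>{a\<in>A. fst a = j}. b (\<sigma> a)) then 1 else 0)"
    proof -
      have "3 dvd (\<Sum>a\<in>{a\<in>A. fst a = j}. b (\<sigma> a))" if g: "good ?f" and j: "j \<in> {1..m}" for j
      proof -
        let ?c = "\<lambda>i. card {a\<in>A. fst a = j \<and> ?f a = i}"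
        have "(\<Sum>a\<in>{a\<in>A. fst a = j}. b (\<sigma> a)) = (\<Sum>a\<in>{a\<in>A. fst a = j}. ?f a)" by (intro sum.cong) auto
        also have "\<dots> = (\<Sum>i\<in>?I. \<Sum>a\<in>{a\<in>{a\<in>A. fst a = j}. ?f a = i}. ?f a)"
        proof (rule sum.group[symmetric])
          show "?f ` {a\<in>A. fst a = j} \<subseteq> ?I" using b \<sigma> by (force simp: F_def)
        qed (use finA in auto)
        also have "\<dots> = (\<Sum>i\<in>?I. i * ?c i)"
        proof (intro sum.cong refl)
          fix i
          have "{a\<in>{a\<in>A. fst a = j}. ?f a = i} = {a\<in>A. fst a = j \<and> ?f a = i}" by auto
          then show "(\<Sum>a\<in>{a\<in>{a\<in>A. fst a = j}. ?f a = i}. ?f a) = i * ?c i" by simp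
        qed
        also have "?I = {0, 1, 2}" by auto
        also have "(\<Sum>i\<in>{0, 1, 2}. i * ?c i) = ?c 1 + 2 * ?c 2" by simp
        finally have "(\<Sum>a\<in>{a\<in>A. fst a = j}. b (\<sigma> a)) = ?c 1 + 2 * ?c 2" .
        \<comment> \<open>Hence \<open>?c 1 + 2 * ?c 2\<close> is congruent to
          \<open>3 * ?c 2\<close>.\<close>
        moreover have "?c 1 mod 3 = ?c 2 mod 3" using g j unfolding good_def by blast
        ultimately show ?thesis by presburger
      qed
      then show ?thesis by auto
    qed
    finally show "(\<Sum>f\<in>{f \<in> A \<rightarrow>\<^sub>E ?I. good f}. if \<forall>a\<in>A. b (\<sigma> a) = f a then 1 else 0)
       \<le> (if \<forall>j\<in>{1..m}. 3 dvd (\<Sum>a\<in>{a\<in>A. fst a = j}. b (\<sigma> a)) then 1 else 0 :: real)" .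
  qed
  also have "\<dots> = (\<Sum>\<sigma>\<in>F. real (card {b \<in> ?V \<rightarrow>\<^sub>E ?I. \<forall>j\<in>{1..m}. 3 dvd (\<Sum>a\<in>{a\<in>A. fst a = j}. b (\<sigma> a))}))"
    using finb by (subst sum.swap) (simp add: card_filter_sum of_nat_sum if_distrib[of real] cong: if_cong)
  finally show ?thesis unfolding F_def .
qed

section \<open>Cube roots of unity and the transposed kernel\<close>

lemma sum_cube_root_powers:
  "(\<Sum>r\<in>{0..2::nat}. cis (2 * pi / 3) ^ (r * s)) = (if 3 dvd s then 3 else 0)"
proof -
  define \<omega> where "\<omega> = cis (2 * pi / 3)"
  have w3: "\<omega> ^ 3 = 1" by (simp add: \<omega>_def Complex.DeMoivre)
  have s: "\<omega> ^ s = \<omega> ^ (s mod 3)"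
    by (metis div_mult_mod_eq mult.commute power_add power_mult power_one w3 mult_1)
  have "\<omega> \<noteq> 1" by (simp add: \<omega>_def complex_eq_iff cos_120)
  moreover have "(\<omega> - 1) * (1 + \<omega> + \<omega> ^ 2) = 0"
    using w3 by (simp add: algebra_simps power2_eq_square power3_eq_cube)
  ultimately have sum0: "1 + \<omega> + \<omega> ^ 2 = 0" by simp
  have "{0..2::nat} = {0, 1, 2}" by auto
  then have "(\<Sum>r\<in>{0..2::nat}. \<omega> ^ (r * s)) = 1 + \<omega> ^ s + (\<omega> ^ s) ^ 2"
    by (simp add: power_mult[symmetric] mult.commute)
  also have "\<dots> = (if 3 dvd s then 3 else 0)"
  proof -
    have "s mod 3 = 0 \<or> s mod 3 = 1 \<or> s mod 3 = 2" by auto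
    moreover have "1 + \<omega> ^ 2 + (\<omega> ^ 2) ^ 2 = 1 + \<omega> + \<omega> ^ 2"
      using w3 by (simp add: power2_eq_square power3_eq_cube mult.assoc)
    ultimately show ?thesis using sum0 by (auto simp: s dvd_eq_mod_eq_0)
  qed
  finally show ?thesis unfolding \<omega>_def .
qed

text \<open>For fixed \<open>b\<close> the sum over \<open>c\<close> is a product over
  \<open>J\<close>, and orthogonality makes each factor 3 or 0. The exponent is the bilinear form of
  the incidence matrix, symmetric in the roles of \<open>b\<close> and \<open>c\<close>, so the same
  lemma evaluates the double sum from the other side.\<close>

lemma sum_cube_root_eq_card:
  fixes \<tau> :: "'a \<Rightarrow> 'j" and \<sigma> :: "'a \<Rightarrow> 'v"
  assumes "finite A" "finite J" "finite V" "\<tau> ` A \<subseteq> J"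
  shows "(\<Sum>b\<in>V \<rightarrow>\<^sub>E {0..2::nat}. \<Sum>c\<in>J \<rightarrow>\<^sub>E {0..2::nat}. cis (2 * pi / 3) ^ (\<Sum>a\<in>A. c (\<tau> a) * b (\<sigma> a)))
     = 3 ^ card J * of_nat (card {b\<in>V \<rightarrow>\<^sub>E {0..2::nat}. \<forall>j\<in>J. 3 dvd (\<Sum>a\<in>{a\<in>A. \<tau> a = j}. b (\<sigma> a))})"
proof -
  define \<omega> where "\<omega> = cis (2 * pi / 3)"
  have fin: "finite (V \<rightarrow>\<^sub>E {0..2::nat})" using assms by (intro finite_PiE) auto
  have "(\<Sum>c\<in>J \<rightarrow>\<^sub>E {0..2::nat}. \<omega> ^ (\<Sum>a\<in>A. c (\<tau> a) * b (\<sigma> a)))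
     = (if \<forall>j\<in>J. 3 dvd (\<Sum>a\<in>{a\<in>A. \<tau> a = j}. b (\<sigma> a)) then 3 ^ card J else 0)" for b
  proof -
    have "(\<Sum>a\<in>A. c (\<tau> a) * b (\<sigma> a)) = (\<Sum>j\<in>J. c j * (\<Sum>a\<in>{a\<in>A. \<tau> a = j}. b (\<sigma> a)))" for c
      using sum.group[OF assms(1,2,4), of "\<lambda>a. c (\<tau> a) * b (\<sigma> a)"] by (simp add: sum_distrib_left)
    then have "(\<Sum>c\<in>J \<rightarrow>\<^sub>E {0..2::nat}. \<omega> ^ (\<Sum>a\<in>A. c (\<tau> a) * b (\<sigma> a)))
      = (\<Sum>c\<in>J \<rightarrow>\<^sub>E {0..2::nat}. \<Prod>j\<in>J. \<omega> ^ (c j * (\<Sum>a\<in>{a\<in>A. \<tau> a = j}. b (\<sigma> a))))"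
      by (simp add: power_sum)
    also have "\<dots> = (\<Prod>j\<in>J. \<Sum>r\<in>{0..2::nat}. \<omega> ^ (r * (\<Sum>a\<in>{a\<in>A. \<tau> a = j}. b (\<sigma> a))))"
      using assms by (intro prod_sum_PiE[symmetric]) auto
    also have "\<dots> = (if \<forall>j\<in>J. 3 dvd (\<Sum>a\<in>{a\<in>A. \<tau> a = j}. b (\<sigma> a)) then 3 ^ card J else 0)"
      using assms unfolding \<omega>_def sum_cube_root_powers by (auto simp: prod_zero_iff)
    finally show ?thesis .
  qed
  then have "(\<Sum>b\<in>V \<rightarrow>\<^sub>E {0..2::nat}. \<Sum>c\<in>J \<rightarrow>\<^sub>E {0..2::nat}. \<omega> ^ (\<Sum>a\<in>A. c (\<tau> a) * b (\<sigma> a)))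
    = (\<Sum>b\<in>V \<rightarrow>\<^sub>E {0..2::nat}. if \<forall>j\<in>J. 3 dvd (\<Sum>a\<in>{a\<in>A. \<tau> a = j}. b (\<sigma> a)) then 3 ^ card J else 0)"
    by simp
  also have "\<dots> = (\<Sum>b\<in>{b\<in>V \<rightarrow>\<^sub>E {0..2::nat}. \<forall>j\<in>J. 3 dvd (\<Sum>a\<in>{a\<in>A. \<tau> a = j}. b (\<sigma> a))}. 3 ^ card J)"
    using fin by (simp only: sum.inter_filter)
  finally show ?thesis unfolding \<omega>_def by (simp add: mult.commute)
qed

text \<open>The kernel of a matrix over the integers modulo 3 and the kernel of its transpose: for
  the matrix with one unit entry at \<open>(\<tau> a, \<sigma> a)\<close> for each \<open>a\<close>, both sides count, up to
  normalisation, the same exponential sum.\<close>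

lemma card_kernel_transpose:
  fixes \<tau> :: "'a \<Rightarrow> 'j" and \<sigma> :: "'a \<Rightarrow> 'v"
  assumes "finite A" "finite J" "finite V" "\<tau> ` A \<subseteq> J" "\<sigma> ` A \<subseteq> V"
  shows "3 ^ card J * card {b\<in>V \<rightarrow>\<^sub>E {0..2::nat}. \<forall>j\<in>J. 3 dvd (\<Sum>a\<in>{a\<in>A. \<tau> a = j}. b (\<sigma> a))}
       = 3 ^ card V * card {c\<in>J \<rightarrow>\<^sub>E {0..2::nat}. \<forall>x\<in>V. 3 dvd (\<Sum>a\<in>{a\<in>A. \<sigma> a = x}. c (\<tau> a))}"
proof -
  have "(of_nat (3 ^ card J * card {b\<in>V \<rightarrow>\<^sub>E {0..2::nat}. \<forall>j\<in>J. 3 dvd (\<Sum>a\<in>{a\<in>A. \<tau> a = j}. b (\<sigma> a))}) :: complex)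
       = of_nat (3 ^ card V * card {c\<in>J \<rightarrow>\<^sub>E {0..2::nat}. \<forall>x\<in>V. 3 dvd (\<Sum>a\<in>{a\<in>A. \<sigma> a = x}. c (\<tau> a))})"
    using sum_cube_root_eq_card[OF assms(1-4), of \<sigma>] sum_cube_root_eq_card[OF assms(1,3,2,5), of \<tau>]
      sum.swap[of "\<lambda>b c. cis (2 * pi / 3) ^ (\<Sum>a\<in>A. c (\<tau> a) * b (\<sigma> a))" "J \<rightarrow>\<^sub>E {0..2::nat}" "V \<rightarrow>\<^sub>E {0..2::nat}"]
    by (simp add: mult.commute)
  then show ?thesis by (simp only: of_nat_eq_iff)
qed

text \<open>With \<open>c\<close> fixed first, it colours the slots, and both conditions on
  \<open>\<sigma>\<close> concern one fibre at a time. This separation is what the generating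
  function bound exploits.\<close>

lemma sum_N_le_sum_dual:
  fixes k m n :: nat
  defines "A \<equiv> {1..m} \<times> {..<k}"
  shows "3 ^ m * (\<Sum>w\<in>tuples_sum {0..2} n. \<Sum>l\<in>tuples_sum {0..2} (k * m). N k m n w l)
     \<le> 3 ^ n * (\<Sum>c\<in>{1..m} \<rightarrow>\<^sub>E {0..2::nat}. real (card {\<sigma> \<in> A \<rightarrow>\<^sub>E {1..n}.
          \<forall>x\<in>{1..n}. 2 \<le> card {a\<in>A. \<sigma> a = x} \<and> 3 dvd (\<Sum>a\<in>{a\<in>A. \<sigma> a = x}. c (fst a))}))"
proof -
  define F where "F = {\<sigma> \<in> A \<rightarrow>\<^sub>E {1..n}. \<forall>x\<in>{1..n}. 2 \<le> card {a\<in>A. \<sigma> a = x}}"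
  have finA: "finite A" by (simp add: A_def)
  have finF: "finite F" unfolding F_def using finA by (intro finite_subset[OF _ finite_PiE[of A "\<lambda>_. {1..n}"]]) auto
  have finc: "finite ({1..m} \<rightarrow>\<^sub>E {0..2::nat})" by (intro finite_PiE) auto
  have "3 ^ m * (\<Sum>w\<in>tuples_sum {0..2} n. \<Sum>l\<in>tuples_sum {0..2} (k * m). N k m n w l)
    \<le> 3 ^ m * (\<Sum>\<sigma>\<in>F. real (card {b \<in> {1..n} \<rightarrow>\<^sub>E {0..2::nat}. \<forall>j\<in>{1..m}. 3 dvd (\<Sum>a\<in>{a\<in>A. fst a = j}. b (\<sigma> a))}))"
    using sum_N_le_card[where n = n and k = k and m = m] by (simp add: A_def F_def)
  also have "\<dots> = (\<Sum>\<sigma>\<in>F. real (3 ^ m * card {b \<in> {1..n} \<rightarrow>\<^sub>E {0..2::nat}. \<forall>j\<in>{1..m}. 3 dvd (\<Sum>a\<in>{a\<in>A. fst a = j}. b (\<sigma> a))}))"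
    by (simp add: sum_distrib_left)
  also have "\<dots> = (\<Sum>\<sigma>\<in>F. real (3 ^ n * card {c \<in> {1..m} \<rightarrow>\<^sub>E {0..2::nat}. \<forall>x\<in>{1..n}. 3 dvd (\<Sum>a\<in>{a\<in>A. \<sigma> a = x}. c (fst a))}))"
  proof (intro sum.cong refl arg_cong[where f=real])
    fix \<sigma> assume "\<sigma> \<in> F"
    then have "\<sigma> ` A \<subseteq> {1..n}" by (auto simp: F_def)
    then show "3 ^ m * card {b \<in> {1..n} \<rightarrow>\<^sub>E {0..2::nat}. \<forall>j\<in>{1..m}. 3 dvd (\<Sum>a\<in>{a\<in>A. fst a = j}. b (\<sigma> a))}
      = 3 ^ n * card {c \<in> {1..m} \<rightarrow>\<^sub>E {0..2::nat}. \<forall>x\<in>{1..n}. 3 dvd (\<Sum>a\<in>{a\<in>A. \<sigma> a = x}. c (fst a))}"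
      using card_kernel_transpose[of A "{1..m}" "{1..n}" fst \<sigma>] finA by (auto simp: A_def)
  qed
  also have "\<dots> = 3 ^ n * (\<Sum>\<sigma>\<in>F. \<Sum>c\<in>{1..m} \<rightarrow>\<^sub>E {0..2::nat}. if \<forall>x\<in>{1..n}. 3 dvd (\<Sum>a\<in>{a\<in>A. \<sigma> a = x}. c (fst a)) then 1 else 0)"
    using finc by (simp add: card_filter_sum of_nat_sum sum_distrib_left if_distrib[of real] cong: if_cong)
  also have "\<dots> = 3 ^ n * (\<Sum>c\<in>{1..m} \<rightarrow>\<^sub>E {0..2::nat}. real (card {\<sigma>\<in>F. \<forall>x\<in>{1..n}. 3 dvd (\<Sum>a\<in>{a\<in>A. \<sigma> a = x}. c (fst a))}))"
    using finF by (subst sum.swap) (simp add: card_filter_sum of_nat_sum if_distrib[of real] cong: if_cong)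
  also have "(\<lambda>c. {\<sigma>\<in>F. \<forall>x\<in>{1..n}. 3 dvd (\<Sum>a\<in>{a\<in>A. \<sigma> a = x}. c (fst a))})
     = (\<lambda>c. {\<sigma> \<in> A \<rightarrow>\<^sub>E {1..n}. \<forall>x\<in>{1..n}. 2 \<le> card {a\<in>A. \<sigma> a = x} \<and> 3 dvd (\<Sum>a\<in>{a\<in>A. \<sigma> a = x}. c (fst a))})"
    by (auto simp: F_def fun_eq_iff)
  finally show ?thesis .
qed

section \<open>The number of formulas with a given dual vector\<close>

text \<open>An upper bound for the generating function of the fibres allowed at one variable, with
  weight \<open>z\<close> for slots where \<open>c\<close> is 0 and total weight \<open>u\<close>
  for the others. The exponentials come from averaging over the cube roots of unity, the two
  non-trivial ones having real part -1/2. The terms \<open>1\<close> and \<open>z\<close> belong to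
  the fibres that satisfy the congruence but have fewer than two slots.\<close>

definition Gbound :: "real \<Rightarrow> real \<Rightarrow> real" where
  "Gbound z u = (exp (z + u) + 2 * exp (z - u / 2)) / 3 - 1 - z"

text \<open>The box \<open>{..L}\<close> keeps all sums finite. The filtered sum \<open>S l\<close>
  is an average of three products of truncated exponentials, increases with \<open>l\<close>, and so
  stays below its limit.\<close>

lemma sum_triples_le_Gbound:
  fixes z :: "nat \<Rightarrow> real"
  assumes z: "\<And>i. 0 \<le> z i"
  shows "(\<Sum>t\<in>{t\<in>{0..2::nat} \<rightarrow>\<^sub>E {..L::nat}. 2 \<le> (\<Sum>i\<in>{0..2}. t i) \<and> 3 dvd (t 1 + 2 * t 2)}.
           \<Prod>i\<in>{0..2}. z i ^ t i / fact (t i)) \<le> Gbound (z 0) (z 1 + z 2)"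
proof -
  define \<omega> where "\<omega> = cis (2 * pi / 3)"
  define w where "w t = (\<Prod>i\<in>{0..2}. z i ^ t i / fact (t i))" for t :: "nat \<Rightarrow> nat"
  have I: "{0..2::nat} = {0, 1, 2}" by auto
  have w0: "0 \<le> w t" for t using z by (auto simp: w_def intro!: prod_nonneg)
  define B where "B l = ({0..2::nat} \<rightarrow>\<^sub>E {..l::nat})" for l
  have finB: "finite (B l)" for l unfolding B_def by (intro finite_PiE) auto
  define S where "S l = (\<Sum>t\<in>{t\<in>B l. 3 dvd (t 1 + 2 * t 2)}. w t)" for l
  define E where "E l r = (\<Prod>i\<in>{0..2::nat}. \<Sum>j\<le>l. (\<omega> ^ (r * i) * z i) ^ j / fact j)" for l r :: nat
  have S_eq: "complex_of_real (S l) = (\<Sum>r\<in>{0..2}. E l r) / 3" for l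
  proof -
    have "E l r = (\<Sum>t\<in>B l. w t * \<omega> ^ (r * (t 1 + 2 * t 2)))" for r
    proof -
      have "E l r = (\<Sum>t\<in>B l. \<Prod>i\<in>{0..2}. (\<omega> ^ (r * i) * z i) ^ t i / fact (t i))"
        unfolding E_def B_def by (intro prod_sum_PiE) auto
      also have "\<dots> = (\<Sum>t\<in>B l. w t * \<omega> ^ (r * (t 1 + 2 * t 2)))"
        by (intro sum.cong refl)
          (simp add: I w_def power_mult_distrib power_add algebra_simps flip: power_mult)
      finally show ?thesis .
    qed
    then have "(\<Sum>r\<in>{0..2}. E l r) = (\<Sum>t\<in>B l. w t * (\<Sum>r\<in>{0..2}. \<omega> ^ (r * (t 1 + 2 * t 2))))"
      by (simp add: sum_distrib_left) (rule sum.swap)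
    also have "\<dots> = (\<Sum>t\<in>B l. if 3 dvd (t 1 + 2 * t 2) then 3 * complex_of_real (w t) else 0)"
      unfolding \<omega>_def sum_cube_root_powers by (intro sum.cong) auto
    also have "\<dots> = 3 * complex_of_real (S l)"
      using finB by (simp add: S_def sum.inter_filter[symmetric] sum_distrib_left)
    finally show ?thesis by simp
  qed
  have Elim: "(\<lambda>l. E l r) \<longlonglongrightarrow> (\<Prod>i\<in>{0..2::nat}. exp (\<omega> ^ (r * i) * z i))" for r
  proof -
    have "(\<lambda>l. \<Sum>j\<le>l. x ^ j / fact j) \<longlonglongrightarrow> exp x" for x :: complex
    proof -
      have "(\<lambda>j. x ^ j / fact j) sums exp x"
        using exp_converges[of x] by (simp add: scaleR_conv_of_real divide_inverse mult.commute)
      then show ?thesis by (simp add: sums_def_le)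
    qed
    then show ?thesis unfolding E_def by (intro tendsto_prod) auto
  qed
  have "(\<lambda>l. complex_of_real (S l)) \<longlonglongrightarrow> (\<Sum>r\<in>{0..2}. \<Prod>i\<in>{0..2::nat}. exp (\<omega> ^ (r * i) * z i)) / 3"
    unfolding S_eq by (intro tendsto_divide tendsto_sum Elim tendsto_const) auto
  from tendsto_Re[OF this]
  have Slim: "S \<longlonglongrightarrow> Re ((\<Sum>r\<in>{0..2}. \<Prod>i\<in>{0..2::nat}. exp (\<omega> ^ (r * i) * z i)) / 3)"
    by (simp only: Re_complex_of_real)
  have Bmono: "B l \<subseteq> B l'" if "l \<le> l'" for l l'
    unfolding B_def using that by (intro PiE_mono) auto
  have Sinc: "incseq S"
    unfolding incseq_def
  proof (intro allI impI)
    fix l l' :: nat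
    assume "l \<le> l'"
    then show "S l \<le> S l'"
      unfolding S_def using finB w0 Bmono[of l l'] by (intro sum_mono2) auto
  qed
  have S_le: "S l \<le> Re ((\<Sum>r\<in>{0..2}. \<Prod>i\<in>{0..2::nat}. exp (\<omega> ^ (r * i) * z i)) / 3)" for l
    by (rule incseq_le[OF Sinc Slim])
  \<comment> \<open>For \<open>r = 1\<close> and \<open>r = 2\<close> only the modulus of the
    product is used; it depends on \<open>z 1\<close> and \<open>z 2\<close> through their sum
    alone.\<close>
  have norm_le: "Re (\<Prod>i\<in>{0..2::nat}. exp (\<omega> ^ (r * i) * z i)) \<le> exp (z 0 - (z 1 + z 2) / 2)"
    if "Re (\<omega> ^ r) = - 1 / 2" "Re (\<omega> ^ (r * 2)) = - 1 / 2" for r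
  proof -
    have "Re (\<Prod>i\<in>{0..2::nat}. exp (\<omega> ^ (r * i) * z i)) \<le> norm (\<Prod>i\<in>{0..2::nat}. exp (\<omega> ^ (r * i) * z i))"
      by (rule complex_Re_le_cmod)
    also have "\<dots> = exp (z 0 - (z 1 + z 2) / 2)"
      using that by (simp add: I norm_mult flip: exp_add) (simp add: field_simps)
    finally show ?thesis .
  qed
  have Re1: "Re (\<omega> ^ 1) = - 1 / 2" by (simp add: \<omega>_def cos_120)
  have Re2: "Re (\<omega> ^ 2) = - 1 / 2"
    by (simp add: \<omega>_def power2_eq_square cos_120 sin_120)
  have Re4: "Re (\<omega> ^ 4) = - 1 / 2"
    by (simp add: \<omega>_def power4_eq_xxxx cos_120 sin_120)
  define P where "P r = (\<Prod>i\<in>{0..2::nat}. exp (\<omega> ^ (r * i) * z i))" for r :: nat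
  have "P 0 = complex_of_real (exp (z 0) * (exp (z 1) * exp (z 2)))"
    by (simp add: P_def I exp_of_real)
  then have P0: "Re (P 0) = exp (z 0 + (z 1 + z 2))"
    by (simp only: Re_complex_of_real exp_add)
  have P1: "Re (P 1) \<le> exp (z 0 - (z 1 + z 2) / 2)"
    unfolding P_def by (rule norm_le) (use Re1 Re2 in simp_all)
  have P2: "Re (P 2) \<le> exp (z 0 - (z 1 + z 2) / 2)"
    unfolding P_def by (rule norm_le) (use Re2 Re4 in simp_all)
  have sum3: "Re ((\<Sum>r\<in>{0..2}. P r) / 3) = (Re (P 0) + Re (P 1) + Re (P 2)) / 3"
    by (simp add: I)
  have S_le': "S l \<le> Gbound (z 0) (z 1 + z 2) + 1 + z 0" for l
  proof -
    have "Re ((\<Sum>r\<in>{0..2}. P r) / 3) \<le> (exp (z 0 + (z 1 + z 2)) + 2 * exp (z 0 - (z 1 + z 2) / 2)) / 3"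
      using P1 P2 unfolding sum3 P0 by simp
    moreover have "S l \<le> Re ((\<Sum>r\<in>{0..2}. P r) / 3)"
      unfolding P_def by (rule S_le)
    ultimately show ?thesis unfolding Gbound_def by simp
  qed
  define T where "T = {t\<in>B L. 2 \<le> (\<Sum>i\<in>{0..2}. t i) \<and> 3 dvd (t 1 + 2 * t 2)}"
  \<comment> \<open>These are the two triples that pass the congruence with sum below 2. The box is
    enlarged to \<open>L + 1\<close> so that it contains \<open>t1\<close> also for
    \<open>L = 0\<close>.\<close>
  define t0 t1 :: "nat \<Rightarrow> nat" where "t0 = (\<lambda>i\<in>{0..2}. 0)" and "t1 = (\<lambda>i\<in>{0..2}. if i = 0 then 1 else 0)"
  have ne: "t0 \<noteq> t1" by (auto simp: t0_def t1_def fun_eq_iff)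
  have "sum w (T \<union> {t0, t1}) \<le> S (L + 1)"
    unfolding S_def
  proof (rule sum_mono2)
    have "T \<subseteq> {t\<in>B (L + 1). 3 dvd (t 1 + 2 * t 2)}" using Bmono[of L "L + 1"] by (auto simp: T_def)
    moreover have "{t0, t1} \<subseteq> {t\<in>B (L + 1). 3 dvd (t 1 + 2 * t 2)}" by (auto simp: B_def t0_def t1_def)
    ultimately show "T \<union> {t0, t1} \<subseteq> {t\<in>B (L + 1). 3 dvd (t 1 + 2 * t 2)}" by (rule Un_least)
  qed (use finB w0 in auto)
  moreover have "sum w (T \<union> {t0, t1}) = sum w T + sum w {t0, t1}"
    using finB by (intro sum.union_disjoint) (auto simp: T_def t0_def t1_def I)
  moreover have "sum w {t0, t1} = 1 + z 0"
    using ne by (simp add: w_def t0_def t1_def I)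
  ultimately have "sum w T \<le> Gbound (z 0) (z 1 + z 2)"
    using S_le'[of "L + 1"] by simp
  then show ?thesis by (simp add: T_def B_def w_def)
qed

text \<open>The preceding bound, already for the box \<open>{..0}\<close>, has a non-negative left
  side.\<close>

lemma Gbound_nonneg:
  assumes "0 \<le> z" "0 \<le> u"
  shows "0 \<le> Gbound z u"
proof -
  define f where "f i = (if i = (0::nat) then z else if i = 1 then u else 0)" for i
  have f: "0 \<le> f i" for i using assms by (simp add: f_def)
  have "0 \<le> (\<Sum>t\<in>{t\<in>{0..2::nat} \<rightarrow>\<^sub>E {..0::nat}. 2 \<le> (\<Sum>i\<in>{0..2}. t i) \<and> 3 dvd (t 1 + 2 * t 2)}.
           \<Prod>i\<in>{0..2}. f i ^ t i / fact (t i))"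
    by (intro sum_nonneg prod_nonneg divide_nonneg_nonneg zero_le_power f fact_ge_zero ballI)
  also have "\<dots> \<le> Gbound (f 0) (f 1 + f 2)" using f by (rule sum_triples_le_Gbound)
  finally show ?thesis by (simp add: f_def)
qed

text \<open>Formulas are grouped by the table \<open>v\<close> of colour counts per variable. A
  table is realised \<open>R\<close> divided by its factorials many times, and \<open>Z\<close> is
  the product of its weights, so it contributes at most \<open>R\<close> times a product over the
  variables. Summing over all tables with rows in \<open>T\<close>, whatever their column totals,
  factorises the sum; this is the step from a coefficient to the value at a point.\<close>

lemma card_zero_sum_fibres_le:
  fixes z :: "nat \<Rightarrow> real" and col :: "'a \<Rightarrow> nat"
  assumes fin: "finite A" "finite V" and col: "col ` A \<subseteq> {0..2}" and z: "\<And>i. 0 \<le> z i"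
  shows "real (card {\<sigma> \<in> A \<rightarrow>\<^sub>E V. \<forall>x\<in>V. 2 \<le> card {a\<in>A. \<sigma> a = x} \<and> 3 dvd (\<Sum>a\<in>{a\<in>A. \<sigma> a = x}. col a)})
           * (\<Prod>i\<in>{0..2}. z i ^ card {a\<in>A. col a = i})
       \<le> (\<Prod>i\<in>{0..2}. fact (card {a\<in>A. col a = i})) * Gbound (z 0) (z 1 + z 2) ^ card V"
proof -
  let ?I = "{0..2::nat}"
  define S where "S = {\<sigma> \<in> A \<rightarrow>\<^sub>E V. \<forall>x\<in>V. 2 \<le> card {a\<in>A. \<sigma> a = x} \<and> 3 dvd (\<Sum>a\<in>{a\<in>A. \<sigma> a = x}. col a)}"
  define T where "T = {t\<in>?I \<rightarrow>\<^sub>E {..card A}. 2 \<le> (\<Sum>i\<in>?I. t i) \<and> 3 dvd (t 1 + 2 * t 2)}"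
  define w where "w t = (\<Prod>i\<in>?I. z i ^ t i / fact (t i))" for t :: "nat \<Rightarrow> nat"
  define cnt where "cnt \<sigma> = (\<lambda>x\<in>V. \<lambda>i\<in>?I. card {a\<in>A. col a = i \<and> \<sigma> a = x})" for \<sigma>
  define Z where "Z = (\<Prod>i\<in>?I. z i ^ card {a\<in>A. col a = i})"
  define R where "R = (\<Prod>i\<in>?I. fact (card {a\<in>A. col a = i}) :: real)"
  have finS: "finite S" unfolding S_def using fin by (intro finite_subset[OF _ finite_PiE[of A "\<lambda>_. V"]]) auto
  have finT: "finite T" unfolding T_def by (intro finite_subset[OF _ finite_PiE[of ?I "\<lambda>_. {..card A}"]]) auto
  have w0: "0 \<le> w t" for t using z by (auto simp: w_def intro!: prod_nonneg)
  have Z0: "0 \<le> Z" using z by (auto simp: Z_def intro!: prod_nonneg)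
  have cntT: "cnt \<sigma> \<in> V \<rightarrow>\<^sub>E T" if \<sigma>: "\<sigma> \<in> S" for \<sigma>
  proof -
    have "(\<lambda>i\<in>?I. card {a\<in>A. col a = i \<and> \<sigma> a = x}) \<in> T" if x: "x \<in> V" for x
    proof -
      let ?F = "{a\<in>A. \<sigma> a = x}"
      let ?c = "\<lambda>i. card {a\<in>A. col a = i \<and> \<sigma> a = x}"
      have Fi: "{a\<in>?F. col a = i} = {a\<in>A. col a = i \<and> \<sigma> a = x}" for i by auto
      have im: "col ` ?F \<subseteq> ?I" using col by auto
      have "card ?F = (\<Sum>i\<in>?I. ?c i)"
      proof -
        have "(\<Sum>a\<in>?F. 1) = (\<Sum>i\<in>?I. \<Sum>a\<in>{a\<in>?F. col a = i}. 1::nat)"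
          by (rule sum.group[symmetric]) (use fin im in auto)
        then show ?thesis by (simp only: Fi card_eq_sum)
      qed
      moreover have "(\<Sum>a\<in>?F. col a) = (\<Sum>i\<in>?I. ?c i * i)"
      proof -
        have "(\<Sum>a\<in>?F. col a) = (\<Sum>i\<in>?I. \<Sum>a\<in>{a\<in>?F. col a = i}. col a)"
          by (rule sum.group[symmetric]) (use fin im in auto)
        also have "\<dots> = (\<Sum>i\<in>?I. ?c i * i)"
          by (intro sum.cong refl) (simp add: Fi[symmetric])
        finally show ?thesis .
      qed
      moreover have "(\<Sum>i\<in>?I. g i * i) = g 1 + 2 * g 2" for g :: "nat \<Rightarrow> nat"
        by (simp add: numeral_2_eq_2)
      moreover have "2 \<le> card ?F" "3 dvd (\<Sum>a\<in>?F. col a)" using \<sigma> x by (auto simp: S_def)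
      ultimately have *: "2 \<le> (\<Sum>i\<in>?I. ?c i)" "3 dvd (?c 1 + 2 * ?c 2)" by (simp_all only:)
      have "?c i \<in> {..card A}" for i
        unfolding atMost_iff by (rule card_mono) (use fin in auto)
      then have "(\<lambda>i\<in>?I. ?c i) \<in> ?I \<rightarrow>\<^sub>E {..card A}" by (intro PiE_I restrict_apply) (simp_all only: restrict_apply if_True if_False)
      moreover have "(\<Sum>i\<in>?I. (\<lambda>i\<in>?I. ?c i) i) = (\<Sum>i\<in>?I. ?c i)" by (intro sum.cong) auto
      moreover have "(\<lambda>i\<in>?I. ?c i) 1 = ?c 1" "(\<lambda>i\<in>?I. ?c i) 2 = ?c 2" by simp_all
      ultimately show ?thesis unfolding T_def using * by (simp only: mem_Collect_eq)
    qed
    then show ?thesis by (auto simp: cnt_def)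
  qed
  have bound: "real (card {\<sigma>\<in>S. cnt \<sigma> = v}) * Z \<le> R * (\<Prod>x\<in>V. w (v x))" if v: "v \<in> V \<rightarrow>\<^sub>E T" for v
  proof (cases "{\<sigma>\<in>S. cnt \<sigma> = v} = {}")
    case True
    have "0 \<le> R * (\<Prod>x\<in>V. w (v x))"
      unfolding R_def by (intro mult_nonneg_nonneg prod_nonneg ballI w0 fact_ge_zero)
    then show ?thesis by (simp only: True card.empty of_nat_0 mult_zero_left)
  next
    case False
    then obtain \<sigma> where \<sigma>: "\<sigma> \<in> S" "cnt \<sigma> = v" by blast
    have vx: "v x i = card {a\<in>A. col a = i \<and> \<sigma> a = x}" if "x \<in> V" "i \<in> ?I" for x i
      using \<sigma> that by (auto simp: cnt_def)
    have tot: "(\<Sum>x\<in>V. v x i) = card {a\<in>A. col a = i}" if i: "i \<in> ?I" for i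
    proof -
      have "\<sigma> ` {a\<in>A. col a = i} \<subseteq> V" using \<sigma> by (auto simp: S_def)
      moreover have "{a\<in>{a\<in>A. col a = i}. \<sigma> a = x} = {a\<in>A. col a = i \<and> \<sigma> a = x}" for x by auto
      ultimately have "card {a\<in>A. col a = i} = (\<Sum>x\<in>V. card {a\<in>A. col a = i \<and> \<sigma> a = x})"
        using sum.group[of "{a\<in>A. col a = i}" V \<sigma> "\<lambda>_. 1::nat"] fin by simp
      then show ?thesis using vx i by simp
    qed
    let ?Y = "{f \<in> A \<rightarrow>\<^sub>E V. \<forall>i\<in>?I. \<forall>x\<in>V. card {a\<in>A. col a = i \<and> f a = x} = v x i}"
    have "card ?Y * (\<Prod>i\<in>?I. \<Prod>x\<in>V. fact (v x i)) = (\<Prod>i\<in>?I. fact (card {a\<in>A. col a = i}))"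
      by (rule card_functions_coloured_fibres[OF fin _ col]) (simp_all only: finite_atLeastAtMost tot)
    then have "real (card ?Y * (\<Prod>i\<in>?I. \<Prod>x\<in>V. fact (v x i))) = real (\<Prod>i\<in>?I. fact (card {a\<in>A. col a = i}))"
      by (rule arg_cong)
    then have Y: "real (card ?Y) * (\<Prod>i\<in>?I. \<Prod>x\<in>V. fact (v x i)) = R"
      unfolding R_def by (simp only: of_nat_mult of_nat_prod of_nat_fact)
    have Z_eq: "Z = (\<Prod>i\<in>?I. \<Prod>x\<in>V. fact (v x i)) * (\<Prod>x\<in>V. w (v x))"
    proof -
      have "Z = (\<Prod>i\<in>?I. \<Prod>x\<in>V. z i ^ v x i)"
        unfolding Z_def by (intro prod.cong refl) (simp only: tot[symmetric] power_sum)
      also have "\<dots> = (\<Prod>i\<in>?I. \<Prod>x\<in>V. fact (v x i) * (z i ^ v x i / fact (v x i)))"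
        by (intro prod.cong refl) simp
      also have "\<dots> = (\<Prod>i\<in>?I. \<Prod>x\<in>V. fact (v x i)) * (\<Prod>i\<in>?I. \<Prod>x\<in>V. z i ^ v x i / fact (v x i))"
        by (simp only: prod.distrib)
      also have "(\<Prod>i\<in>?I. \<Prod>x\<in>V. z i ^ v x i / fact (v x i)) = (\<Prod>x\<in>V. w (v x))"
        unfolding w_def by (rule prod.swap)
      finally show ?thesis .
    qed
    have "card {\<sigma>\<in>S. cnt \<sigma> = v} \<le> card ?Y"
    proof (rule card_mono)
      show "finite ?Y" using fin by (intro finite_subset[OF _ finite_PiE[of A "\<lambda>_. V"]]) auto
    qed (auto simp: S_def cnt_def)
    then have "real (card {\<sigma>\<in>S. cnt \<sigma> = v}) * Z \<le> real (card ?Y) * Z"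
      by (intro mult_right_mono Z0 of_nat_mono)
    moreover have "real (card ?Y) * Z = R * (\<Prod>x\<in>V. w (v x))"
      unfolding Z_eq mult.assoc[symmetric] Y ..
    ultimately show ?thesis by (simp only:)
  qed
  have "real (card S) * Z = (\<Sum>v\<in>V \<rightarrow>\<^sub>E T. real (card {\<sigma>\<in>S. cnt \<sigma> = v}) * Z)"
  proof -
    have "card S = (\<Sum>v\<in>V \<rightarrow>\<^sub>E T. card {\<sigma>\<in>S. cnt \<sigma> = v})"
      using sum.group[of S "V \<rightarrow>\<^sub>E T" cnt "\<lambda>_. 1::nat", symmetric] finS fin finT cntT
      unfolding card_eq_sum by (simp only: finite_PiE image_subsetI)
    then show ?thesis by (simp only: of_nat_sum sum_distrib_right)
  qed
  also have "\<dots> \<le> (\<Sum>v\<in>V \<rightarrow>\<^sub>E T. R * (\<Prod>x\<in>V. w (v x)))"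
    by (intro sum_mono bound)
  also have "\<dots> = R * (\<Sum>t\<in>T. w t) ^ card V"
    using prod_sum_PiE[of V "\<lambda>_. T" "\<lambda>_ t. w t"] fin finT by (simp add: sum_distrib_left)
  also have "\<dots> \<le> R * Gbound (z 0) (z 1 + z 2) ^ card V"
  proof (intro mult_left_mono power_mono)
    show "(\<Sum>t\<in>T. w t) \<le> Gbound (z 0) (z 1 + z 2)"
      unfolding T_def w_def by (rule sum_triples_le_Gbound[OF z])
    show "0 \<le> (\<Sum>t\<in>T. w t)" by (intro sum_nonneg w0)
    show "0 \<le> R" unfolding R_def by (intro prod_nonneg ballI fact_ge_zero)
  qed
  finally show ?thesis unfolding S_def Z_def R_def .
qed

text \<open>The largest term of the binomial expansion of \<open>(a + b)\<^sup>a\<^sup>+\<^sup>b\<close> is the one with \<open>a\<^sup>a b\<^sup>b\<close>.\<close>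

lemma fact_mult_fact_le:
  "fact a * fact b * (a + b) ^ (a + b) \<le> (a + b + 1) * fact (a + b) * (a ^ a * b ^ b :: nat)"
proof -
  \<comment> \<open>Equivalently, \<open>a ^ i / fact i\<close> is largest at \<open>i = a\<close>.
    Used for \<open>a\<close> and \<open>b\<close>, it compares every binomial term with the central
    one.\<close>
  have mode: "fact a * a ^ i \<le> fact i * (a ^ a :: nat)" for a i :: nat
  proof (cases "i \<le> a")
    case True
    have "i + j \<le> a \<Longrightarrow> fact (i + j) \<le> a ^ j * (fact i :: nat)" for j
    proof (induction j)
      case (Suc j)
      have "fact (i + Suc j) = Suc (i + j) * (fact (i + j) :: nat)" by simp
      also have "\<dots> \<le> a * (a ^ j * fact i)" using Suc by (intro mult_mono) auto
      finally show ?case by (simp only: power_Suc mult.assoc)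
    qed simp
    from this[of "a - i"] have "fact a \<le> a ^ (a - i) * (fact i :: nat)" using True by simp
    then have "fact a * a ^ i \<le> a ^ (a - i) * fact i * a ^ i" by (rule mult_right_mono) simp
    also have "\<dots> = fact i * (a ^ (a - i) * a ^ i)" by (simp only: mult_ac)
    also have "a ^ (a - i) * a ^ i = a ^ a" using True by (simp flip: power_add)
    finally show ?thesis .
  next
    case False
    then have "a \<le> i" by simp
    then have "fact a * a ^ (i - a) \<le> (fact i :: nat)"
    proof (induction i rule: dec_induct)
      case (step i)
      have "fact a * a ^ (Suc i - a) = a * (fact a * a ^ (i - a))" using step by (simp add: Suc_diff_le)
      also have "\<dots> \<le> Suc i * fact i" using step by (intro mult_mono) auto
      finally show ?case by simp
    qed simp
    then have "(fact a * a ^ (i - a)) * a ^ a \<le> fact i * a ^ a" by (rule mult_right_mono) simp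
    moreover have "a ^ (i - a) * a ^ a = a ^ i" using False by (simp flip: power_add)
    ultimately show ?thesis by (simp add: mult.assoc)
  qed
  have "fact a * fact b * (a + b) ^ (a + b)
      = (\<Sum>i\<le>a + b. fact a * fact b * (((a + b) choose i) * a ^ i * b ^ (a + b - i)))"
    by (simp add: binomial sum_distrib_left)
  also have "\<dots> \<le> (\<Sum>i\<le>a + b. fact (a + b) * (a ^ a * b ^ b))"
  proof (intro sum_mono)
    fix i assume "i \<in> {..a + b}"
    then have i: "i \<le> a + b" by simp
    have "fact a * fact b * (((a + b) choose i) * a ^ i * b ^ (a + b - i))
      = ((a + b) choose i) * ((fact a * a ^ i) * (fact b * b ^ (a + b - i)))" by (simp add: mult_ac)
    also have "\<dots> \<le> ((a + b) choose i) * ((fact i * a ^ a) * (fact (a + b - i) * b ^ b))"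
      by (intro mult_left_mono mult_mono mode) auto
    also have "\<dots> = (fact i * fact (a + b - i) * ((a + b) choose i)) * (a ^ a * b ^ b)" by (simp add: mult_ac)
    also have "\<dots> = fact (a + b) * (a ^ a * b ^ b)" using binomial_fact_lemma[OF i] by simp
    finally show "fact a * fact b * (((a + b) choose i) * a ^ i * b ^ (a + b - i)) \<le> fact (a + b) * (a ^ a * b ^ b)" .
  qed
  also have "\<dots> = (a + b + 1) * fact (a + b) * (a ^ a * b ^ b)" by (simp add: algebra_simps)
  finally show ?thesis .
qed

text \<open>\<open>Gbound\<close> sees only the total weight \<open>u\<close> of the colours 1 and
  2, so \<open>u\<close> may be split between them freely. Splitting it in the ratio of their slot
  numbers \<open>a\<close> and \<open>b\<close> costs a factor \<open>\<theta>\<close> that cancels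
  \<open>fact a * fact b / fact (a + b)\<close> up to a linear factor. The bound then depends on
  \<open>c\<close> only through \<open>q\<close>.\<close>

lemma card_dual_le:
  fixes k m n q :: nat and c :: "nat \<Rightarrow> nat"
  defines "A \<equiv> {1..m} \<times> {..<k}"
  assumes c: "c \<in> {1..m} \<rightarrow>\<^sub>E {0..2}" and q: "q = card {j\<in>{1..m}. c j \<noteq> 0}" "0 < q"
    and z: "0 \<le> z" "0 \<le> u" and k: "0 < k"
  shows "real (card {\<sigma> \<in> A \<rightarrow>\<^sub>E {1..n}. \<forall>x\<in>{1..n}. 2 \<le> card {a\<in>A. \<sigma> a = x} \<and> 3 dvd (\<Sum>a\<in>{a\<in>A. \<sigma> a = x}. c (fst a))})
           * (z ^ (k * (m - q)) * u ^ (k * q))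
       \<le> (real (k * q) + 1) * fact (k * (m - q)) * fact (k * q) * Gbound z u ^ n"
    (is "?S * _ \<le> _")
proof -
  define \<mu> where "\<mu> i = card {j\<in>{1..m}. c j = i}" for i
  have cA: "card {a\<in>A. c (fst a) = i} = k * \<mu> i" for i
  proof -
    have "{a\<in>A. c (fst a) = i} = {j\<in>{1..m}. c j = i} \<times> {..<k}" by (auto simp: A_def)
    then show ?thesis by (simp only: card_cartesian_product \<mu>_def card_lessThan mult.commute)
  qed
  have q12: "q = \<mu> 1 + \<mu> 2"
  proof -
    have "{j\<in>{1..m}. c j \<noteq> 0} = {j\<in>{1..m}. c j = 1} \<union> {j\<in>{1..m}. c j = 2}"
    proof -
      have "c j = 0 \<or> c j = 1 \<or> c j = 2" if "j \<in> {1..m}" for j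
      proof -
        have "c j \<in> {0..2}" using c that by blast
        then show ?thesis by auto
      qed
      then show ?thesis by force
    qed
    then show ?thesis unfolding q \<mu>_def by (simp only:) (rule card_Un_disjoint, auto)
  qed
  have m0: "\<mu> 0 = m - q"
  proof -
    have "{j\<in>{1..m}. c j = 0} = {1..m} - {j\<in>{1..m}. c j \<noteq> 0}" by auto
    moreover have "card ({1..m} - {j\<in>{1..m}. c j \<noteq> 0}) = card {1..m} - card {j\<in>{1..m}. c j \<noteq> 0}"
      by (rule card_Diff_subset) auto
    ultimately show ?thesis unfolding q(1) \<mu>_def by (simp only: card_atLeastAtMost diff_Suc_1)
  qed
  define a b where "a = k * \<mu> 1" and "b = k * \<mu> 2"
  have ab: "a + b = k * q" by (simp add: a_def b_def q12 algebra_simps)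
  define zz where "zz i = (if i = (0::nat) then z else if i = 1 then u * (real a / real (a + b)) else u * (real b / real (a + b)))" for i
  have zz0: "0 \<le> zz i" for i using z by (auto simp: zz_def)
  have ab0: "a + b > 0" using ab q k by simp
  then have "0 < real (a + b)" by (simp only: of_nat_0_less_iff)
  then have abr: "0 < real a + real b" by (simp only: of_nat_add)
  have zsum: "zz 1 + zz 2 = u"
  proof -
    have "zz 1 + zz 2 = u * (real a + real b) / (real a + real b)"
      by (simp add: zz_def add_divide_distrib distrib_left)
    then show ?thesis using abr by simp
  qed
  define \<theta> where "\<theta> = (real a / real (a + b)) ^ a * (real b / real (a + b)) ^ b"
  have \<theta>_eq: "\<theta> * real (a + b) ^ (a + b) = real a ^ a * real b ^ b"
    using ab0 by (simp add: \<theta>_def power_divide power_add)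
  \<comment> \<open>If \<open>a\<close> or \<open>b\<close> is 0, its factor is
    \<open>0 ^ 0 = 1\<close>.\<close>
  have \<theta>0: "0 < \<theta>" unfolding \<theta>_def by (cases "a = 0"; cases "b = 0") auto
  have G0: "0 \<le> Gbound z u"
    using z by (rule Gbound_nonneg)
  have I: "{0..2::nat} = {0, 1, 2}" by auto
  have "?S * (z ^ (k * (m - q)) * (zz 1 ^ a * zz 2 ^ b)) \<le> fact (k * (m - q)) * (fact a * fact b) * Gbound z u ^ n"
  proof -
    have col: "(\<lambda>a. c (fst a)) ` A \<subseteq> {0..2}" using c by (force simp: A_def)
    have expand: "(\<Prod>i\<in>{0..2}. g i) = g 0 * (g 1 * g 2)" for g :: "nat \<Rightarrow> real"
      by (simp add: I)
    have "finite A" by (simp add: A_def)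
    note bound = card_zero_sum_fibres_le[of A "{1..n}" "\<lambda>a. c (fst a)" zz, OF this finite_atLeastAtMost col zz0]
    have "zz 0 = z" by (simp add: zz_def)
    with bound show ?thesis
      by (simp only: expand cA m0 a_def[symmetric] b_def[symmetric] zsum card_atLeastAtMost diff_Suc_1 mult.assoc)
  qed
  also have "zz 1 ^ a * zz 2 ^ b = u ^ (k * q) * \<theta>"
  proof -
    have zz12: "zz 1 = u * (real a / real (a + b))" "zz 2 = u * (real b / real (a + b))" by (simp_all add: zz_def)
    show ?thesis unfolding zz12 power_mult_distrib \<theta>_def ab[symmetric] power_add by (simp only: mult_ac)
  qed
  finally have 1: "(?S * (z ^ (k * (m - q)) * u ^ (k * q))) * \<theta> \<le> fact (k * (m - q)) * (fact a * fact b) * Gbound z u ^ n"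
    by (simp add: mult_ac)
  have 2: "fact a * fact b \<le> (real (k * q) + 1) * fact (k * q) * \<theta>"
  proof -
    have "real (fact a * fact b * (a + b) ^ (a + b)) \<le> real ((a + b + 1) * fact (a + b) * (a ^ a * b ^ b))"
      using fact_mult_fact_le[of a b] by (simp only: of_nat_le_iff)
    then have "(fact a * fact b) * real (a + b) ^ (a + b) \<le> (real (a + b) + 1) * fact (a + b) * (real a ^ a * real b ^ b)"
      by (simp add: algebra_simps)
    also have "\<dots> = ((real (a + b) + 1) * fact (a + b) * \<theta>) * real (a + b) ^ (a + b)"
      by (simp add: \<theta>_eq[symmetric])
    finally show ?thesis using ab0 by (simp add: ab)
  qed
  have "(?S * (z ^ (k * (m - q)) * u ^ (k * q))) * \<theta>
     \<le> fact (k * (m - q)) * ((real (k * q) + 1) * fact (k * q) * \<theta>) * Gbound z u ^ n"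
    using 1 2 G0 by (meson fact_ge_zero mult_left_mono mult_right_mono order_trans zero_le_power)
  also have "\<dots> = ((real (k * q) + 1) * fact (k * (m - q)) * fact (k * q) * Gbound z u ^ n) * \<theta>"
    by (simp add: mult_ac)
  finally show ?thesis using \<theta>0 by (simp only: mult_le_cancel_right_pos)
qed

section \<open>The number of formulas\<close>

text \<open>Polya frequency of order two: the 2 by 2 minors of the Toeplitz matrix of
  \<open>u\<close> are non-negative. Beyond log-concavity of neighbours this excludes internal
  zeros, and in this form the property passes to products.\<close>

definition pf2 :: "(nat \<Rightarrow> real) \<Rightarrow> bool" where
  "pf2 u \<longleftrightarrow> (\<forall>i. 0 \<le> u i) \<and> (\<forall>x \<alpha> \<beta>. u x * u (x + \<alpha> + \<beta>) \<le> u (x + \<alpha>) * u (x + \<beta>))"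

text \<open>Cauchy--Binet for \<open>2 \<times> 2\<close> minors of a product of Toeplitz matrices.\<close>

lemma pf2_fps_mult:
  fixes f g :: "real fps"
  assumes f: "pf2 (fps_nth f)" and g: "pf2 (fps_nth g)"
  shows "pf2 (fps_nth (f * g))"
proof -
  define T where "T h r i = (if i \<le> r then fps_nth h (r - i) else 0)" for h :: "real fps" and r i :: nat
  have T_minor: "0 \<le> T h r i * T h r' j - T h r j * T h r' i"
    if h: "pf2 (fps_nth h)" and "r \<le> r'" "i \<le> j" for h r r' i j
  proof (cases "j \<le> r")
    case True
    have "fps_nth h (r - j) * fps_nth h ((r - j) + (j - i) + (r' - r))
        \<le> fps_nth h ((r - j) + (j - i)) * fps_nth h ((r - j) + (r' - r))"
      using h by (auto simp: pf2_def)
    moreover have "(r - j) + (j - i) + (r' - r) = r' - i" "(r - j) + (j - i) = r - i" "(r - j) + (r' - r) = r' - j"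
      using True that by auto
    ultimately show ?thesis using True that by (simp add: T_def)
  next
    case False
    then show ?thesis using h by (auto simp: T_def pf2_def)
  qed
  have nn: "0 \<le> fps_nth (f * g) i" for i
    using f g by (auto simp: fps_mult_nth pf2_def intro!: sum_nonneg)
  have conv: "fps_nth (f * g) (r - c) = (\<Sum>i\<le>R. T f r i * T g i c)" if "c \<le> r" "r \<le> R" for r c R
  proof -
    have "fps_nth (f * g) (r - c) = (\<Sum>j=0..r - c. fps_nth g j * fps_nth f (r - c - j))"
      by (subst mult.commute) (rule fps_mult_nth)
    also have "\<dots> = (\<Sum>i\<in>{c..r}. fps_nth g (i - c) * fps_nth f (r - i))"
      using that by (intro sum.reindex_bij_witness[of _ "\<lambda>i. i - c" "\<lambda>j. j + c"]) (auto simp: add.commute)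
    also have "\<dots> = (\<Sum>i\<in>{c..r}. T f r i * T g i c)"
      by (intro sum.cong) (auto simp: T_def)
    also have "\<dots> = (\<Sum>i\<le>R. T f r i * T g i c)"
      using that by (intro sum.mono_neutral_left) (auto simp: T_def)
    finally show ?thesis .
  qed
  have "fps_nth (f * g) x * fps_nth (f * g) (x + \<alpha> + \<beta>) \<le> fps_nth (f * g) (x + \<alpha>) * fps_nth (f * g) (x + \<beta>)" for x \<alpha> \<beta>
  proof -
    define R r where "R = x + \<alpha> + \<beta>" and "r = x + \<alpha>"
    let ?A = "\<lambda>i j. T f r i * T f R j" and ?B = "\<lambda>i j. T g i 0 * T g j \<alpha>"
    have e: "fps_nth (f * g) (x + \<alpha>) = (\<Sum>i\<le>R. T f r i * T g i 0)"
      "fps_nth (f * g) (x + \<beta>) = (\<Sum>i\<le>R. T f R i * T g i \<alpha>)"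
      "fps_nth (f * g) x = (\<Sum>i\<le>R. T f r i * T g i \<alpha>)"
      "fps_nth (f * g) (x + \<alpha> + \<beta>) = (\<Sum>i\<le>R. T f R i * T g i 0)"
      using conv[of 0 r R] conv[of \<alpha> R R] conv[of \<alpha> r R] conv[of 0 R R] by (auto simp: R_def r_def)
    define D where "D = (\<Sum>i\<le>R. \<Sum>j\<le>R. ?A i j * (?B i j - ?B j i))"
    have D: "fps_nth (f * g) (x + \<alpha>) * fps_nth (f * g) (x + \<beta>) - fps_nth (f * g) x * fps_nth (f * g) (x + \<alpha> + \<beta>) = D"
      unfolding e D_def sum_product sum_subtractf[symmetric]
      by (intro sum.cong refl) (simp add: algebra_simps)
    have swap: "D = (\<Sum>i\<le>R. \<Sum>j\<le>R. ?A j i * (?B j i - ?B i j))"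
      unfolding D_def by (rule sum.swap)
    \<comment> \<open>Adding the sum with \<open>i\<close> and \<open>j\<close> exchanged turns each
      summand into a minor for \<open>f\<close> times a minor for \<open>g\<close>. Both are
      non-negative for \<open>i \<le> j\<close> and both non-positive otherwise.\<close>
    have "D + D = (\<Sum>i\<le>R. \<Sum>j\<le>R. ?A i j * (?B i j - ?B j i)) + (\<Sum>i\<le>R. \<Sum>j\<le>R. ?A j i * (?B j i - ?B i j))"
      by (subst (2) swap) (simp only: D_def)
    also have "\<dots> = (\<Sum>i\<le>R. \<Sum>j\<le>R. (?A i j - ?A j i) * (?B i j - ?B j i))"
      unfolding sum.distrib[symmetric] by (intro sum.cong refl) (simp add: algebra_simps)
    also have "\<dots> \<ge> 0"
    proof (intro sum_nonneg)
      fix i j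
      show "0 \<le> (?A i j - ?A j i) * (?B i j - ?B j i)"
      proof (cases "i \<le> j")
        case True
        have "0 \<le> ?A i j - ?A j i" using T_minor[OF f, of r R i j] True by (simp add: R_def r_def mult.commute)
        moreover have "0 \<le> ?B i j - ?B j i"
          using T_minor[OF g, of i j 0 \<alpha>] True by (simp add: mult.commute)
        ultimately show ?thesis by simp
      next
        case False
        have "?A i j - ?A j i \<le> 0" using T_minor[OF f, of r R j i] False by (simp add: R_def r_def mult.commute)
        moreover have "?B i j - ?B j i \<le> 0"
          using T_minor[OF g, of j i 0 \<alpha>] False by (simp add: mult.commute)
        ultimately show ?thesis by (rule mult_nonpos_nonpos)
      qed
    qed
    finally show ?thesis using D by linarith
  qed
  then show ?thesis using nn by (simp add: pf2_def)
qed

text \<open>Factorials are log-convex, and for \<open>x < 2\<close> the left side of the inequality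
  vanishes.\<close>

lemma pf2_trunc_exp: "pf2 (fps_nth trunc_exp)"
proof -
  have "fact (x + \<alpha>) * fact (x + \<beta>) \<le> (fact x * fact (x + \<alpha> + \<beta>) :: real)" for x \<alpha> \<beta> :: nat
  proof (induction \<alpha>)
    case (Suc \<alpha>)
    have "fact (x + Suc \<alpha>) * fact (x + \<beta>) = real (Suc (x + \<alpha>)) * (fact (x + \<alpha>) * fact (x + \<beta>))" by simp
    also have "\<dots> \<le> real (Suc (x + \<alpha> + \<beta>)) * (fact x * fact (x + \<alpha> + \<beta>))"
      by (rule mult_mono) (use Suc in auto)
    also have "\<dots> = fact x * fact (x + Suc \<alpha> + \<beta>)" by simp
    finally show ?case .
  qed simp
  then show ?thesis by (auto simp: pf2_def trunc_exp_def field_simps)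
qed

lemma pf2_trunc_exp_power: "pf2 (fps_nth (trunc_exp ^ n))"
proof (induction n)
  case 0
  show ?case by (auto simp: pf2_def)
next
  case (Suc n)
  then show ?case by (simp add: pf2_fps_mult[OF pf2_trunc_exp])
qed

lemma coeff_nonneg: "0 \<le> fps_nth (trunc_exp ^ n) j"
  using pf2_trunc_exp_power[of n] by (simp add: pf2_def)

lemma coeff_pos: "0 < n \<Longrightarrow> 2 * n \<le> j \<Longrightarrow> 0 < fps_nth (trunc_exp ^ n) j"
proof (induction n arbitrary: j)
  case (Suc n)
  show ?case
  proof (cases "n = 0")
    case True
    then show ?thesis using Suc by (simp add: trunc_exp_def)
  next
    case False
    have "0 < fps_nth trunc_exp 2 * fps_nth (trunc_exp ^ n) (j - 2)"
      using Suc False by (intro mult_pos_pos Suc.IH) (auto simp: trunc_exp_def)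
    also have "\<dots> \<le> (\<Sum>i=0..j. fps_nth trunc_exp i * fps_nth (trunc_exp ^ n) (j - i))"
      using Suc.prems by (intro member_le_sum) (auto intro!: mult_nonneg_nonneg coeff_nonneg coeff_nonneg[of 1, simplified])
    finally show ?thesis by (simp add: fps_mult_nth)
  qed
qed simp

text \<open>The derivative of \<open>trunc_exp\<close> is \<open>trunc_exp + fps_X\<close>; the
  inequality discards what \<open>fps_X\<close> contributes. It bounds the ratio of consecutive
  coefficients, which later serves as the tilting point.\<close>

lemma coeff_Suc_ge: "real n * fps_nth (trunc_exp ^ n) j \<le> real (Suc j) * fps_nth (trunc_exp ^ n) (Suc j)"
proof (cases n)
  case (Suc n')
  have D: "fps_deriv trunc_exp = trunc_exp + fps_X"
  proof (rule fps_ext)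
    fix j :: nat
    have "j = 0 \<or> j = 1 \<or> 2 \<le> j" by auto
    then show "fps_nth (fps_deriv trunc_exp) j = fps_nth (trunc_exp + fps_X) j"
    proof (elim disjE)
      assume j: "2 \<le> j"
      have "fps_nth (fps_deriv trunc_exp) j = real (Suc j) * (1 / (real (Suc j) * fact j))"
        using j by (simp add: trunc_exp_def del: of_nat_Suc)
      then show ?thesis using j by (simp add: trunc_exp_def)
    qed (auto simp: trunc_exp_def)
  qed
  have "fps_deriv (trunc_exp ^ n) = of_nat n * (trunc_exp + fps_X) * trunc_exp ^ n'"
    using Suc by (simp only: fps_deriv_power' D diff_Suc_1)
  also have "\<dots> = fps_const (real n) * (trunc_exp ^ n + fps_X * trunc_exp ^ n')"
    unfolding Suc power_Suc fps_of_nat by (simp only: distrib_left distrib_right mult.assoc)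
  finally have "real (Suc j) * fps_nth (trunc_exp ^ n) (Suc j) = real n * fps_nth (trunc_exp ^ n + fps_X * trunc_exp ^ n') j"
    by (metis fps_deriv_nth fps_mult_left_const_nth Suc_eq_plus1)
  also have "\<dots> \<ge> real n * fps_nth (trunc_exp ^ n) j"
    by (intro mult_left_mono) (auto simp: coeff_nonneg)
  finally show ?thesis .
qed simp

section \<open>Values of the series and the saddle point bound\<close>

definition texp :: "real \<Rightarrow> real" where "texp x = exp x - x - 1"

lemma exp_sums: "(\<lambda>j. x ^ j / fact j) sums exp (x :: real)"
  using exp_converges[of x] by (simp add: divide_inverse mult.commute)

lemma trunc_exp_sums: "(\<lambda>j. fps_nth trunc_exp j * x ^ j) sums texp x"
proof -
  have "(\<lambda>j. if j \<in> {0, 1} then x ^ j / fact j else 0) sums (\<Sum>j\<in>{0, 1}. x ^ j / fact j)"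
    by (rule sums_If_finite_set) simp
  from sums_diff[OF exp_sums[of x] this]
  have "(\<lambda>j. x ^ j / fact j - (if j \<in> {0, 1} then x ^ j / fact j else 0)) sums texp x"
    by (simp add: texp_def diff_diff_add add.commute)
  moreover have "x ^ j / fact j - (if j \<in> {0, 1} then x ^ j / fact j else 0) = fps_nth trunc_exp j * x ^ j" for j
    by (auto simp: trunc_exp_def)
  ultimately show ?thesis by simp
qed

text \<open>Divided by \<open>texp x\<close>, this first moment is \<open>Q x\<close>.\<close>

lemma trunc_exp_moment_sums: "(\<lambda>j. real j * (fps_nth trunc_exp j * x ^ j)) sums (x * (exp x - 1))"
proof -
  have "(\<lambda>j. real (Suc j) * (x ^ Suc j / fact (Suc j))) sums (x * exp x)"
  proof -
    have "real (Suc j) * (x ^ Suc j / fact (Suc j)) = x * (x ^ j / fact j)" for j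
      by (simp del: of_nat_Suc)
    then show ?thesis using sums_mult[OF exp_sums[of x], of x] by (simp only:)
  qed
  then have "(\<lambda>j. real j * (x ^ j / fact j)) sums (x * exp x)"
    by (subst (asm) sums_Suc_iff) simp
  moreover have "(\<lambda>j. if j \<in> {1} then real j * (x ^ j / fact j) else 0) sums (\<Sum>j\<in>{1}. real j * (x ^ j / fact j))"
    by (rule sums_If_finite_set) simp
  ultimately have "(\<lambda>j. real j * (x ^ j / fact j) - (if j \<in> {1} then real j * (x ^ j / fact j) else 0)) sums (x * exp x - x)"
    using sums_diff by fastforce
  moreover have "real j * (x ^ j / fact j) - (if j \<in> {1} then real j * (x ^ j / fact j) else 0) = real j * (fps_nth trunc_exp j * x ^ j)" for j
  proof -
    have "j = 0 \<or> j = 1 \<or> 2 \<le> j" by auto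
    then show ?thesis by (auto simp: trunc_exp_def)
  qed
  ultimately show ?thesis by (simp add: algebra_simps)
qed

lemma coeff_sums:
  assumes "0 \<le> x"
  shows "(\<lambda>j. fps_nth (trunc_exp ^ n) j * x ^ j) sums texp x ^ n"
proof (induction n)
  case 0
  have "(\<lambda>j. if j \<in> {0} then x ^ j else 0) sums (\<Sum>j\<in>{0}. x ^ j)" by (rule sums_If_finite_set) simp
  moreover have "(if j \<in> {0} then x ^ j else 0) = fps_nth (trunc_exp ^ 0) j * x ^ j" for j by auto
  ultimately show ?case by simp
next
  case (Suc n)
  let ?f = "\<lambda>j. fps_nth trunc_exp j * x ^ j" and ?g = "\<lambda>j. fps_nth (trunc_exp ^ n) j * x ^ j"
  have fn: "norm (?f j) = ?f j" "norm (?g j) = ?g j" for j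
    using assms coeff_nonneg[of 1 j] coeff_nonneg[of n j] by auto
  have "(\<lambda>k. \<Sum>i\<le>k. ?f i * ?g (k - i)) sums ((\<Sum>k. ?f k) * (\<Sum>k. ?g k))"
    by (rule Cauchy_product_sums) (use sums_summable[OF trunc_exp_sums[of x]] sums_summable[OF Suc] in \<open>simp_all only: fn\<close>)
  moreover have "(\<Sum>i\<le>k. ?f i * ?g (k - i)) = fps_nth (trunc_exp ^ Suc n) k * x ^ k" for k
  proof -
    have "?f i * ?g (k - i) = fps_nth trunc_exp i * fps_nth (trunc_exp ^ n) (k - i) * x ^ k" if "i \<le> k" for i
      using that power_add[of x i "k - i"] by simp
    then show ?thesis
      unfolding power_Suc fps_mult_nth atLeast0AtMost sum_distrib_right by (intro sum.cong refl) simp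
  qed
  moreover have "(\<Sum>k. ?f k) = texp x" "(\<Sum>k. ?g k) = texp x ^ n"
    using trunc_exp_sums[of x] Suc by (auto simp: sums_iff)
  ultimately show ?case by simp
qed

lemma texp_ge_sq: "0 \<le> x \<Longrightarrow> x\<^sup>2 / 2 \<le> texp x"
  using exp_lower_Taylor_quadratic[of x] by (simp add: texp_def)

lemma texp_pos: "0 < x \<Longrightarrow> 0 < texp x"
  using texp_ge_sq[of x] by (smt (verit) divide_pos_pos zero_less_power)

text \<open>Jensen's inequality for the truncated exponential, whose mean at parameter \<open>s\<close> is \<open>Q s\<close>.\<close>

lemma texp_tilt_ge:
  assumes "0 < s" "0 < x"
  shows "exp (Q s * ln (x / s)) * texp s \<le> texp x"
proof -
  define t where "t = ln (x / s)"
  have x: "x = s * exp t" using assms by (simp add: t_def)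
  let ?f = "\<lambda>j. fps_nth trunc_exp j * s ^ j"
  have f0: "0 \<le> ?f j" for j using coeff_nonneg[of 1 j] assms by simp
  \<comment> \<open>Here \<open>exp (real j * t)\<close> is replaced by its tangent at the mean
    \<open>Q s\<close>; by the first moment the linear part sums to zero.\<close>
  have "(\<lambda>j. exp (Q s * t) * ((1 - Q s * t) * ?f j + t * (real j * ?f j))) sums
      (exp (Q s * t) * ((1 - Q s * t) * texp s + t * (s * (exp s - 1))))"
    by (intro sums_mult sums_add trunc_exp_sums trunc_exp_moment_sums)
  moreover have "exp (Q s * t) * ((1 - Q s * t) * texp s + t * (s * (exp s - 1))) = exp (Q s * t) * texp s"
  proof -
    have "s * (exp s - 1) = Q s * texp s"
      using texp_pos[OF assms(1)] by (simp add: Q_def texp_def)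
    then show ?thesis by (simp only:) (simp add: algebra_simps)
  qed
  ultimately have S: "(\<lambda>j. exp (Q s * t) * ((1 - Q s * t) * ?f j + t * (real j * ?f j))) sums (exp (Q s * t) * texp s)"
    by (simp only:)
  have "exp (Q s * t) * ((1 - Q s * t) * ?f j + t * (real j * ?f j)) \<le> fps_nth trunc_exp j * x ^ j" for j
  proof -
    have "exp (Q s * t) * (1 + (real j - Q s) * t) \<le> exp (Q s * t) * exp ((real j - Q s) * t)"
      using exp_ge_add_one_self[of "(real j - Q s) * t"] by simp
    also have "\<dots> = exp t ^ j" by (simp add: algebra_simps flip: exp_add exp_of_nat_mult)
    finally have "exp (Q s * t) * (1 + (real j - Q s) * t) * ?f j \<le> exp t ^ j * ?f j"
      using f0 by (rule mult_right_mono)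
    then show ?thesis by (simp add: x power_mult_distrib algebra_simps)
  qed
  from sums_le[OF this S trunc_exp_sums] show ?thesis unfolding t_def .
qed

text \<open>Together with \<open>texp_ge_sq\<close> this controls the growth of \<open>texp\<close>
  when its argument is doubled, uniformly down to 0.\<close>

lemma texp_le_sq_exp:
  assumes "0 \<le> x"
  shows "texp x \<le> x\<^sup>2 / 2 * exp x"
proof -
  have S1: "(\<lambda>j. fps_nth trunc_exp (j + 2) * x ^ (j + 2)) sums texp x"
    using trunc_exp_sums[of x] by (subst sums_iff_shift) (simp add: numeral_2_eq_2 trunc_exp_def)
  have S2: "(\<lambda>j. x\<^sup>2 / 2 * (x ^ j / fact j)) sums (x\<^sup>2 / 2 * exp x)"
    by (intro sums_mult exp_sums)
  have "fps_nth trunc_exp (j + 2) * x ^ (j + 2) \<le> x\<^sup>2 / 2 * (x ^ j / fact j)" for j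
  proof -
    have "2 * fact j \<le> (fact (j + 2) :: real)"
    proof -
      have "2 * fact j \<le> (real (j + 2) * real (j + 1)) * fact j"
      proof (rule mult_right_mono)
        show "2 \<le> real (j + 2) * real (j + 1)" by (simp add: algebra_simps)
      qed simp
      then show ?thesis by (simp add: algebra_simps)
    qed
    then have "1 / fact (j + 2) \<le> 1 / (2 * fact j :: real)" by (intro divide_left_mono) auto
    then have "1 / fact (j + 2) * x ^ (j + 2) \<le> 1 / (2 * fact j) * x ^ (j + 2)"
      using assms by (intro mult_right_mono) auto
    then show ?thesis by (simp add: trunc_exp_def power_add power2_eq_square mult_ac)
  qed
  from sums_le[OF this S1 S2] show ?thesis .
qed

text \<open>Since the coefficients are log-concave, the tilting parameter \<open>x\<close> can be chosen so that
  the \<open>r\<close>-th term of the series at \<open>x\<close> is the largest.\<close>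

lemma coeff_lower_bound:
  assumes n: "0 < n" and r: "2 * n < r" and s: "0 < s" and Qs: "real n * Q s = real r"
    and J: "2 * (4 * exp (2 * (real r / real n))) ^ n \<le> 2 ^ J"
  shows "texp s ^ n / s ^ r \<le> 2 * (real J + 1) * fps_nth (trunc_exp ^ n) r"
proof -
  define a where "a = fps_nth (trunc_exp ^ n)"
  have a0: "0 \<le> a j" for j by (simp add: a_def coeff_nonneg)
  have ap: "0 < a j" if "2 * n \<le> j" for j using n that by (simp add: a_def coeff_pos)
  have lc: "a i * a (i + \<alpha> + \<beta>) \<le> a (i + \<alpha>) * a (i + \<beta>)" for i \<alpha> \<beta>
    using pf2_trunc_exp_power[of n] by (simp add: a_def pf2_def)
  \<comment> \<open>At this point the terms of index \<open>r - 1\<close> and \<open>r\<close> are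
    equal, so log-concavity makes the terms decrease away from \<open>r\<close> on both
    sides.\<close>
  define x where "x = a (r - 1) / a r"
  have ar: "0 < a r" "0 < a (r - 1)" using ap r by auto
  have x0: "0 < x" using ar by (simp add: x_def)
  have ax: "a r * x = a (r - 1)" using ar by (simp add: x_def)
  have r1: "r - 1 + 1 = r" using r by simp
  have x_le: "x \<le> real r / real n"
    using coeff_Suc_ge[of n "r - 1"] r n ar by (simp add: x_def a_def field_simps)
  have up: "a (r + i) * x ^ (r + i) \<le> a r * x ^ r" for i
  proof (induction i)
    case (Suc i)
    have "a (r - 1) * a (r + Suc i) \<le> a r * a (r + i)"
      using lc[of "r - 1" 1 "Suc i"] r1 by (simp add: add.commute add.left_commute)
    then have "a (r + Suc i) * x \<le> a (r + i)"
      using ar by (simp add: x_def field_simps)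
    then have "a (r + Suc i) * x * x ^ (r + i) \<le> a (r + i) * x ^ (r + i)"
      using x0 by (intro mult_right_mono) auto
    then show ?case using Suc by (simp add: mult.assoc)
  qed simp
  have down: "a (r - i) * x ^ (r - i) \<le> a r * x ^ r" if "i \<le> r" for i
    using that
  proof (induction i)
    case (Suc i)
    have "a (r - Suc i) * a r \<le> a (r - i) * a (r - 1)"
      using lc[of "r - Suc i" 1 i] Suc.prems by (simp add: Suc_diff_Suc)
    then have "a (r - Suc i) \<le> a (r - i) * x"
      using ar by (simp add: x_def field_simps)
    then have "a (r - Suc i) * x ^ (r - Suc i) \<le> a (r - i) * x * x ^ (r - Suc i)"
      using x0 by (intro mult_right_mono) auto
    also have "\<dots> = a (r - i) * x ^ Suc (r - Suc i)" by simp
    also have "Suc (r - Suc i) = r - i" using Suc.prems by simp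
    finally show ?case using Suc by simp
  qed simp
  have mode: "a j * x ^ j \<le> a r * x ^ r" for j
    using up[of "j - r"] down[of "r - j"] by (cases "r \<le> j") auto
  \<comment> \<open>Every term beyond \<open>J\<close> is at most \<open>2 ^ J\<close> times smaller
    than the corresponding term at \<open>2 * x\<close>. Doubling the argument costs at most
    \<open>4 * exp (2 * x)\<close> per factor, and the assumption on \<open>J\<close> makes the tail
    at most half of the sum.\<close>
  have tail: "texp (2 * x) ^ n / 2 ^ J \<le> texp x ^ n / 2"
  proof -
    have "texp (2 * x) \<le> 4 * exp (2 * x) * (x\<^sup>2 / 2)"
      using texp_le_sq_exp[of "2 * x"] x0 by (simp add: power2_eq_square)
    also have "\<dots> \<le> 4 * exp (2 * (real r / real n)) * texp x"
      using x_le x0 texp_ge_sq[of x] by (intro mult_mono) auto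
    finally have "texp (2 * x) ^ n \<le> (4 * exp (2 * (real r / real n)) * texp x) ^ n"
      using texp_pos[of "2 * x"] x0 by (intro power_mono) auto
    also have "\<dots> = (4 * exp (2 * (real r / real n))) ^ n * texp x ^ n" by (rule power_mult_distrib)
    also have "\<dots> \<le> 2 ^ J / 2 * texp x ^ n"
      using J texp_pos[OF x0] by (intro mult_right_mono) auto
    finally show ?thesis by (simp add: field_simps)
  qed
  have "texp x ^ n - texp (2 * x) ^ n / 2 ^ J \<le> (\<Sum>j\<in>{..J}. a j * x ^ j)"
  proof (rule sums_le)
    show "(\<lambda>j. a j * x ^ j - a j * (2 * x) ^ j / 2 ^ J) sums (texp x ^ n - texp (2 * x) ^ n / 2 ^ J)"
      unfolding a_def using x0 by (intro sums_diff sums_divide coeff_sums) auto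
    show "(\<lambda>j. if j \<in> {..J} then a j * x ^ j else 0) sums (\<Sum>j\<in>{..J}. a j * x ^ j)"
      by (rule sums_If_finite_set) simp
    show "a j * x ^ j - a j * (2 * x) ^ j / 2 ^ J \<le> (if j \<in> {..J} then a j * x ^ j else 0)" for j
    proof (cases "j \<le> J")
      case True
      then show ?thesis using a0[of j] x0 by simp
    next
      case False
      have "(2::real) ^ J \<le> 2 ^ j" using False by (intro power_increasing) auto
      then have "a j * x ^ j * 2 ^ J \<le> a j * x ^ j * 2 ^ j"
        using a0[of j] x0 by (intro mult_left_mono) auto
      then have "a j * x ^ j \<le> a j * (2 * x) ^ j / 2 ^ J"
        by (simp add: power_mult_distrib field_simps)
      then show ?thesis using False by simp
    qed
  qed
  also have "\<dots> \<le> (\<Sum>j\<in>{..J}. a r * x ^ r)" by (intro sum_mono mode)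
  also have "\<dots> = (real J + 1) * (a r * x ^ r)" by simp
  finally have "texp x ^ n \<le> 2 * ((real J + 1) * (a r * x ^ r))" using tail by linarith
  then have A: "texp x ^ n \<le> 2 * (real J + 1) * a r * x ^ r" by (simp only: mult.assoc)
  \<comment> \<open>The unknown point \<open>x\<close> is now traded for \<open>s\<close>: as
    \<open>n * Q s = r\<close>, Jensen's inequality yields exactly the factor
    \<open>(x / s) ^ r\<close>, and the powers of \<open>x\<close> cancel.\<close>
  have "(exp (Q s * ln (x / s)) * texp s) ^ n \<le> texp x ^ n"
    using texp_tilt_ge[OF s x0] texp_pos[OF s] by (intro power_mono) auto
  moreover have "exp (Q s * ln (x / s)) ^ n = (x / s) ^ r"
  proof -
    have "exp (Q s * ln (x / s)) ^ n = exp ((real n * Q s) * ln (x / s))"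
      by (simp add: mult.assoc flip: exp_of_nat_mult)
    also have "\<dots> = (x / s) ^ r" unfolding Qs using x0 s by (simp add: exp_of_nat_mult)
    finally show ?thesis .
  qed
  ultimately have "(x / s) ^ r * texp s ^ n \<le> 2 * (real J + 1) * a r * x ^ r"
    using A by (simp only: power_mult_distrib)
  then have "x ^ r * (texp s ^ n / s ^ r) \<le> x ^ r * (2 * (real J + 1) * a r)"
    by (simp add: power_divide mult_ac)
  then show ?thesis using x0 unfolding a_def by (simp only: mult_le_cancel_left_pos zero_less_power)
qed

section \<open>Estimates for the generating functions\<close>

lemma exp_ge_partial:
  assumes "0 \<le> (x::real)"
  shows "(\<Sum>j<l. x ^ j / fact j) \<le> exp x"
  using sum_le_suminf[OF sums_summable[OF exp_sums[of x]], of "{..<l}"] exp_sums[of x] assms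
  by (simp add: sums_iff)

text \<open>The quadratic polynomials bounding \<open>exp (- x)\<close> and \<open>exp x\<close>
  multiply to 1 + x^4 / 4.\<close>

lemma exp_minus_le:
  assumes "0 \<le> (x::real)"
  shows "exp (- x) \<le> 1 - x + x\<^sup>2 / 2"
proof -
  have "1 \<le> (1 - x + x\<^sup>2 / 2) * (1 + x + x\<^sup>2 / 2)"
    using assms by (simp add: algebra_simps power2_eq_square)
  also have "\<dots> \<le> (1 - x + x\<^sup>2 / 2) * exp x"
  proof (rule mult_left_mono)
    show "1 + x + x\<^sup>2 / 2 \<le> exp x" using exp_lower_Taylor_quadratic[OF assms] .
    have "0 \<le> (1 - x)\<^sup>2 + 1" by simp
    then show "0 \<le> 1 - x + x\<^sup>2 / 2" by (simp add: power2_eq_square algebra_simps)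
  qed
  finally show ?thesis by (simp add: exp_minus field_simps)
qed

text \<open>The linear terms of \<open>exp u\<close> and \<open>2 * exp (- u / 2)\<close> cancel,
  since a single non-zero slot cannot satisfy the congruence. The quadratic terms give (1 + 1/4) / 3
  = 5/12, and the slack up to 1/2 pays for the passage from \<open>exp s\<close> to
  \<open>texp s\<close>, provided \<open>6 * (s + 1) \<le> exp s\<close>.\<close>

lemma Gbound_near_zero:
  assumes s: "15 \<le> s" and u: "0 \<le> u" "u \<le> 1"
  shows "Gbound s u \<le> texp s * (1 + u\<^sup>2 / 2)"
proof -
  have "6 * (s + 1) \<le> 1 + s + s\<^sup>2 / 2"
  proof -
    have lin: "6 * (a + 1) \<le> 1 + a + b / 2" if "15 * a \<le> b" "15 \<le> a" for a b :: real
    proof -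
      have "1 + a + b / 2 - 6 * (a + 1) = (b - 15 * a) / 2 + 5 / 2 * (a - 2)" by (simp add: field_simps)
      moreover have "0 \<le> (b - 15 * a) / 2" "0 \<le> 5 / 2 * (a - 2)" using that by simp_all
      ultimately show ?thesis by linarith
    qed
    show ?thesis by (rule lin) (use s in \<open>simp_all add: power2_eq_square\<close>)
  qed
  also have "\<dots> \<le> exp s" using exp_lower_Taylor_quadratic[of s] s by simp
  finally have e: "6 * (s + 1) \<le> exp s" .
  have "exp u + 2 * exp (- (u / 2)) \<le> (1 + u + u\<^sup>2) + 2 * (1 - u / 2 + (u / 2)\<^sup>2 / 2)"
    using exp_bound[OF u] exp_minus_le[of "u / 2"] u by (intro add_mono mult_left_mono) auto
  also have "\<dots> = 3 * (1 + 5 / 12 * u\<^sup>2)" by (simp add: power2_eq_square)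
  finally have le: "exp s * (exp u + 2 * exp (- (u / 2))) \<le> exp s * (3 * (1 + 5 / 12 * u\<^sup>2))"
    by (rule mult_left_mono) simp
  have "Gbound s u \<le> exp s * (1 + 5 / 12 * u\<^sup>2) - 1 - s"
  proof -
    have "exp (s + u) + 2 * exp (s - u / 2) = exp s * (exp u + 2 * exp (- (u / 2)))"
      using exp_add[of s u] exp_add[of s "- (u / 2)"] by (simp only: diff_conv_add_uminus distrib_left mult.left_commute)
    moreover have "exp s * (3 * (1 + 5 / 12 * u\<^sup>2)) = 3 * (exp s * (1 + 5 / 12 * u\<^sup>2))" by simp
    ultimately have "exp (s + u) + 2 * exp (s - u / 2) \<le> 3 * (exp s * (1 + 5 / 12 * u\<^sup>2))"
      using le by (simp only:)
    then show ?thesis unfolding Gbound_def by simp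
  qed
  also have "\<dots> \<le> texp s * (1 + u\<^sup>2 / 2)"
    using mult_right_mono[OF e, of "u\<^sup>2"] by (simp add: texp_def algebra_simps)
  finally show ?thesis .
qed

text \<open>The weights add up to \<open>s\<close>, and \<open>1 + z\<close> is the average of the
  linear parts of the three exponentials, so each of these becomes a \<open>texp\<close>.\<close>

lemma Gbound_balanced: "Gbound (s * (1 - \<rho>)) (s * \<rho>) = (texp s + 2 * texp (s * (1 - 3 * \<rho> / 2))) / 3"
proof -
  have "s * (1 - \<rho>) + s * \<rho> = s" "s * (1 - \<rho>) - s * \<rho> / 2 = s * (1 - 3 * \<rho> / 2)"
    by (simp_all add: algebra_simps)
  then show ?thesis unfolding Gbound_def texp_def by (simp add: field_simps)
qed

text \<open>\<open>texp x * exp (- x)\<close> is the probability that a Poisson variable of mean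
  \<open>x\<close> is at least 2, which increases with \<open>x\<close>.\<close>

lemma texp_ratio_le_exp:
  assumes "0 \<le> x" "x \<le> y"
  shows "texp x \<le> texp y * exp (x - y)"
proof -
  have "1 + y \<le> (1 + x) * (1 + (y - x))"
    using mult_nonneg_nonneg[of x "y - x"] assms by (simp add: algebra_simps)
  also have "\<dots> \<le> (1 + x) * exp (y - x)"
    using assms by (intro mult_left_mono exp_ge_add_one_self) auto
  finally have "(1 + y) * exp (x - y) \<le> (1 + x) * exp (y - x) * exp (x - y)" by (rule mult_right_mono) simp
  also have "\<dots> = 1 + x" by (simp add: mult.assoc flip: exp_add)
  finally have "(1 + y) * exp (x - y) \<le> 1 + x" .
  moreover have "exp y * exp (x - y) = exp x" by (simp flip: exp_add)
  ultimately show ?thesis by (simp add: texp_def algebra_simps)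
qed

lemma texp_le_abs: "texp x \<le> x\<^sup>2 / 2 * exp \<bar>x\<bar>"
proof (cases "0 \<le> x")
  case True
  then show ?thesis using texp_le_sq_exp by simp
next
  case False
  then have "texp x \<le> x\<^sup>2 / 2 * 1" using exp_minus_le[of "- x"] by (simp add: texp_def)
  also have "\<dots> \<le> x\<^sup>2 / 2 * exp \<bar>x\<bar>" by (intro mult_left_mono) auto
  finally show ?thesis .
qed

text \<open>Since \<open>\<bar>s * x\<bar> \<le> s / 2\<close>, it suffices that
  \<open>2 * s\<^sup>2 * exp (s / 2) \<le> texp s\<close>. With \<open>h = s / 2\<close> this
  follows from \<open>1 + h + 8 * h\<^sup>2 \<le> exp h\<close>, for which seven Taylor terms are
  enough when \<open>h \<ge> 15 / 2\<close>. Negative \<open>x\<close> is allowed, as the bulk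
  estimate requires.\<close>

lemma texp_ratio_le_sq:
  assumes s: "15 \<le> s" and x: "\<bar>x\<bar> \<le> 1 / 2"
  shows "texp (s * x) \<le> texp s * (x\<^sup>2 / 4)"
proof -
  define h where "h = s / 2"
  have h: "15 / 2 \<le> h" using s by (simp add: h_def)
  have "(\<Sum>j<7. h ^ j / fact j) \<le> exp h" using h by (intro exp_ge_partial) auto
  then have taylor: "1 + h + h ^ 2 / 2 + h ^ 3 / 6 + h ^ 4 / 24 + h ^ 5 / 120 + h ^ 6 / 720 \<le> exp h"
    by (simp add: numeral_eq_Suc)
  have hpow: "h ^ 2 * (15 / 2) ^ i \<le> h ^ (2 + i)" for i
    using h by (simp only: power_add) (intro mult_left_mono power_mono, auto)
  from hpow[of 1] hpow[of 2] hpow[of 3] hpow[of 4]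
  have "h ^ 2 * (15 / 2) \<le> h ^ 3" "h ^ 2 * (225 / 4) \<le> h ^ 4" "h ^ 2 * (3375 / 8) \<le> h ^ 5" "h ^ 2 * (50625 / 16) \<le> h ^ 6"
    by (simp_all add: power_divide)
  with taylor have e: "1 + h + 8 * h\<^sup>2 \<le> exp h" using zero_le_power2[of h] by linarith
  have "1 * h \<le> h * h" using h by (intro mult_right_mono) auto
  then have "h \<le> h\<^sup>2" by (simp only: power2_eq_square mult_1)
  then have e2: "1 + 2 * h \<le> exp h" using e zero_le_power2[of h] by linarith
  have "8 * h\<^sup>2 * exp h + (1 + 2 * h) \<le> 8 * h\<^sup>2 * exp h + exp h" using e2 by simp
  also have "\<dots> \<le> exp h * exp h"
    using mult_right_mono[of "8 * h\<^sup>2 + 1" "exp h" "exp h"] e h by (simp add: algebra_simps)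
  also have "\<dots> = exp s" by (simp add: h_def flip: exp_add)
  finally have "2 * s\<^sup>2 * exp h \<le> texp s"
    by (simp add: texp_def h_def power2_eq_square)
  then have "2 * s\<^sup>2 * exp h * (x\<^sup>2 / 4) \<le> texp s * (x\<^sup>2 / 4)" by (rule mult_right_mono) simp
  moreover have "texp (s * x) \<le> (s * x)\<^sup>2 / 2 * exp h"
  proof -
    have "\<bar>s * x\<bar> \<le> h" using s x mult_left_mono[OF x, of s] by (simp add: h_def abs_mult)
    then have "(s * x)\<^sup>2 / 2 * exp \<bar>s * x\<bar> \<le> (s * x)\<^sup>2 / 2 * exp h" by (intro mult_left_mono) auto
    then show ?thesis using texp_le_abs[of "s * x"] by linarith
  qed
  moreover have "(s * x)\<^sup>2 / 2 * exp h = 2 * s\<^sup>2 * exp h * (x\<^sup>2 / 4)" by (simp add: power_mult_distrib)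
  ultimately show ?thesis by linarith
qed

text \<open>Both sides agree at 1, and the difference has derivative
  \<open>ln y - (y - 1) / 2\<close>, which is non-positive below 1 and non-negative between 1 and 2.
  At 0 the right side is 0.\<close>

lemma xlnx_ge:
  assumes "0 \<le> x" "x \<le> (2::real)"
  shows "x - 1 + (x - 1)\<^sup>2 / 4 \<le> x * ln x"
proof (cases "x = 0")
  case False
  define g where "g x = x * ln x - (x - 1) - (x - 1)\<^sup>2 / 4" for x :: real
  have D: "(g has_real_derivative (ln y - (y - 1) / 2)) (at y)" if "0 < y" for y
    unfolding g_def using that by (auto intro!: derivative_eq_intros simp: field_simps)
  have "g 1 \<le> g x"
  proof (cases "x \<le> 1")
    case True
    show ?thesis
    proof (rule DERIV_nonpos_imp_nonincreasing[of x 1 g, OF True])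
      fix y assume y: "x \<le> y" "y \<le> 1"
      then have "0 < y" using False assms by simp
      moreover have "ln y - (y - 1) / 2 \<le> 0" using ln_le_minus_one[OF \<open>0 < y\<close>] y by simp
      ultimately show "\<exists>d. (g has_real_derivative d) (at y) \<and> d \<le> 0" using D by blast
    qed
  next
    case x: False
    show ?thesis
    proof (rule DERIV_nonneg_imp_nondecreasing[of 1 x g])
      fix y assume y: "1 \<le> y" "y \<le> x"
      have "ln (1 / y) \<le> 1 / y - 1" using y by (intro ln_le_minus_one) simp
      then have "1 - 1 / y \<le> ln y" using y by (simp add: ln_div)
      moreover have "(y - 1) / 2 \<le> 1 - 1 / y"
      proof -
        have "(y - 1) / 2 \<le> (y - 1) / y" using y assms by (intro divide_left_mono) auto
        then show ?thesis using y by (simp add: diff_divide_distrib)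
      qed
      ultimately have "0 \<le> ln y - (y - 1) / 2" by simp
      then show "\<exists>d. (g has_real_derivative d) (at y) \<and> 0 \<le> d" using D[of y] y by auto
    qed (use x in simp)
  qed
  then show ?thesis by (simp add: g_def)
qed simp

lemma power_eq_exp_ln: "0 < x \<or> r = 0 \<Longrightarrow> x ^ r = exp (real r * ln (x::real))"
  by (cases "r = 0") (simp_all add: exp_of_nat_mult)

text \<open>The entropy of \<open>(1 - \<rho>, \<rho>/2, \<rho>/2)\<close> is at most \<open>ln 3 - \<xi>\<^sup>2/2\<close>, where \<open>\<xi> = 1 - 3\<rho>/2\<close>.\<close>

lemma entropy_bound:
  fixes m q :: nat
  assumes m: "0 < m" and q: "q \<le> m" "m \<le> 3 * q"
  defines "\<rho> \<equiv> real q / real m"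
  shows "exp (real m * (1 - 3 * \<rho> / 2)\<^sup>2 / 2) \<le> 3 ^ m * ((\<rho> / 2) ^ q * (1 - \<rho>) ^ (m - q))"
proof -
  define \<xi> where "\<xi> = 1 - 3 * \<rho> / 2"
  have \<rho>: "1 / 3 \<le> \<rho>" "\<rho> \<le> 1" using q m by (auto simp: \<rho>_def field_simps)
  have qm: "real q = real m * (2 * (1 - \<xi>) / 3)" "real (m - q) = real m * ((1 + 2 * \<xi>) / 3)"
    using m q by (simp_all add: \<xi>_def \<rho>_def of_nat_diff field_simps)
  have eqs: "\<rho> / 2 = (1 - \<xi>) / 3" "1 - \<rho> = (1 + 2 * \<xi>) / 3" by (simp_all add: \<xi>_def)
  have "\<xi>\<^sup>2 / 2 \<le> (2 / 3) * ((1 - \<xi>) * ln (1 - \<xi>)) + (1 / 3) * ((1 + 2 * \<xi>) * ln (1 + 2 * \<xi>))"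
  \<comment> \<open>As \<open>\<rho> \<ge> 1 / 3\<close>, both \<open>1 - \<xi>\<close> and
    \<open>1 + 2 * \<xi>\<close> lie between 0 and 2. With weights 2/3 and 1/3 the linear terms
    cancel and the quadratic ones add up to 1/6 + 1/3 = 1/2.\<close>
  proof -
    have "(1 - \<xi>) - 1 + ((1 - \<xi>) - 1)\<^sup>2 / 4 \<le> (1 - \<xi>) * ln (1 - \<xi>)"
      using \<rho> by (intro xlnx_ge) (auto simp: \<xi>_def)
    moreover have "(1 + 2 * \<xi>) - 1 + ((1 + 2 * \<xi>) - 1)\<^sup>2 / 4 \<le> (1 + 2 * \<xi>) * ln (1 + 2 * \<xi>)"
      using \<rho> by (intro xlnx_ge) (auto simp: \<xi>_def)
    moreover have "(1 - \<xi>) - 1 + ((1 - \<xi>) - 1)\<^sup>2 / 4 = \<xi>\<^sup>2 / 4 - \<xi>" "(1 + 2 * \<xi>) - 1 + ((1 + 2 * \<xi>) - 1)\<^sup>2 / 4 = \<xi>\<^sup>2 + 2 * \<xi>"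
      by (simp_all add: power2_eq_square)
    ultimately show ?thesis by linarith
  qed
  then have "real m * \<xi>\<^sup>2 / 2 \<le> real m * ((2 / 3) * ((1 - \<xi>) * ln (1 - \<xi>)) + (1 / 3) * ((1 + 2 * \<xi>) * ln (1 + 2 * \<xi>)))"
    using mult_left_mono[of "\<xi>\<^sup>2 / 2" _ "real m"] by simp
  also have "\<dots> = real q * ln (1 - \<xi>) + real (m - q) * ln (1 + 2 * \<xi>)"
    unfolding qm by (simp add: algebra_simps add_divide_distrib diff_divide_distrib)
  finally have "exp (real m * \<xi>\<^sup>2 / 2) \<le> exp (real q * ln (1 - \<xi>)) * exp (real (m - q) * ln (1 + 2 * \<xi>))"
    by (simp flip: exp_add)
  also have "\<dots> = (1 - \<xi>) ^ q * (1 + 2 * \<xi>) ^ (m - q)"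
  proof -
    have "0 < 1 - \<xi>" using \<rho> by (simp add: \<xi>_def)
    \<comment> \<open>For \<open>q = m\<close> the base is 0, but so is the exponent.\<close>
    moreover have "0 < 1 + 2 * \<xi> \<or> m - q = 0"
    proof (cases "m - q = 0")
      case False
      then have "0 < real m * ((1 + 2 * \<xi>) / 3)" using qm(2) by simp
      then show ?thesis using m by (simp add: zero_less_mult_iff)
    qed simp
    ultimately show ?thesis by (simp add: power_eq_exp_ln)
  qed
  also have "\<dots> = 3 ^ m * ((\<rho> / 2) ^ q * (1 - \<rho>) ^ (m - q))"
  proof -
    have "(3::real) ^ m = 3 ^ q * 3 ^ (m - q)" using q by (simp flip: power_add)
    then show ?thesis unfolding eqs by (simp add: power_divide)
  qed
  finally show ?thesis unfolding \<xi>_def .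
qed

text \<open>\<open>W\<close> stands for the number of vectors with support size \<open>q\<close>,
  known only through the inequality for all \<open>a\<close>. For \<open>\<rho> \<le> 1 / 3\<close>
  a fixed \<open>a\<close> and a numerical bound on the generating function suffice. For
  \<open>\<rho> \<ge> 1 / 3\<close> the entropy loses exp (- m \<xi>^2 / 2) against 3^m while the
  generating function gains at most exp (n \<xi>^2 / 2) over 3^(-n). With the same constant in both
  exponents, the product decays in \<open>n - m\<close>, which is at least
  \<open>(1 - \<gamma>0) * n\<close>.\<close>

lemma bulk_term_le:
  fixes m n q :: nat and W s \<gamma>0 :: real
  assumes m: "0 < q" "q \<le> m" "real m \<le> \<gamma>0 * real n" and \<gamma>0: "\<gamma>0 < 1" and s: "15 \<le> s"
    and W: "0 \<le> W" "\<And>a. 0 \<le> a \<Longrightarrow> a \<le> 1 \<Longrightarrow> W * ((a / 2) ^ q * (1 - a) ^ (m - q)) \<le> 1"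
  defines "\<rho> \<equiv> real q / real m"
  assumes big: "1 / 2 < s * \<rho>"
  shows "W * (Gbound (s * (1 - \<rho>)) (s * \<rho>) / texp s) ^ n \<le> (max (995 / 1000) (exp (- (1 - \<gamma>0) / 2))) ^ n"
proof -
  define \<xi> where "\<xi> = 1 - 3 * \<rho> / 2"
  define g where "g = Gbound (s * (1 - \<rho>)) (s * \<rho>) / texp s"
  have m0: "0 < m" using m by simp
  have "real m \<le> real n"
  proof -
    have "\<gamma>0 * real n \<le> 1 * real n" using \<gamma>0 by (intro mult_right_mono) auto
    then show ?thesis using m by simp
  qed
  then have mn: "m \<le> n" by simp
  have \<rho>: "0 < \<rho>" "\<rho> \<le> 1" using m by (auto simp: \<rho>_def)
  have tp: "0 < texp s" using s by (intro texp_pos) auto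
  have g_eq: "g = (1 + 2 * (texp (s * \<xi>) / texp s)) / 3"
    unfolding g_def Gbound_balanced \<xi>_def using tp by (simp add: field_simps)
  have g0: "0 \<le> g" unfolding g_def using s \<rho> tp by (intro divide_nonneg_pos Gbound_nonneg) auto
  have g_le: "g \<le> (1 + 2 * exp (- (3 / 2 * (s * \<rho>)))) / 3" if "\<rho> \<le> 1 / 3"
  proof -
    have "texp (s * \<xi>) \<le> texp s * exp (s * \<xi> - s)"
      using that s \<rho> by (intro texp_ratio_le_exp) (auto simp: \<xi>_def mult_le_cancel_left1)
    then have "texp (s * \<xi>) / texp s \<le> exp (s * \<xi> - s)" using tp by (simp add: field_simps)
    also have "s * \<xi> - s = - (3 / 2 * (s * \<rho>))" by (simp add: \<xi>_def algebra_simps)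
    finally show ?thesis unfolding g_eq by simp
  qed
  \<comment> \<open>The parameter \<open>a\<close> will be the right end of the range of
    \<open>\<rho>\<close>, and \<open>l\<close> its inverse. Then \<open>l * q \<le> m\<close> turns
    the power with exponent \<open>q\<close> into one with exponent \<open>m\<close>.\<close>
  have W_small: "W \<le> (c * (1 / (1 - a))) ^ n"
    if a: "0 < a" "a < 1" and c: "2 * (1 - a) / a \<le> c ^ l" "1 \<le> c" and l: "l * q \<le> m" for a c l
  proof -
    have "W * ((a / 2) ^ q * (1 - a) ^ (m - q)) \<le> 1" using W(2)[of a] a by simp
    then have "W \<le> (2 / a) ^ q * (1 / (1 - a)) ^ (m - q)"
      using a by (simp add: field_simps)
    also have "\<dots> = (2 * (1 - a) / a) ^ q * (1 / (1 - a)) ^ m"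
    proof -
      have "(1 / (1 - a)) ^ m = (1 / (1 - a)) ^ q * (1 / (1 - a)) ^ (m - q)"
        using m by (simp flip: power_add)
      moreover have "(2 * (1 - a) / a) ^ q * (1 / (1 - a)) ^ q = (2 / a) ^ q"
      proof -
        have "2 * (1 - a) / a * (1 / (1 - a)) = 2 / a" using a by (simp add: divide_eq_eq)
        then show ?thesis by (simp only: power_mult_distrib[symmetric])
      qed
      ultimately show ?thesis by (simp flip: mult.assoc)
    qed
    also have "(2 * (1 - a) / a) ^ q \<le> (c ^ l) ^ q" using a c by (intro power_mono) auto
    also have "(c ^ l) ^ q \<le> c ^ m" using c l by (simp flip: power_mult add: power_increasing)
    also have "c ^ m * (1 / (1 - a)) ^ m = (c * (1 / (1 - a))) ^ m" by (simp only: power_mult_distrib)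
    also have "\<dots> \<le> (c * (1 / (1 - a))) ^ n"
    proof (rule power_increasing[OF mn])
      have "1 * 1 \<le> c * (1 / (1 - a))" using a c by (intro mult_mono) (auto simp: field_simps)
      then show "1 \<le> c * (1 / (1 - a))" by simp
    qed
    finally show ?thesis using a by simp
  qed
  have combine: "W * g ^ n \<le> (995 / 1000) ^ n"
    if "W \<le> x ^ n" "g \<le> y" "x * y \<le> 995 / 1000" "0 \<le> x" for x y
  proof -
    have "W * g ^ n \<le> x ^ n * y ^ n" using that g0 by (intro mult_mono power_mono) auto
    also have "\<dots> \<le> (995 / 1000) ^ n" unfolding power_mult_distrib[symmetric]
      using that g0 by (intro power_mono mult_nonneg_nonneg) auto
    finally show ?thesis .
  qed
  consider "\<rho> \<le> 1 / 9" | "1 / 9 \<le> \<rho>" "\<rho> \<le> 1 / 3" | "1 / 3 \<le> \<rho>" by linarith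
  then have "W * g ^ n \<le> (995 / 1000) ^ n \<or> W * g ^ n \<le> exp (- (1 - \<gamma>0) / 2) ^ n"
  proof cases
    case 1
    \<comment> \<open>The exponent 3/4 is 3/2 times the threshold 1/2. Below, 1361/1000 is just
      above the ninth root of 16, the value of \<open>2 * (1 - a) / a\<close> at
      \<open>a = 1 / 9\<close>; this range determines the rate 995/1000.\<close>
    have "(\<Sum>j<5. (3/4) ^ j / fact j) \<le> exp (3 / 4 :: real)" by (intro exp_ge_partial) auto
    then have "2114 / 1000 \<le> exp (3 / 4 :: real)" by (simp add: numeral_eq_Suc)
    moreover have "exp (3 / 4) \<le> exp (3 / 2 * (s * \<rho>))" using big by (simp only: exp_le_cancel_iff)
    ultimately have "2114 / 1000 \<le> exp (3 / 2 * (s * \<rho>))" by linarith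
    then have "exp (- (3 / 2 * (s * \<rho>))) \<le> 1000 / 2114" by (simp add: exp_minus field_simps)
    then have g: "g \<le> 6487 / 10000" using g_le 1 by simp
    have "9 * q \<le> m" using 1 m0 by (simp add: \<rho>_def field_simps)
    then have "W \<le> (1361 / 1000 * (1 / (1 - 1 / 9))) ^ n" by (intro W_small[where l = 9]) (auto simp: power_divide)
    then have "W * g ^ n \<le> (995 / 1000) ^ n" using g by (rule combine) auto
    then show ?thesis ..
  next
    case 2
    \<comment> \<open>Here \<open>s * \<rho> \<ge> 15 / 9\<close>, whence the exponent 5/2; below,
      1588/1000 is just above the cube root of 4, the value at \<open>a = 1 / 3\<close>.\<close>
    have "(\<Sum>j<7. (5/2) ^ j / fact j) \<le> exp (5 / 2 :: real)" by (intro exp_ge_partial) auto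
    then have "12 \<le> exp (5 / 2 :: real)" by (simp add: numeral_eq_Suc)
    moreover have "exp (5 / 2) \<le> exp (3 / 2 * (s * \<rho>))" using s 2 mult_mono[of 15 s "1/9" \<rho>] by simp
    ultimately have "12 \<le> exp (3 / 2 * (s * \<rho>))" by linarith
    then have "exp (- (3 / 2 * (s * \<rho>))) \<le> 1 / 12" by (simp add: exp_minus field_simps)
    then have g: "g \<le> 7 / 18" using g_le 2 by simp
    have "3 * q \<le> m" using 2 m0 by (simp add: \<rho>_def field_simps)
    then have "W \<le> (1588 / 1000 * (1 / (1 - 1 / 3))) ^ n" by (intro W_small[where l = 3]) (auto simp: power_divide)
    then have "W * g ^ n \<le> (995 / 1000) ^ n" using g by (rule combine) auto
    then show ?thesis ..
  next
    case 3
    have \<xi>: "\<bar>\<xi>\<bar> \<le> 1 / 2" by (rule abs_leI) (use 3 \<rho> in \<open>simp_all add: \<xi>_def\<close>)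
    have "\<bar>\<xi>\<bar>\<^sup>2 \<le> (1 / 2)\<^sup>2" using \<xi> by (intro power_mono) auto
    then have \<xi>2: "\<xi>\<^sup>2 \<le> 1 / 4" by (simp add: power2_eq_square)
    have "texp (s * \<xi>) / texp s \<le> \<xi>\<^sup>2 / 4"
      using texp_ratio_le_sq[OF s \<xi>] tp by (simp add: field_simps)
    then have "g \<le> (1 + \<xi>\<^sup>2 / 2) / 3" unfolding g_eq by simp
    also have "\<dots> \<le> exp (\<xi>\<^sup>2 / 2) / 3" by (intro divide_right_mono exp_ge_add_one_self) simp
    finally have "g ^ n \<le> (exp (\<xi>\<^sup>2 / 2) / 3) ^ n" using g0 by (rule power_mono)
    also have "\<dots> = exp (real n * (\<xi>\<^sup>2 / 2) - real n * ln 3)"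
      unfolding exp_diff exp_of_nat_mult power_divide by simp
    finally have gn: "g ^ n \<le> exp (real n * (\<xi>\<^sup>2 / 2) - real n * ln 3)" .
    have "m \<le> 3 * q" using 3 m0 by (simp add: \<rho>_def field_simps)
    then have "exp (real m * \<xi>\<^sup>2 / 2) \<le> 3 ^ m * ((\<rho> / 2) ^ q * (1 - \<rho>) ^ (m - q))"
      using entropy_bound[of m q] m m0 by (simp add: \<rho>_def \<xi>_def)
    then have "W * exp (real m * \<xi>\<^sup>2 / 2) \<le> W * (3 ^ m * ((\<rho> / 2) ^ q * (1 - \<rho>) ^ (m - q)))"
      using W(1) by (rule mult_left_mono)
    also have "\<dots> = 3 ^ m * (W * ((\<rho> / 2) ^ q * (1 - \<rho>) ^ (m - q)))" by simp
    also have "\<dots> \<le> 3 ^ m * 1" using W(2)[of \<rho>] \<rho> by (intro mult_left_mono) auto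
    also have "\<dots> = exp (real m * ln 3)" by (simp add: exp_of_nat_mult)
    finally have "W \<le> exp (real m * ln 3 - real m * \<xi>\<^sup>2 / 2)"
      unfolding exp_diff by (simp only: pos_le_divide_eq exp_gt_zero)
    then have "W * g ^ n \<le> exp (real m * ln 3 - real m * \<xi>\<^sup>2 / 2) * exp (real n * (\<xi>\<^sup>2 / 2) - real n * ln 3)"
      using gn g0 by (intro mult_mono) auto
    also have "\<dots> = exp (- ((real n - real m) * (ln 3 - \<xi>\<^sup>2 / 2)))"
      unfolding exp_add[symmetric] by (rule arg_cong[where f = exp]) (simp add: field_simps)
    also have "\<dots> \<le> exp (- (((1 - \<gamma>0) * real n) * (1 / 2)))"
    proof -
      have "1 \<le> ln (3::real)" using exp_le by (simp add: ln_ge_iff)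
      then have "((1 - \<gamma>0) * real n) * (1 / 2) \<le> (real n - real m) * (ln 3 - \<xi>\<^sup>2 / 2)"
        using \<xi>2 m(3) \<gamma>0 mn by (intro mult_mono) (auto simp: algebra_simps)
      then show ?thesis by simp
    qed
    also have "\<dots> = exp (- (1 - \<gamma>0) / 2) ^ n" by (simp flip: exp_of_nat_mult add: algebra_simps)
    finally show ?thesis ..
  qed
  moreover have "(995 / 1000) ^ n \<le> (max (995 / 1000) (exp (- (1 - \<gamma>0) / 2))) ^ n"
    "exp (- (1 - \<gamma>0) / 2) ^ n \<le> (max (995 / 1000) (exp (- (1 - \<gamma>0) / 2))) ^ n"
    by (intro power_mono; simp)+
  ultimately show ?thesis unfolding g_def by linarith
qed

text \<open>Each factor is the q-th power of something, up to constants: the count gives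
  \<open>2 / \<rho>\<close>, the generating function at most \<open>exp (k / 2)\<close>, and the
  zero slots at most \<open>exp (- 29 / 30 * (k - 1))\<close>, because
  \<open>s * \<rho> \<le> 1 / 2\<close> and \<open>s \<ge> 15\<close> force
  \<open>\<rho> \<le> 1 / 30\<close>. Two of the \<open>k\<close> factors \<open>u\<close> turn
  \<open>2 / \<rho>\<close> into \<open>2 * s\<close>; six more are retained to yield the cube in
  the result.\<close>

lemma sparse_term_le:
  fixes k m n q :: nat and W s :: real
  assumes m: "0 < q" "q \<le> m" and s: "15 \<le> s" "s \<le> real k" and ns: "real n * s \<le> real k * real m"
    and W: "0 \<le> W" "\<And>a. 0 \<le> a \<Longrightarrow> a \<le> 1 \<Longrightarrow> W * ((a / 2) ^ q * (1 - a) ^ (m - q)) \<le> 1"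
  defines "\<rho> \<equiv> real q / real m"
  defines "u \<equiv> sqrt (s * \<rho>)"
  assumes small: "s * \<rho> \<le> 1 / 2"
  shows "W * (u ^ (k * q) * (1 - \<rho>) ^ (k * (m - q)) * (Gbound s u / texp s) ^ n)
     \<le> (9 / 10) ^ q * (real k * real q / real m) ^ 3"
proof -
  have m0: "0 < m" using m by simp
  have \<rho>0: "0 < \<rho>" using m by (simp add: \<rho>_def)
  have "15 * \<rho> \<le> s * \<rho>" using s \<rho>0 by (intro mult_right_mono) auto
  then have \<rho>1: "\<rho> \<le> 1 / 30" using small by simp
  have u2: "u\<^sup>2 = s * \<rho>" using s \<rho>0 by (simp add: u_def)
  have u0: "0 < u" using s \<rho>0 by (simp add: u_def)
  have u1: "u \<le> 1" using small by (simp add: u_def)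
  have k15: "15 \<le> k" using s by linarith
  have tp: "0 < texp s" using s by (intro texp_pos) auto
  have "Gbound s u / texp s \<le> 1 + u\<^sup>2 / 2"
    using Gbound_near_zero[OF s(1) _ u1] u0 tp by (simp add: divide_le_eq mult.commute)
  also have "\<dots> \<le> exp (u\<^sup>2 / 2)" using exp_ge_add_one_self[of "u\<^sup>2 / 2"] by (simp add: add.commute)
  finally have "(Gbound s u / texp s) ^ n \<le> exp (u\<^sup>2 / 2) ^ n"
    using s u0 tp by (intro power_mono divide_nonneg_pos Gbound_nonneg) auto
  also have "\<dots> = exp (real n * s * \<rho> / 2)" by (simp add: u2 mult_ac flip: exp_of_nat_mult)
  also have "\<dots> \<le> exp (real k * real m * \<rho> / 2)"
    using mult_right_mono[OF ns, of \<rho>] \<rho>0 by simp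
  also have "real k * real m * \<rho> / 2 = real q * (real k / 2)" using m0 by (simp add: \<rho>_def)
  finally have G: "(Gbound s u / texp s) ^ n \<le> exp (real q * (real k / 2))" .
  have W': "W * (1 - \<rho>) ^ (k * (m - q)) \<le> (2 / \<rho>) ^ q * exp (- (real q * (29 / 30 * (real k - 1))))"
  proof -
    have "W * ((\<rho> / 2) ^ q * (1 - \<rho>) ^ (m - q)) \<le> 1" using W(2)[of \<rho>] \<rho>0 \<rho>1 by simp
    then have "W * (1 - \<rho>) ^ (m - q) \<le> (2 / \<rho>) ^ q" using \<rho>0 by (simp add: field_simps)
    moreover have "((1 - \<rho>) ^ (m - q)) ^ (k - 1) \<le> exp (- (real q * (29 / 30 * (real k - 1))))"
    proof -
      have "(1 - \<rho>) ^ (m - q) \<le> exp (- \<rho>) ^ (m - q)"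
        using exp_ge_add_one_self[of "- \<rho>"] \<rho>1 by (intro power_mono) auto
      also have "\<dots> = exp (- (real q * (1 - \<rho>)))"
        using m m0 by (simp add: \<rho>_def of_nat_diff field_simps flip: exp_of_nat_mult)
      also have "\<dots> \<le> exp (- (real q * (29 / 30)))"
      proof -
        have "real q * (29 / 30) \<le> real q * (1 - \<rho>)" using \<rho>1 by (intro mult_left_mono) auto
        then show ?thesis by simp
      qed
      finally have "((1 - \<rho>) ^ (m - q)) ^ (k - 1) \<le> exp (- (real q * (29 / 30))) ^ (k - 1)"
        using \<rho>1 by (intro power_mono) auto
      also have "\<dots> = exp (- (real q * (29 / 30 * (real k - 1))))"
        using k15 by (simp add: of_nat_diff algebra_simps flip: exp_of_nat_mult)
      finally show ?thesis .
    qed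
    ultimately have "(W * (1 - \<rho>) ^ (m - q)) * ((1 - \<rho>) ^ (m - q)) ^ (k - 1)
       \<le> (2 / \<rho>) ^ q * exp (- (real q * (29 / 30 * (real k - 1))))"
      using \<rho>0 \<rho>1 by (intro mult_mono) auto
    moreover have "(1 - \<rho>) ^ (m - q) * ((1 - \<rho>) ^ (m - q)) ^ (k - 1) = (1 - \<rho>) ^ (k * (m - q))"
    proof -
      have "(1 - \<rho>) ^ (m - q) * ((1 - \<rho>) ^ (m - q)) ^ (k - 1) = ((1 - \<rho>) ^ (m - q)) ^ Suc (k - 1)"
        by (simp only: power_Suc)
      also have "Suc (k - 1) = k" using k15 by simp
      finally show ?thesis by (simp add: mult.commute flip: power_mult)
    qed
    ultimately show ?thesis by (simp add: mult.assoc)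
  qed
  have "W * (u ^ (k * q) * (1 - \<rho>) ^ (k * (m - q)) * (Gbound s u / texp s) ^ n)
     = (W * (1 - \<rho>) ^ (k * (m - q))) * (u ^ (k * q) * (Gbound s u / texp s) ^ n)" by (simp only: mult_ac)
  also have "\<dots> \<le> ((2 / \<rho>) ^ q * exp (- (real q * (29 / 30 * (real k - 1))))) * (u ^ (k * q) * exp (real q * (real k / 2)))"
  proof (rule mult_mono[OF W'])
    show "u ^ (k * q) * (Gbound s u / texp s) ^ n \<le> u ^ (k * q) * exp (real q * (real k / 2))"
      using G u0 by (intro mult_left_mono) auto
    show "0 \<le> u ^ (k * q) * (Gbound s u / texp s) ^ n"
      using u0 s tp by (intro mult_nonneg_nonneg zero_le_power divide_nonneg_pos Gbound_nonneg) auto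
  qed (use \<rho>0 in simp)
  also have "\<dots> = (2 / \<rho> * u ^ k * exp (real k / 2 - 29 / 30 * (real k - 1))) ^ q"
  proof -
    have "exp (- (real q * (29 / 30 * (real k - 1)))) * exp (real q * (real k / 2))
        = exp (real k / 2 - 29 / 30 * (real k - 1)) ^ q"
      by (simp add: algebra_simps flip: exp_of_nat_mult exp_add)
    then show ?thesis unfolding power_mult_distrib power_mult by (simp only: mult_ac)
  qed
  also have "\<dots> \<le> (9 / 10 * u ^ 6) ^ q"
  proof (rule power_mono)
    \<comment> \<open>The exponent is at most \<open>1 - y\<close>, as 29/30 - 1/2 = 7/15. The
      estimate is tight at \<open>k = 15\<close>, where \<open>y = 7\<close>: in terms of
      \<open>y\<close>, \<open>6 * k\<close> is 90/7 times \<open>y\<close>, just below 9/10 times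
      343/24.\<close>
    define y where "y = 7 / 15 * real k"
    have y7: "7 \<le> y" using k15 by (simp add: y_def)
    have "(\<Sum>j\<in>{4}. y ^ j / fact j) \<le> (\<Sum>j<5. y ^ j / fact j)" using y7 by (intro sum_mono2) auto
    also have "\<dots> \<le> exp y" using y7 by (intro exp_ge_partial) auto
    finally have "y ^ 4 / 24 \<le> exp y" by (simp add: fact_numeral)
    moreover have "7 ^ 3 * y \<le> y ^ 3 * y" using y7 by (intro mult_right_mono power_mono) auto
    ultimately have ey: "343 / 24 * y \<le> exp y" by (simp add: power3_eq_cube power4_eq_xxxx)
    have "2 / \<rho> * u ^ k = 2 * s * u ^ (k - 2)"
    proof -
      have "u ^ (2 + (k - 2)) = u\<^sup>2 * u ^ (k - 2)" by (rule power_add)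
      moreover have "2 + (k - 2) = k" using k15 by simp
      ultimately have "u ^ k = u\<^sup>2 * u ^ (k - 2)" by (simp only:)
      then show ?thesis using \<rho>0 by (simp add: u2)
    qed
    also have "\<dots> \<le> 2 * real k * u ^ 6"
      using s u0 u1 k15 by (intro mult_mono power_decreasing) auto
    finally have "2 / \<rho> * u ^ k * exp (real k / 2 - 29 / 30 * (real k - 1)) \<le> 2 * real k * u ^ 6 * (exp 1 * exp (- y))"
    proof (rule mult_mono)
      have "real k / 2 - 29 / 30 * (real k - 1) \<le> 1 + - y" by (simp add: y_def field_simps)
      then show "exp (real k / 2 - 29 / 30 * (real k - 1)) \<le> exp 1 * exp (- y)"
        by (simp only: exp_add[symmetric] exp_le_cancel_iff)
    qed (use u0 in simp_all)
    also have "\<dots> \<le> 2 * real k * u ^ 6 * (3 * exp (- y))"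
      using exp_le u0 by (intro mult_left_mono mult_right_mono) auto
    also have "\<dots> \<le> 9 / 10 * u ^ 6"
    proof -
      have "6 * real k \<le> 9 / 10 * exp y" using ey by (simp add: y_def)
      then have "6 * real k * exp (- y) \<le> 9 / 10" by (simp add: exp_minus field_simps)
      then have "6 * real k * exp (- y) * u ^ 6 \<le> 9 / 10 * u ^ 6" using u0 by (intro mult_right_mono) auto
      then show ?thesis by (simp add: mult_ac)
    qed
    finally show "2 / \<rho> * u ^ k * exp (real k / 2 - 29 / 30 * (real k - 1)) \<le> 9 / 10 * u ^ 6" .
    show "0 \<le> 2 / \<rho> * u ^ k * exp (real k / 2 - 29 / 30 * (real k - 1))" using \<rho>0 u0 by simp
  qed
  also have "\<dots> = (9 / 10) ^ q * (u ^ 6) ^ q" by (rule power_mult_distrib)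
  \<comment> \<open>One factor \<open>u ^ 6\<close> beats the polynomial losses, while
    \<open>(9 / 10) ^ q\<close> makes the bound uniform in \<open>q\<close>.\<close>
  also have "\<dots> \<le> (9 / 10) ^ q * (u ^ 6) ^ 1"
    using u0 u1 m by (intro mult_left_mono power_decreasing) (auto intro: power_le_one)
  also have "(u ^ 6) ^ 1 = (s * \<rho>) ^ 3"
    by (simp flip: u2 power_mult)
  also have "(s * \<rho>) ^ 3 \<le> (real k * real q / real m) ^ 3"
    using s \<rho>0 m by (intro power_mono) (auto simp: \<rho>_def intro!: divide_right_mono mult_right_mono)
  finally show ?thesis by simp
qed

section \<open>The second moment\<close>

text \<open>If the entries of \<open>c\<close> are drawn independently, 0 with probability
  \<open>1 - a\<close> and 1 or 2 with \<open>a / 2\<close> each, every vector counted here has the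
  same probability. Keeping \<open>a\<close> free replaces estimates of binomial
  coefficients.\<close>

lemma card_support_le:
  fixes m q :: nat and a :: real
  assumes a: "0 \<le> a" "a \<le> 1"
  shows "real (card {c \<in> {1..m} \<rightarrow>\<^sub>E {0..2::nat}. card {j\<in>{1..m}. c j \<noteq> 0} = q}) * ((a / 2) ^ q * (1 - a) ^ (m - q)) \<le> 1"
proof -
  define \<pi> where "\<pi> r = (if r = 0 then 1 - a else a / 2)" for r :: nat
  let ?C = "{1..m} \<rightarrow>\<^sub>E {0..2::nat}"
  let ?S = "{c \<in> ?C. card {j\<in>{1..m}. c j \<noteq> 0} = q}"
  have fin: "finite ?C" by (intro finite_PiE) auto
  have "(\<Prod>j\<in>{1..m}. \<pi> (c j)) = (a / 2) ^ q * (1 - a) ^ (m - q)" if "c \<in> ?S" for c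
  proof -
    let ?A = "{j\<in>{1..m}. c j \<noteq> 0}"
    have A: "card ?A = q" using that by simp
    have "(\<Prod>j\<in>{1..m}. \<pi> (c j)) = (\<Prod>j\<in>{1..m} - ?A. \<pi> (c j)) * (\<Prod>j\<in>?A. \<pi> (c j))"
      by (rule prod.subset_diff) auto
    also have "(\<Prod>j\<in>?A. \<pi> (c j)) = (\<Prod>j\<in>?A. a / 2)" by (intro prod.cong) (auto simp: \<pi>_def)
    also have "\<dots> = (a / 2) ^ q" using A by (simp only: prod_constant)
    also have "(\<Prod>j\<in>{1..m} - ?A. \<pi> (c j)) = (\<Prod>j\<in>{1..m} - ?A. 1 - a)" by (intro prod.cong) (auto simp: \<pi>_def)
    also have "\<dots> = (1 - a) ^ (m - q)"
    proof -
      have "card ({1..m} - ?A) = card {1..m} - card ?A" by (rule card_Diff_subset) auto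
      then show ?thesis using A by (simp only: prod_constant card_atLeastAtMost diff_Suc_1)
    qed
    finally show ?thesis by (simp only: mult.commute)
  qed
  then have "real (card ?S) * ((a / 2) ^ q * (1 - a) ^ (m - q)) = (\<Sum>c\<in>?S. \<Prod>j\<in>{1..m}. \<pi> (c j))"
    by simp
  also have "\<dots> \<le> (\<Sum>c\<in>?C. \<Prod>j\<in>{1..m}. \<pi> (c j))"
    using a fin by (intro sum_mono2) (auto intro!: prod_nonneg simp: \<pi>_def)
  also have "\<dots> = (\<Prod>j\<in>{1..m}. \<Sum>r\<in>{0..2}. \<pi> r)"
    by (intro prod_sum_PiE[symmetric]) auto
  also have "(\<Sum>r\<in>{0..2::nat}. \<pi> r) = 1" by (simp add: \<pi>_def numeral_2_eq_2)
  finally show ?thesis by simp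
qed

text \<open>Fourth roots reduce the claim to \<open>j * y ^ j\<close> tending to 0. The exponent 4
  arises in both regimes: q m n is at most n^3 and one more n yields the decay 1/n, or the factor q
  meets the cube from \<open>sparse_term_le\<close>.\<close>

lemma poly_times_geometric_bounded:
  fixes x :: real
  assumes "0 \<le> x" "x < 1"
  obtains B where "0 \<le> B" "\<And>j::nat. real j ^ 4 * x ^ j \<le> B"
proof -
  define y where "y = root 4 x"
  have y: "0 \<le> y" "y < 1" "y ^ 4 = x" using assms by (auto simp: y_def)
  have "(\<lambda>j. real j * y ^ j) \<longlonglongrightarrow> 0"
    using powser_times_n_limit_0[of y] y by simp
  then have "Bseq (\<lambda>j. real j * y ^ j)" by (rule convergent_imp_Bseq[OF convergentI])
  then obtain b where b: "\<And>j. norm (real j * y ^ j) \<le> b" by (auto simp: Bseq_def)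
  show ?thesis
  proof (rule that[of "b ^ 4"])
    fix j
    have "real j ^ 4 * x ^ j = (real j * y ^ j) ^ 4"
      by (simp add: y(3)[symmetric] power_mult_distrib mult.commute flip: power_mult)
    also have "\<dots> \<le> b ^ 4" using b[of j] y by (intro power_mono) auto
    finally show "real j ^ 4 * x ^ j \<le> b ^ 4" .
  qed simp
qed

text \<open>The point \<open>z\<close>, \<open>u\<close> stays free because the two regimes choose
  it differently. The three linear factors are the losses from splitting the non-zero colours, from
  comparing the factorials of zero and non-zero slots with \<open>fact (k * m)\<close>, and from the
  lower bound on \<open>N0\<close>.\<close>

lemma card_dual_le_N0:
  fixes k m n q J :: nat and c :: "nat \<Rightarrow> nat" and s z u :: real
  defines "A \<equiv> {1..m} \<times> {..<k}" and "\<rho> \<equiv> real q / real m"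
  assumes c: "c \<in> {1..m} \<rightarrow>\<^sub>E {0..2}" and q: "q = card {j\<in>{1..m}. c j \<noteq> 0}" "0 < q" "q \<le> m"
    and z: "0 \<le> z" "0 \<le> u" "0 < z ^ (k * (m - q)) * u ^ (k * q)" and k: "0 < k"
    and s: "0 < s" and N0: "fact (k * m) * texp s ^ n \<le> 2 * (real J + 1) * s ^ (k * m) * N0 k m n"
  shows "real (card {\<sigma> \<in> A \<rightarrow>\<^sub>E {1..n}. \<forall>x\<in>{1..n}. 2 \<le> card {a\<in>A. \<sigma> a = x} \<and> 3 dvd (\<Sum>a\<in>{a\<in>A. \<sigma> a = x}. c (fst a))})
     \<le> N0 k m n * ((real (k * q) + 1) * (real (k * m) + 1) * (2 * (real J + 1)) *
         (\<rho> ^ (k * q) * (1 - \<rho>) ^ (k * (m - q)) * s ^ (k * m) / (z ^ (k * (m - q)) * u ^ (k * q)) * (Gbound z u / texp s) ^ n))"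
    (is "?S \<le> _")
proof -
  define D where "D = z ^ (k * (m - q)) * u ^ (k * q)"
  define E where "E = \<rho> ^ (k * q) * (1 - \<rho>) ^ (k * (m - q))"
  have m0: "0 < m" using q by simp
  have \<rho>: "0 < \<rho>" "\<rho> \<le> 1" using q(2,3) by (auto simp: \<rho>_def)
  have E0: "0 \<le> E" using \<rho> by (simp add: E_def)
  have tp: "0 < texp s" using s by (rule texp_pos)
  have G0: "0 \<le> Gbound z u" using z by (intro Gbound_nonneg)
  have S: "?S * D \<le> (real (k * q) + 1) * fact (k * (m - q)) * fact (k * q) * Gbound z u ^ n"
    unfolding D_def A_def using card_dual_le[OF c q(1,2) z(1,2) k] .
  have ff: "fact (k * (m - q)) * fact (k * q) \<le> (real (k * m) + 1) * fact (k * m) * E"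
  proof -
    let ?a = "k * (m - q)" and ?b = "k * q"
    have ab: "?a + ?b = k * m" using q(3) by (simp flip: distrib_left)
    have "real (fact ?a * fact ?b * (?a + ?b) ^ (?a + ?b)) \<le> real ((?a + ?b + 1) * fact (?a + ?b) * (?a ^ ?a * ?b ^ ?b))"
      using fact_mult_fact_le[of ?a ?b] by (simp only: of_nat_le_iff)
    then have "(fact ?a * fact ?b) * real (k * m) ^ (k * m) \<le> (real (k * m) + 1) * fact (k * m) * (real ?a ^ ?a * real ?b ^ ?b)"
      unfolding ab by (simp only: of_nat_mult of_nat_power of_nat_fact of_nat_add of_nat_1 mult_ac)
    also have "real ?a ^ ?a * real ?b ^ ?b = E * real (k * m) ^ (k * m)"
    proof -
      have "real ?a = real (k * m) * (1 - \<rho>)" "real ?b = real (k * m) * \<rho>"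
        using q(3) m0 by (simp_all add: \<rho>_def of_nat_diff field_simps)
      then have "real ?a ^ ?a * real ?b ^ ?b = (real (k * m) * (1 - \<rho>)) ^ ?a * (real (k * m) * \<rho>) ^ ?b" by (simp only:)
      also have "\<dots> = E * (real (k * m) ^ ?a * real (k * m) ^ ?b)"
        unfolding power_mult_distrib E_def by (simp only: mult_ac)
      finally show ?thesis by (simp only: ab power_add[symmetric])
    qed
    finally have "(fact ?a * fact ?b) * real (k * m) ^ (k * m) \<le> ((real (k * m) + 1) * fact (k * m) * E) * real (k * m) ^ (k * m)"
      by (simp only: mult.assoc)
    moreover have "0 < real (k * m) ^ (k * m)" using k m0 by simp
    ultimately show ?thesis by (simp only: mult_le_cancel_right_pos)
  qed
  have "?S * D * texp s ^ n \<le> (real (k * q) + 1) * (fact (k * (m - q)) * fact (k * q)) * Gbound z u ^ n * texp s ^ n"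
    using S tp by (intro mult_right_mono) (auto simp: mult.assoc)
  also have "\<dots> \<le> (real (k * q) + 1) * ((real (k * m) + 1) * fact (k * m) * E) * Gbound z u ^ n * texp s ^ n"
    using ff tp G0 by (intro mult_right_mono mult_left_mono) auto
  also have "\<dots> = (real (k * q) + 1) * (real (k * m) + 1) * E * Gbound z u ^ n * (fact (k * m) * texp s ^ n)"
    by (simp only: mult_ac)
  also have "\<dots> \<le> (real (k * q) + 1) * (real (k * m) + 1) * E * Gbound z u ^ n * (2 * (real J + 1) * s ^ (k * m) * N0 k m n)"
    using N0 E0 G0 by (intro mult_left_mono) auto
  finally have "?S * (D * texp s ^ n) \<le> (real (k * q) + 1) * (real (k * m) + 1) * E * Gbound z u ^ n * (2 * (real J + 1) * s ^ (k * m) * N0 k m n)"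
    by (simp only: mult.assoc)
  moreover have "0 < D * texp s ^ n" using z tp by (simp add: D_def)
  ultimately have "?S \<le> (real (k * q) + 1) * (real (k * m) + 1) * E * Gbound z u ^ n * (2 * (real J + 1) * s ^ (k * m) * N0 k m n) / (D * texp s ^ n)"
    by (simp only: pos_le_divide_eq)
  also have "\<dots> = N0 k m n * ((real (k * q) + 1) * (real (k * m) + 1) * (2 * (real J + 1)) * (E * s ^ (k * m) / D * (Gbound z u / texp s) ^ n))"
    by (simp add: power_divide mult_ac)
  finally show ?thesis unfolding D_def E_def .
qed

theorem theorem4:
  fixes k :: nat and \<gamma>0 :: real
  assumes "\<gamma>0 < 1"
  shows "\<exists>C::real. \<forall>(n::nat) (m::nat) (\<gamma>::real) (s::real).
    n \<ge> 1 \<longrightarrow> real m = \<gamma> * real n \<longrightarrow> \<gamma> \<le> \<gamma>0 \<longrightarrow> s \<ge> 15 \<longrightarrow> Q s = real k * \<gamma> \<longrightarrow>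
    (\<Sum>w\<in>tuples_sum {0..2} n. \<Sum>l\<in>tuples_sum {0..2} (k * m). N k m n w l / N0 k m n)
      \<le> C * 3 powr ((1 - \<gamma>) * real n)"
proof -
  \<comment> \<open>Since \<open>k * m / n \<le> k\<close>, the exponent \<open>J = r * n\<close>
    satisfies the tail condition of \<open>coeff_lower_bound\<close>; 8 = 2 * 4 absorbs its leading
    factor 2 because \<open>n \<ge> 1\<close>.\<close>
  obtain r where r: "8 * exp (2 * real k) \<le> (2::real) ^ r"
    using real_arch_pow[of 2 "8 * exp (2 * real k)"] by (auto intro: less_imp_le)
  define \<delta> where "\<delta> = max (995 / 1000) (exp (- (1 - \<gamma>0) / 2))"
  have \<delta>: "0 \<le> \<delta>" "\<delta> < 1" using assms by (auto simp: \<delta>_def)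
  obtain B1 where B1: "0 \<le> B1" "\<And>j::nat. real j ^ 4 * \<delta> ^ j \<le> B1"
    using poly_times_geometric_bounded[OF \<delta>] by blast
  obtain B2 where B2: "0 \<le> B2" "\<And>j::nat. real j ^ 4 * (9 / 10) ^ j \<le> B2"
    using poly_times_geometric_bounded[of "9 / 10"] by auto
  \<comment> \<open>\<open>C0 * (q * m * n)\<close> dominates the three linear losses together; the
    two summands of \<open>C\<close> serve the dense and the sparse regime.\<close>
  define C0 where "C0 = 2 * (real k + 1)\<^sup>2 * (real r + 1)"
  define C where "C = C0 * B1 + C0 * real k ^ 4 * B2"
  have C0: "0 \<le> C0" by (simp add: C0_def)
  have "(\<Sum>w\<in>tuples_sum {0..2} n. \<Sum>l\<in>tuples_sum {0..2} (k * m). N k m n w l / N0 k m n)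
      \<le> (1 + C) * 3 powr ((1 - \<gamma>) * real n)"
    if n: "1 \<le> n" and \<gamma>: "real m = \<gamma> * real n" "\<gamma> \<le> \<gamma>0" and s: "15 \<le> s" "Q s = real k * \<gamma>"
    for n m :: nat and \<gamma> s :: real
  proof -
    have tp: "0 < texp s" using s by (intro texp_pos) simp
    \<comment> \<open>Hence \<open>15 \<le> s \<le> k\<close>, and \<open>n * Q s = k * m\<close>
      gives \<open>n \<le> k * m\<close>.\<close>
    have "s \<le> Q s"
    proof -
      have "s * texp s \<le> s * (exp s - 1)" using s by (intro mult_left_mono) (auto simp: texp_def)
      then show ?thesis using tp by (simp add: Q_def texp_def field_simps)
    qed
    then have sk: "s \<le> real k * \<gamma>" using s by simp
    have \<gamma>1: "\<gamma> < 1" using \<gamma> assms by simp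
    have k0: "0 < k" using sk s by (cases "k = 0") auto
    have \<gamma>0': "0 < \<gamma>" using sk s k0 by (smt (verit) mult_nonneg_nonpos of_nat_0_le_iff)
    have kg: "real k * \<gamma> \<le> real k * 1" using \<gamma>1 by (intro mult_left_mono) auto
    have sk': "s \<le> real k" using sk kg by simp
    have m0: "0 < m" using \<gamma> \<gamma>0' n by (cases "m = 0") auto
    have "\<gamma> * real n \<le> 1 * real n" using \<gamma>1 by (intro mult_right_mono) auto
    then have mn: "m \<le> n" using \<gamma> by simp
    have m\<gamma>: "real m \<le> \<gamma>0 * real n" using \<gamma> by (simp add: mult_right_mono)
    have km: "real (k * m) = real n * Q s" using \<gamma> s by simp
    have ns: "real n * s \<le> real k * real m" using km \<open>s \<le> Q s\<close> by (simp add: mult_left_mono)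
    have nkm: "real n \<le> real k * real m"
    proof -
      have "real n * 1 \<le> real n * s" using s by (intro mult_left_mono) auto
      then show ?thesis using ns by simp
    qed
    define J where "J = r * n"
    have coeff: "texp s ^ n / s ^ (k * m) \<le> 2 * (real J + 1) * fps_nth (trunc_exp ^ n) (k * m)"
    proof (rule coeff_lower_bound)
      have "real (2 * n) < real n * 15" using n by simp
      also have "\<dots> \<le> real n * s" using s by (intro mult_left_mono) auto
      also have "\<dots> \<le> real (k * m)" using ns by simp
      finally have "real (2 * n) < real (k * m)" .
      then show "2 * n < k * m" by (simp only: of_nat_less_iff)
      have "real (k * m) / real n = real k * \<gamma>" using \<gamma> n by simp
      then have "exp (2 * (real (k * m) / real n)) \<le> exp (2 * real k)" using kg by simp
      then have "(4 * exp (2 * (real (k * m) / real n))) ^ n \<le> (4 * exp (2 * real k)) ^ n"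
        by (intro power_mono mult_left_mono) auto
      moreover have "(2::real) ^ 1 \<le> 2 ^ n" using n by (rule power_increasing) simp
      ultimately have "2 ^ 1 * (4 * exp (2 * (real (k * m) / real n))) ^ n \<le> 2 ^ n * (4 * exp (2 * real k)) ^ n"
        by (intro mult_mono) simp_all
      also have "\<dots> = (2 * (4 * exp (2 * real k))) ^ n" by (simp only: power_mult_distrib)
      also have "\<dots> \<le> (2 ^ r) ^ n" using r by (intro power_mono) auto
      also have "\<dots> = 2 ^ J" by (simp only: J_def power_mult)
      finally show "2 * (4 * exp (2 * (real (k * m) / real n))) ^ n \<le> 2 ^ J" by (simp only: power_one_right)
    qed (use n s km in auto)
    define Z where "Z = N0 k m n"
    have Z_eq: "Z = fact (k * m) * fps_nth (trunc_exp ^ n) (k * m)" by (simp add: Z_def N0_def M_eq_coeff)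
    have N0_ge: "fact (k * m) * texp s ^ n \<le> 2 * (real J + 1) * s ^ (k * m) * Z"
    proof -
      have "texp s ^ n \<le> 2 * (real J + 1) * fps_nth (trunc_exp ^ n) (k * m) * s ^ (k * m)"
        using coeff s by (simp add: divide_le_eq)
      then have "fact (k * m) * texp s ^ n \<le> fact (k * m) * (2 * (real J + 1) * fps_nth (trunc_exp ^ n) (k * m) * s ^ (k * m))"
        by (rule mult_left_mono) simp
      then show ?thesis unfolding Z_eq by (simp only: mult_ac)
    qed
    have Z0: "0 < Z"
    proof -
      have "0 < fact (k * m) * texp s ^ n" using tp by simp
      then have "0 < (2 * (real J + 1) * s ^ (k * m)) * Z" using N0_ge by linarith
      moreover have "0 < 2 * (real J + 1) * s ^ (k * m)" using s by simp
      ultimately show ?thesis by (simp only: zero_less_mult_pos)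
    qed
    define A where "A = {1..m} \<times> {..<k}"
    define S where "S c = real (card {\<sigma> \<in> A \<rightarrow>\<^sub>E {1..n}. \<forall>x\<in>{1..n}. 2 \<le> card {a\<in>A. \<sigma> a = x} \<and> 3 dvd (\<Sum>a\<in>{a\<in>A. \<sigma> a = x}. c (fst a))})"
      for c :: "nat \<Rightarrow> nat"
    let ?c = "{1..m} \<rightarrow>\<^sub>E {0..2::nat}"
    define supp where "supp c = card {j\<in>{1..m}. c j \<noteq> (0::nat)}" for c :: "nat \<Rightarrow> nat"
    have finc: "finite ?c" by (intro finite_PiE) auto
    have supp_le: "supp c \<le> m" for c
    proof -
      have "card {j\<in>{1..m}. c j \<noteq> 0} \<le> card {1..m}" by (rule card_mono) auto
      then show ?thesis by (simp only: supp_def card_atLeastAtMost diff_Suc_1)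
    qed
    have finA: "finite A" and cardA: "card A = k * m" by (auto simp: A_def)
    \<comment> \<open>The zero vector imposes no congruence, so it contributes at most the number of
      all formulas, without any loss.\<close>
    have zero: "(\<Sum>c\<in>{c\<in>?c. supp c = 0}. S c) \<le> Z"
    proof -
      have "{c\<in>?c. supp c = 0} \<subseteq> {\<lambda>j\<in>{1..m}. 0}"
        by (auto simp: supp_def PiE_iff extensional_def fun_eq_iff)
      then have "card {c\<in>?c. supp c = 0} \<le> 1"
        using card_mono[of "{\<lambda>j\<in>{1..m}. 0::nat}" "{c\<in>?c. supp c = 0}"] by simp
      moreover have "S c \<le> Z" for c
      proof -
        have "Z = real (card {\<sigma> \<in> A \<rightarrow>\<^sub>E {1..n}. \<forall>x\<in>{1..n}. 2 \<le> card {a\<in>A. \<sigma> a = x}})"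
          using M_eq_card[OF finA, of "{1..n}"] cardA by (simp add: Z_def N0_def)
        moreover have "S c \<le> real (card {\<sigma> \<in> A \<rightarrow>\<^sub>E {1..n}. \<forall>x\<in>{1..n}. 2 \<le> card {a\<in>A. \<sigma> a = x}})"
          unfolding S_def of_nat_le_iff
        proof (rule card_mono)
          show "finite {\<sigma> \<in> A \<rightarrow>\<^sub>E {1..n}. \<forall>x\<in>{1..n}. 2 \<le> card {a\<in>A. \<sigma> a = x}}"
            using finA by (intro finite_subset[OF _ finite_PiE[of A "\<lambda>_. {1..n}"]]) auto
        qed auto
        ultimately show ?thesis by simp
      qed
      then have "(\<Sum>c\<in>{c\<in>?c. supp c = 0}. S c) \<le> real (card {c\<in>?c. supp c = 0}) * Z"
        by (rule sum_bounded_above)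
      moreover have "real (card {c\<in>?c. supp c = 0}) * Z \<le> 1 * Z"
        using \<open>card {c\<in>?c. supp c = 0} \<le> 1\<close> Z0 by (intro mult_right_mono) auto
      ultimately show ?thesis by linarith
    qed
    \<comment> \<open>The factor \<open>1 / m\<close> compensates for the \<open>m\<close> possible
      support sizes.\<close>
    have pos: "(\<Sum>c\<in>{c\<in>?c. supp c = q}. S c) \<le> Z * (C / real m)" if q: "1 \<le> q" "q \<le> m" for q
    proof -
      define \<rho> where "\<rho> = real q / real m"
      define W where "W = real (card {c\<in>?c. supp c = q})"
      have W0: "0 \<le> W" by (simp add: W_def)
      have W: "W * ((a / 2) ^ q * (1 - a) ^ (m - q)) \<le> 1" if "0 \<le> a" "a \<le> 1" for a
        using card_support_le[OF that, of m q] by (simp only: W_def supp_def)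
      have \<rho>: "0 < \<rho>" "\<rho> \<le> 1" using q by (auto simp: \<rho>_def)
      define P where "P = (real (k * q) + 1) * (real (k * m) + 1) * (2 * (real J + 1))"
      have P: "0 \<le> P" "P \<le> C0 * (real q * real m * real n)"
      proof -
        have "P \<le> ((real k + 1) * real q) * ((real k + 1) * real m) * (2 * ((real r + 1) * real n))"
          unfolding P_def J_def using q n m0 by (intro mult_mono) (auto simp: algebra_simps)
        then show "P \<le> C0 * (real q * real m * real n)" unfolding C0_def power2_eq_square by (simp only: mult_ac)
      qed (simp add: P_def)
      have PWX: "P * y \<le> (C0 * (real q * real m * real n)) * y'" if "y \<le> y'" "0 \<le> y'" for y y'
        by (rule order_trans[OF mult_left_mono[OF that(1) P(1)] mult_right_mono[OF P(2) that(2)]])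
      have S_le: "(\<Sum>c\<in>{c\<in>?c. supp c = q}. S c) \<le> Z * (P * (W * X))"
        if z: "0 \<le> z" "0 \<le> u" "0 < z ^ (k * (m - q)) * u ^ (k * q)"
          and X: "X = \<rho> ^ (k * q) * (1 - \<rho>) ^ (k * (m - q)) * s ^ (k * m) / (z ^ (k * (m - q)) * u ^ (k * q)) * (Gbound z u / texp s) ^ n"
        for z u X
      proof -
        have "S c \<le> Z * (P * X)" if "c \<in> {c\<in>?c. supp c = q}" for c
        proof -
          have c: "c \<in> ?c" "q = card {j\<in>{1..m}. c j \<noteq> 0}" using that by (auto simp: supp_def)
          have "0 < q" "0 < s" using q s by auto
          from card_dual_le_N0[OF c this(1) q(2) z k0 this(2) N0_ge[unfolded Z_def]]
          show ?thesis unfolding S_def A_def Z_def P_def X \<rho>_def .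
        qed
        then have "(\<Sum>c\<in>{c\<in>?c. supp c = q}. S c) \<le> W * (Z * (P * X))"
          unfolding W_def by (rule sum_bounded_above)
        then show ?thesis by (simp only: mult_ac)
      qed
      have fin: "?thesis" if le: "(\<Sum>c\<in>{c\<in>?c. supp c = q}. S c) \<le> Z * (P * (W * X))"
        and X: "P * (W * X) \<le> C / real m" for X
      proof -
        have "Z * (P * (W * X)) \<le> Z * (C / real m)" using X Z0 by (intro mult_left_mono) auto
        then show ?thesis using le by linarith
      qed
      have skm: "s ^ (k * m) = s ^ (k * q) * s ^ (k * (m - q))"
        using q by (simp flip: power_add distrib_left)
      show ?thesis
      proof (cases "s * \<rho> \<le> 1 / 2")
        case True
        \<comment> \<open>Minimising u^(- k q) exp (n u^2 / 2) would give u^2 = k q / n = \<rho>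
          Q(s). The nearby value \<open>s * \<rho>\<close> leaves just \<open>u ^ (k * q)\<close> of
          the non-zero slots' prefactor.\<close>
        define u where "u = sqrt (s * \<rho>)"
        have u: "0 < u" "u * u = s * \<rho>" using s \<rho> by (auto simp: u_def)
        define X where "X = u ^ (k * q) * (1 - \<rho>) ^ (k * (m - q)) * (Gbound s u / texp s) ^ n"
        show ?thesis
        proof (rule fin[OF S_le[of s u]])
          have "\<rho> ^ (k * q) * s ^ (k * q) = u ^ (k * q) * u ^ (k * q)"
            unfolding power_mult_distrib[symmetric] u(2) by (simp only: mult.commute)
          moreover have "\<rho> ^ (k * q) * (1 - \<rho>) ^ (k * (m - q)) * s ^ (k * m)
             = (\<rho> ^ (k * q) * s ^ (k * q)) * ((1 - \<rho>) ^ (k * (m - q)) * s ^ (k * (m - q)))"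
            unfolding skm by (simp only: mult_ac)
          ultimately have "\<rho> ^ (k * q) * (1 - \<rho>) ^ (k * (m - q)) * s ^ (k * m)
             = (u ^ (k * q) * (1 - \<rho>) ^ (k * (m - q))) * (s ^ (k * (m - q)) * u ^ (k * q))"
            by (simp only: mult_ac)
          moreover have "s ^ (k * (m - q)) * u ^ (k * q) \<noteq> 0" using u s by simp
          ultimately show "X = \<rho> ^ (k * q) * (1 - \<rho>) ^ (k * (m - q)) * s ^ (k * m) / (s ^ (k * (m - q)) * u ^ (k * q)) * (Gbound s u / texp s) ^ n"
            unfolding X_def by (simp only: nonzero_mult_div_cancel_right simp_thms)
          have "W * X \<le> (9 / 10) ^ q * (real k * real q / real m) ^ 3"
            unfolding X_def u_def \<rho>_def
          proof (rule sparse_term_le[OF _ q(2) s(1) sk' ns W0 W])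
            show "s * (real q / real m) \<le> 1 / 2" using True by (simp only: \<rho>_def)
          qed (use q in auto)
          then have "P * (W * X) \<le> (C0 * (real q * real m * real n)) * ((9 / 10) ^ q * (real k * real q / real m) ^ 3)"
            by (rule PWX) simp
          also have "\<dots> = C0 * real k ^ 3 * (real n / (real m)\<^sup>2) * (real q ^ 4 * (9 / 10) ^ q)"
            using m0 by (simp add: power_divide power_mult_distrib field_simps power2_eq_square power3_eq_cube power4_eq_xxxx)
          also have "\<dots> \<le> C0 * real k ^ 3 * (real k / real m) * B2"
          proof (intro mult_mono B2 mult_left_mono)
            have "real n / (real m)\<^sup>2 \<le> (real k * real m) / (real m)\<^sup>2" using nkm by (intro divide_right_mono) auto
            then show "real n / (real m)\<^sup>2 \<le> real k / real m" using m0 by (simp add: power2_eq_square)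
          qed (use C0 in auto)
          also have "\<dots> \<le> C / real m"
          proof -
            have "C0 * real k ^ 3 * (real k / real m) * B2 = C0 * real k ^ 4 * B2 / real m"
              by (simp add: power3_eq_cube power4_eq_xxxx)
            also have "\<dots> \<le> C / real m" unfolding C_def using C0 B1 by (intro divide_right_mono) auto
            finally show ?thesis .
          qed
          finally show "P * (W * X) \<le> C / real m" .
        qed (use s u in auto)
      next
        case False
        \<comment> \<open>With weights proportional to the slot numbers the whole prefactor of the
          n-th power is 1.\<close>
        define X where "X = (Gbound (s * (1 - \<rho>)) (s * \<rho>) / texp s) ^ n"
        have D: "0 < (s * (1 - \<rho>)) ^ (k * (m - q)) * (s * \<rho>) ^ (k * q)"
        proof -
          have "0 < (s * (1 - \<rho>)) ^ (k * (m - q))"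
          proof (cases "q = m")
            case False
            then have "\<rho> < 1" using q by (simp add: \<rho>_def)
            then show ?thesis using s by simp
          qed simp
          then show ?thesis using s \<rho> by simp
        qed
        show ?thesis
        proof (rule fin[OF S_le[OF _ _ D]])
          from skm have "\<rho> ^ (k * q) * (1 - \<rho>) ^ (k * (m - q)) * s ^ (k * m) = (s * (1 - \<rho>)) ^ (k * (m - q)) * (s * \<rho>) ^ (k * q)"
            by (simp only: power_mult_distrib mult_ac)
          then show "X = \<rho> ^ (k * q) * (1 - \<rho>) ^ (k * (m - q)) * s ^ (k * m) / ((s * (1 - \<rho>)) ^ (k * (m - q)) * (s * \<rho>) ^ (k * q))
             * (Gbound (s * (1 - \<rho>)) (s * \<rho>) / texp s) ^ n"
            unfolding X_def by (simp only: divide_self[OF less_imp_neq[OF D, symmetric]] mult_1)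
          have "W * X \<le> \<delta> ^ n"
            unfolding X_def \<rho>_def \<delta>_def
          proof (rule bulk_term_le[OF _ q(2) m\<gamma> assms s(1) W0 W])
            show "1 / 2 < s * (real q / real m)" using False by (simp add: \<rho>_def)
          qed (use q in auto)
          then have "P * (W * X) \<le> (C0 * (real q * real m * real n)) * \<delta> ^ n"
            by (rule PWX) (use \<delta> in simp)
          also have "\<dots> \<le> (C0 * (real n * real n * real n)) * \<delta> ^ n"
            using q mn C0 \<delta> by (intro mult_right_mono mult_left_mono mult_mono) auto
          also have "\<dots> = C0 * (real n ^ 4 * \<delta> ^ n) / real n"
            using n by (simp add: power4_eq_xxxx)
          also have "\<dots> \<le> C0 * B1 / real n" using B1 C0 by (intro divide_right_mono mult_left_mono) auto
          also have "\<dots> \<le> C0 * B1 / real m" using B1 C0 mn m0 by (intro divide_left_mono) auto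
          also have "\<dots> \<le> C / real m" unfolding C_def using C0 B2 by (intro divide_right_mono) auto
          finally show "P * (W * X) \<le> C / real m" .
        qed (use s \<rho> in auto)
      qed
    qed
    have "(\<Sum>c\<in>?c. S c) = (\<Sum>q\<in>{0..m}. \<Sum>c\<in>{c\<in>?c. supp c = q}. S c)"
      using finc supp_le by (intro sum.group[symmetric]) auto
    also have "\<dots> = (\<Sum>c\<in>{c\<in>?c. supp c = 0}. S c) + (\<Sum>q\<in>{1..m}. \<Sum>c\<in>{c\<in>?c. supp c = q}. S c)"
      by (simp add: sum.atLeast_Suc_atMost)
    also have "\<dots> \<le> Z + (\<Sum>q\<in>{1..m}. Z * (C / real m))"
      by (intro add_mono zero sum_mono pos) auto
    also have "\<dots> = (1 + C) * Z" using m0 by (simp add: algebra_simps)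
    finally have dual: "(\<Sum>c\<in>?c. S c) \<le> (1 + C) * Z" .
    define T where "T = (\<Sum>w\<in>tuples_sum {0..2} n. \<Sum>l\<in>tuples_sum {0..2} (k * m). N k m n w l)"
    have "3 ^ m * T \<le> 3 ^ n * (\<Sum>c\<in>?c. S c)"
      using sum_N_le_sum_dual[where n = n and k = k and m = m] unfolding T_def S_def A_def .
    also have "\<dots> \<le> 3 ^ n * ((1 + C) * Z)" using dual by (intro mult_left_mono) auto
    finally have "T / Z \<le> (1 + C) * (3 ^ n / 3 ^ m)"
      using Z0 by (simp add: field_simps)
    also have "(3::real) ^ n / 3 ^ m = 3 powr ((1 - \<gamma>) * real n)"
    proof -
      have "(1 - \<gamma>) * real n = real n - real m" using \<gamma> by (simp add: algebra_simps)
      then show ?thesis by (simp add: powr_diff powr_realpow)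
    qed
    finally show ?thesis by (simp add: T_def Z_def sum_divide_distrib)
  qed
  then show ?thesis by blast
qed

end
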